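(* Let $K$ be a virtual knot or link with oriented virtual diagram $D$, and let $\widehat{\mathcal C}(D)$ be its Khovanov-Lee complex over $\mathbb{Q}$. Within the Karoubi envelope (i.e. regarded as a complex over the Karoubi envelope of the category of $\mathbb{Q}$-vector spaces in which the state spaces live), $\widehat{\mathcal C}(D)$ is homotopy equivalent to a complex with one generator for each alternately coloured smoothing of $K$ on an abstract link diagram with cross cuts (as defined in the context) and with vanishing differentials.
   Context: **Diagrams.** A virtual link diagram is a generic immersion of circles in the plane each of whose double points is either a classical crossing (with over/under information) or a virtual crossing. A semi-arc is a portion of the diagram running from one passage through a classical crossing to the next (passing freely through virtual crossings). The $A$-smoothing of a classical crossing joins the two regions swept out by rotating the over-strand counterclockwise; the $B$-smoothing is the other one. A state (smoothing) $S$ is a choice of $A$ or $B$ at every classical crossing; its cycles are the closed curves resulting from the smoothings (virtual crossings are ignored). Let $n_\pm$ be the numbers of positive/negative classical crossings. **Canonical local convention.** Draw a classical crossing (of either sign) so that both oriented strands point up, with half-edges SW, SE incoming and NW, NE outgoing. Canonical source-sink orientation: SW and NE are oriented toward the crossing, SE and NW away from it. Local order: for the vertical smoothing the left strand is labelled 1 and the right strand 2; for the horizontal smoothing the top strand is labelled 1 and the bottom strand 2. **Cut loci.** A cut locus is placed on each semi-arc whose two ends carry disagreeing source-sink orientations. Every cycle of every state contains an even number of cut loci. (In the abstract link diagram, i.e. the surface with boundary that is a regular neighbourhood of the diagram with bands passing over/under each other at virtual crossings, a cut locus is represented by a cross cut, where a half-twist is inserted.) **Khovanov-Lee complex.** $V=\mathbb{Q}[X]/(X^2-1)$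 with multiplication $m$, $\Delta(1)=1\otimes X+X\otimes1$, $\Delta(X)=X\otimes X+1\otimes 1$, $\eta=0:V\to V$, and bar operation $\overline1=1$, $\overline X=-X$ (linear). For each state $S$ choose arbitrarily a total order of its cycles (global order) and a marked point, not a cut locus, on each cycle; $V(S)=\bigotimes_{\text{cycles}}V$. The complex $\widehat{\mathcal C}(D)$ is $\bigoplus_S V(S)$, with $V(S)$ in homological degree (number of $B$-smoothings in $S$) $-n_-$, and differential the sum of partial differentials $\partial_\tau$ over $A$-smoothed crossings $\tau$. If changing $\tau$ to $B$ turns one cycle into one cycle, $\partial_\tau=\eta=0$. Otherwise $\partial_\tau:V(S)\to V(S')$ is the composite of: (1) permute factors from global order to local order (cycle(s) through $\tau$ first, the one containing strand 1 before the one containing strand 2, then the rest in relative global order), multiplying by the sign of the permutation; (2) on each factor whose cycle passes through $\tau$ apply bar once for each cut locus met travelling from its marked point to $\tau$; (3) apply $m$ to the first two factors or $\Delta$ to the first factor (outputs on the cycles containing strands 1 and 2 respectively); (4) apply bar on each resulting factor once for each cut locus met travelling from $\tau$ (for unaffected cycles: from the marked point in $S$) to the marked point in $S'$; (5) permute to the global order of $S'$, multiplying by the sign. **Coloured smoothings.** Put $\mathbf r=\frac{1+X}{2}$ ("red"), $\mathbf g=\frac{1-X}{2}$ ("green"); these are complementary idempotents in $V$ interchanged by the bar operation. An alternately coloured smoothing of $D$ (on the abstract link diagram with cross cuts) is a state $S$ together with a colouring by red and green of the arcs into which the cut loci divide the cycles of $S$, such that the colour changes at every cut locus and the two strands at each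 smoothed crossing have different colours. The Karoubi envelope of an additive category is the category obtained by formally adjoining images of all idempotent endomorphisms. *)

theory Defs
  imports
    "HOL-Analysis.Analysis"
    "HOL-Library.Poly_Mapping"
    "HOL-Library.FuncSet"
    "HOL-Combinatorics.Permutations"
begin

section \<open>Virtual link diagrams\<close>

text \<open>Component \<open>i < ncomps\<close> is a circle \<open>\<real>/\<int>\<close> with its orientation, immersed in the plane
  \<open>\<complex>\<close> by the 1-periodic curve \<open>curve i\<close>. The set \<open>classical\<close> contains the classical crossings,
  every other double point is a virtual crossing, and \<open>over c\<close> is the passage \<open>(i, t)\<close> of the
  over-strand through the classical crossing \<open>c\<close>.\<close>

record vdiagram =
  ncomps :: nat
  curve :: "nat \<Rightarrow> real \<Rightarrow> complex"
  classical :: "complex set"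
  over :: "complex \<Rightarrow> nat \<times> real"

definition smooth_curve :: "(real \<Rightarrow> complex) \<Rightarrow> bool" where
  "smooth_curve \<gamma> \<longleftrightarrow>
     (\<exists>F :: nat \<Rightarrow> real \<Rightarrow> complex. F 0 = \<gamma> \<and>
        (\<forall>k t. (F k has_vector_derivative F (Suc k) t) (at t)))"

definition velocity :: "vdiagram \<Rightarrow> nat \<times> real \<Rightarrow> complex" where
  "velocity D p = vector_derivative (curve D (fst p)) (at (snd p))"

definition preimages :: "vdiagram \<Rightarrow> complex \<Rightarrow> (nat \<times> real) set" where
  "preimages D z = {(i, t). i < ncomps D \<and> 0 \<le> t \<and> t < 1 \<and> curve D i t = z}"

definition double_points :: "vdiagram \<Rightarrow> complex set" where
  "double_points D = {z. \<exists>p\<in>preimages D z. \<exists>q\<in>preimages D z. p \<noteq> q}"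

text \<open>The determinant of the pair of plane vectors \<open>(u, v)\<close>; it is positive iff \<open>v\<close> points to the
  left of \<open>u\<close>.\<close>

definition plane_det :: "complex \<Rightarrow> complex \<Rightarrow> real" where
  "plane_det u v = Re u * Im v - Im u * Re v"

definition virtual_link_diagram :: "vdiagram \<Rightarrow> bool" where
  "virtual_link_diagram D \<longleftrightarrow>
     (\<forall>i<ncomps D. smooth_curve (curve D i) \<and> (\<forall>t. curve D i (t + 1) = curve D i t)
        \<and> (\<forall>t. velocity D (i, t) \<noteq> 0)) \<and>
     finite (double_points D) \<and>
     (\<forall>z\<in>double_points D. card (preimages D z) = 2 \<and>
        (\<forall>p\<in>preimages D z. \<forall>q\<in>preimages D z. p \<noteq> q \<longrightarrow>
           plane_det (velocity D p) (velocity D q) \<noteq> 0)) \<and>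
     classical D \<subseteq> double_points D \<and>
     (\<forall>c\<in>classical D. over D c \<in> preimages D c)"


section \<open>Abstract link diagrams\<close>

text \<open>What remains of a diagram when virtual crossings are passed freely. Drawn with both strands
  upwards, a classical crossing has one strand going up to the right (from SW to NE) and one going
  up to the left (from SE to NW); \<open>(c, True)\<close> and \<open>(c, False)\<close> denote the passages of these strands
  through \<open>c\<close>, and \<open>next_pass\<close> sends each passage to the following one on the same component.
  The members of \<open>circles\<close> are the components without classical crossings.\<close>

record 'c abstract_diagram =
  crossings :: "'c set"
  positive :: "'c \<Rightarrow> bool"
  next_pass :: "'c \<times> bool \<Rightarrow> 'c \<times> bool"
  circles :: "nat set"

text \<open>The passage of the strand from SW to NE is the one seeing the other strand cross from its
  right to its left.\<close>

definition passage :: "vdiagram \<Rightarrow> complex \<Rightarrow> bool \<Rightarrow> nat \<times> real" where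
  "passage D c r =
     (THE p. p \<in> preimages D c \<and>
        (\<exists>q\<in>preimages D c. if r then plane_det (velocity D p) (velocity D q) > 0
                                else plane_det (velocity D p) (velocity D q) < 0))"

definition next_time :: "vdiagram \<Rightarrow> nat \<Rightarrow> real \<Rightarrow> real" where
  "next_time D i t =
     (THE s. t < s \<and> curve D i s \<in> classical D \<and>
        (\<forall>u. t < u \<and> u < s \<longrightarrow> curve D i u \<notin> classical D))"

definition next_passage :: "vdiagram \<Rightarrow> complex \<times> bool \<Rightarrow> complex \<times> bool" where
  "next_passage D = (\<lambda>(c, r).
     let (i, t) = passage D c r; s = next_time D i t; c' = curve D i s
     in (c', passage D c' True = (i, frac s)))"

text \<open>A crossing is positive iff its over-strand is the one from SW to NE.\<close>

definition abstract_of :: "vdiagram \<Rightarrow> complex abstract_diagram" where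
  "abstract_of D =
     \<lparr>crossings = classical D,
      positive = (\<lambda>c. over D c = passage D c True),
      next_pass = next_passage D,
      circles = {i. i < ncomps D \<and> (\<forall>t. curve D i t \<notin> classical D)}\<rparr>"

datatype corner = SW | SE | NW | NE

text \<open>Points of the diagram up to moving them without meeting a cut locus: \<open>End c k\<close> stands for the
  points of the semi-arc attached to corner \<open>k\<close> of \<open>c\<close> that lie between \<open>c\<close> and the cut locus of
  this semi-arc (if there is one, otherwise for all points of the semi-arc), and \<open>Circle i\<close> for the
  points of a component without classical crossings.\<close>

datatype 'c point = End 'c corner | Circle nat

definition points :: "'c abstract_diagram \<Rightarrow> 'c point set" where
  "points G = {End c k | c k. c \<in> crossings G} \<union> Circle ` circles G"

definition semi_arc :: "'c abstract_diagram \<Rightarrow> 'c point \<Rightarrow> 'c point \<Rightarrow> bool" where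
  "semi_arc G p q \<longleftrightarrow>
     (\<exists>c r c' r'. c \<in> crossings G \<and> next_pass G (c, r) = (c', r') \<and>
        p = End c (if r then NE else NW) \<and> q = End c' (if r' then SW else SE))"

text \<open>The canonical source-sink orientation. The ends of a semi-arc carry disagreeing orientations
  iff both are oriented towards their crossings or both are oriented away from them.\<close>

fun toward :: "corner \<Rightarrow> bool" where
  "toward SW = True" | "toward NE = True" | "toward SE = False" | "toward NW = False"

fun cut :: "'c point \<Rightarrow> 'c point \<Rightarrow> bool" where
  "cut (End c k) (End c' k') = (toward k = toward k')"
| "cut _ _ = False"


section \<open>States\<close>

text \<open>A state is represented by its set of \<open>B\<close>-smoothed crossings. Turning the over-strand
  counterclockwise sweeps out the top and bottom regions at a positive crossing and the left and
  right regions at a negative one; so the \<open>A\<close>-smoothing of a crossing is the vertical smoothing iff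
  the crossing is positive.\<close>

type_synonym 'c state = "'c set"

definition states :: "'c abstract_diagram \<Rightarrow> 'c state set" where
  "states G = Pow (crossings G)"

definition vertical :: "'c abstract_diagram \<Rightarrow> 'c state \<Rightarrow> 'c \<Rightarrow> bool" where
  "vertical G S c \<longleftrightarrow> (c \<notin> S \<longleftrightarrow> positive G c)"

definition strand1 :: "'c abstract_diagram \<Rightarrow> 'c state \<Rightarrow> 'c \<Rightarrow> corner set" where
  "strand1 G S c = (if vertical G S c then {SW, NW} else {NW, NE})"

definition strand2 :: "'c abstract_diagram \<Rightarrow> 'c state \<Rightarrow> 'c \<Rightarrow> corner set" where
  "strand2 G S c = (if vertical G S c then {SE, NE} else {SW, SE})"

text \<open>A point on strand 1, respectively strand 2, of the smoothed crossing.\<close>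

definition point1 :: "'c abstract_diagram \<Rightarrow> 'c state \<Rightarrow> 'c \<Rightarrow> 'c point" where
  "point1 G S c = End c (if vertical G S c then SW else NW)"

definition point2 :: "'c abstract_diagram \<Rightarrow> 'c state \<Rightarrow> 'c \<Rightarrow> 'c point" where
  "point2 G S c = End c (if vertical G S c then SE else SW)"

text \<open>\<open>travel G S p n q\<close>: one can travel from \<open>p\<close> to \<open>q\<close> along a cycle of \<open>S\<close> meeting \<open>n\<close> cut loci.\<close>

inductive travel :: "'c abstract_diagram \<Rightarrow> 'c state \<Rightarrow> 'c point \<Rightarrow> nat \<Rightarrow> 'c point \<Rightarrow> bool"
  for G S p where
  start: "travel G S p 0 p"
| along_arc: "\<lbrakk>travel G S p n q; semi_arc G q r \<or> semi_arc G r q\<rbrakk> \<Longrightarrow>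
     travel G S p (if cut q r then Suc n else n) r"
| along_strand: "\<lbrakk>travel G S p n (End c k); c \<in> crossings G;
     {k, k'} \<subseteq> strand1 G S c \<or> {k, k'} \<subseteq> strand2 G S c\<rbrakk> \<Longrightarrow>
     travel G S p n (End c k')"

definition cycle_of :: "'c abstract_diagram \<Rightarrow> 'c state \<Rightarrow> 'c point \<Rightarrow> 'c point set" where
  "cycle_of G S p = {q. \<exists>n. travel G S p n q}"

definition cycles :: "'c abstract_diagram \<Rightarrow> 'c state \<Rightarrow> 'c point set set" where
  "cycles G S = cycle_of G S ` points G"

text \<open>The number of cut loci met on the way in the better of the two directions. As each cycle
  contains an even number of cut loci, its parity is the same for both directions.\<close>

definition cuts_met :: "'c abstract_diagram \<Rightarrow> 'c state \<Rightarrow> 'c point \<Rightarrow> 'c point \<Rightarrow> nat" where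
  "cuts_met G S p q = (LEAST n. travel G S p n q)"

text \<open>The arcs into which the cut loci divide the cycles.\<close>

definition arc_of :: "'c abstract_diagram \<Rightarrow> 'c state \<Rightarrow> 'c point \<Rightarrow> 'c point set" where
  "arc_of G S p = {q. travel G S p 0 q}"

definition arcs :: "'c abstract_diagram \<Rightarrow> 'c state \<Rightarrow> 'c point set set" where
  "arcs G S = arc_of G S ` points G"

definition hom_degree :: "'c abstract_diagram \<Rightarrow> 'c state \<Rightarrow> int" where
  "hom_degree G S = int (card S) - int (card {c \<in> crossings G. \<not> positive G c})"


section \<open>Vector spaces over the rationals and their Karoubi envelope\<close>

text \<open>\<open>'b vec\<close> is the rational vector space with basis \<open>'b\<close>. The spaces considered are the
  subspaces of these.\<close>

type_synonym 'b vec = "'b \<Rightarrow>\<^sub>0 rat"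

definition vscale :: "rat \<Rightarrow> 'b vec \<Rightarrow> 'b vec" where
  "vscale c v = Poly_Mapping.map ((*) c) v"

abbreviation basis_vec :: "'b \<Rightarrow> 'b vec" where
  "basis_vec b \<equiv> Poly_Mapping.single b 1"

lemma lookup_vscale: "Poly_Mapping.lookup (vscale c v) b = c * Poly_Mapping.lookup v b"
  by (simp add: vscale_def map.rep_eq when_def)

lemma vector_space_vscale: "vector_space vscale"
  by unfold_locales
    (auto intro!: poly_mapping_eqI simp: lookup_vscale lookup_add algebra_simps)

definition lin_ext :: "('b \<Rightarrow> 'a vec) \<Rightarrow> 'b vec \<Rightarrow> 'a vec" where
  "lin_ext \<phi> v = (\<Sum>b\<in>Poly_Mapping.keys v. vscale (Poly_Mapping.lookup v b) (\<phi> b))"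

definition linear_between :: "'a vec set \<Rightarrow> 'b vec set \<Rightarrow> ('a vec \<Rightarrow> 'b vec) \<Rightarrow> bool" where
  "linear_between U W f \<longleftrightarrow>
     (\<forall>u\<in>U. f u \<in> W) \<and>
     (\<forall>u\<in>U. \<forall>v\<in>U. f (u + v) = f u + f v) \<and>
     (\<forall>c. \<forall>u\<in>U. f (vscale c u) = vscale c (f u))"

text \<open>An object \<open>(U, e)\<close> of the Karoubi envelope is a space \<open>U\<close> with an idempotent endomorphism \<open>e\<close>.
  A morphism from \<open>(U, e)\<close> to \<open>(W, e')\<close> is a linear map \<open>f\<close> with \<open>e' \<circ> f \<circ> e = f\<close>; the identity of
  \<open>(U, e)\<close> is \<open>e\<close>. Maps matter only through their values on \<open>U\<close>. A space \<open>U\<close> is regarded as the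
  object \<open>(U, id)\<close>.\<close>

type_synonym 'b kobj = "'b vec set \<times> ('b vec \<Rightarrow> 'b vec)"

definition kar_obj :: "'b kobj \<Rightarrow> bool" where
  "kar_obj A \<longleftrightarrow>
     module.subspace vscale (fst A) \<and> linear_between (fst A) (fst A) (snd A) \<and>
     (\<forall>u\<in>fst A. snd A (snd A u) = snd A u)"

definition kar_hom :: "'a kobj \<Rightarrow> 'b kobj \<Rightarrow> ('a vec \<Rightarrow> 'b vec) \<Rightarrow> bool" where
  "kar_hom A B f \<longleftrightarrow>
     linear_between (fst A) (fst B) f \<and> (\<forall>u\<in>fst A. snd B (f (snd A u)) = f u)"

definition kar_iso :: "'a kobj \<Rightarrow> 'b kobj \<Rightarrow> bool" where
  "kar_iso A B \<longleftrightarrow> kar_obj A \<and> kar_obj B \<and>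
     (\<exists>f g. kar_hom A B f \<and> kar_hom B A g \<and>
        (\<forall>u\<in>fst A. g (f u) = snd A u) \<and> (\<forall>w\<in>fst B. f (g w) = snd B w))"

definition ground_obj :: "unit kobj" where
  "ground_obj = (UNIV, id)"

definition inject :: "'s \<Rightarrow> 'b vec \<Rightarrow> ('s \<times> 'b) vec" where
  "inject s = lin_ext (\<lambda>b. basis_vec (s, b))"

definition component :: "'s \<Rightarrow> ('s \<times> 'b) vec \<Rightarrow> 'b vec" where
  "component s = lin_ext (\<lambda>(s', b). if s' = s then basis_vec b else 0)"

text \<open>Direct sum of a finite family of objects.\<close>

definition kar_sum :: "'s set \<Rightarrow> ('s \<Rightarrow> 'b kobj) \<Rightarrow> ('s \<times> 'b) kobj" where
  "kar_sum I A =
     ({v. Poly_Mapping.keys v \<subseteq> I \<times> UNIV \<and> (\<forall>s\<in>I. component s v \<in> fst (A s))},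
      \<lambda>v. \<Sum>s\<in>I. inject s (snd (A s) (component s v)))"

text \<open>A complex consists of its objects and its differentials, raising the degree by 1.\<close>

type_synonym 'b kcomplex = "(int \<Rightarrow> 'b kobj) \<times> (int \<Rightarrow> 'b vec \<Rightarrow> 'b vec)"

definition kar_complex :: "'b kcomplex \<Rightarrow> bool" where
  "kar_complex C \<longleftrightarrow>
     (\<forall>i. kar_obj (fst C i)) \<and>
     (\<forall>i. kar_hom (fst C i) (fst C (i + 1)) (snd C i)) \<and>
     (\<forall>i. \<forall>u\<in>fst (fst C i). snd C (i + 1) (snd C i u) = 0)"

definition chain_map :: "'a kcomplex \<Rightarrow> 'b kcomplex \<Rightarrow> (int \<Rightarrow> 'a vec \<Rightarrow> 'b vec) \<Rightarrow> bool" where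
  "chain_map C E f \<longleftrightarrow>
     (\<forall>i. kar_hom (fst C i) (fst E i) (f i)) \<and>
     (\<forall>i. \<forall>u\<in>fst (fst C i). f (i + 1) (snd C i u) = snd E i (f i u))"

definition chain_homotopic ::
  "'a kcomplex \<Rightarrow> 'b kcomplex \<Rightarrow> (int \<Rightarrow> 'a vec \<Rightarrow> 'b vec) \<Rightarrow> (int \<Rightarrow> 'a vec \<Rightarrow> 'b vec) \<Rightarrow> bool" where
  "chain_homotopic C E f g \<longleftrightarrow>
     (\<exists>h. (\<forall>i. kar_hom (fst C i) (fst E (i - 1)) (h i)) \<and>
        (\<forall>i. \<forall>u\<in>fst (fst C i). f i u - g i u = snd E (i - 1) (h i u) + h (i + 1) (snd C i u)))"

definition homotopy_equivalent :: "'a kcomplex \<Rightarrow> 'b kcomplex \<Rightarrow> bool" where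
  "homotopy_equivalent C E \<longleftrightarrow> kar_complex C \<and> kar_complex E \<and>
     (\<exists>f g. chain_map C E f \<and> chain_map E C g \<and>
        chain_homotopic C C (\<lambda>i. g i \<circ> f i) (\<lambda>i. snd (fst C i)) \<and>
        chain_homotopic E E (\<lambda>i. f i \<circ> g i) (\<lambda>i. snd (fst E i)))"


section \<open>The algebra V and its tensor powers\<close>

text \<open>\<open>V1\<close> and \<open>VX\<close> are the basis elements \<open>1\<close> and \<open>X\<close> of \<open>V = \<rat>[X]/(X\<^sup>2 - 1)\<close>. The words of length \<open>k\<close> in these form the standard
  basis of the \<open>k\<close>-th tensor power of \<open>V\<close>.\<close>

datatype gen = V1 | VX

type_synonym word = "gen list"

fun gen_mult :: "gen \<Rightarrow> gen \<Rightarrow> gen" where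
  "gen_mult V1 b = b"
| "gen_mult VX V1 = VX"
| "gen_mult VX VX = V1"

definition V_mult :: "gen vec \<Rightarrow> gen vec \<Rightarrow> gen vec" where
  "V_mult x y = lin_ext (\<lambda>a. lin_ext (\<lambda>b. basis_vec (gen_mult a b)) y) x"

definition bar :: "gen vec \<Rightarrow> gen vec" where
  "bar = lin_ext (\<lambda>a. case a of V1 \<Rightarrow> basis_vec V1 | VX \<Rightarrow> - basis_vec VX)"

text \<open>The tensor product \<open>x\<^sub>1 \<otimes> \<dots> \<otimes> x\<^sub>k\<close> of a list of vectors.\<close>

fun tensor :: "gen vec list \<Rightarrow> word vec" where
  "tensor [] = basis_vec []"
| "tensor (x # xs) = lin_ext (\<lambda>a. lin_ext (\<lambda>w. basis_vec (a # w)) (tensor xs)) x"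

definition factorwise :: "(gen vec \<Rightarrow> gen vec) list \<Rightarrow> word vec \<Rightarrow> word vec" where
  "factorwise fs = lin_ext (\<lambda>w. tensor (map2 (\<lambda>f a. f (basis_vec a)) fs w))"

definition merge :: "word vec \<Rightarrow> word vec" where
  "merge = lin_ext (\<lambda>w. case w of a # b # u \<Rightarrow> basis_vec (gen_mult a b # u) | _ \<Rightarrow> 0)"

definition split_off :: "word vec \<Rightarrow> word vec" where
  "split_off = lin_ext (\<lambda>w. case w of
       V1 # u \<Rightarrow> basis_vec (V1 # VX # u) + basis_vec (VX # V1 # u)
     | VX # u \<Rightarrow> basis_vec (VX # VX # u) + basis_vec (V1 # V1 # u)
     | [] \<Rightarrow> 0)"

text \<open>Permute tensor factors indexed by the entries of the list \<open>L\<close> into the order of the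
  rearrangement \<open>M\<close> of \<open>L\<close>, multiplying by the sign of the permutation.\<close>

definition reorder :: "'x list \<Rightarrow> 'x list \<Rightarrow> word vec \<Rightarrow> word vec" where
  "reorder L M =
     (let \<pi> = (THE \<pi>. \<pi> permutes {..<length L} \<and> permute_list \<pi> L = M)
      in lin_ext (\<lambda>w. vscale (of_int (sign \<pi>)) (basis_vec (permute_list \<pi> w))))"


section \<open>The Khovanov-Lee complex\<close>

text \<open>The choices: a total order of the cycles of each state, given as a list, and a marked point on
  each cycle of each state.\<close>

type_synonym 'c order_choice = "'c state \<Rightarrow> 'c point set list"
type_synonym 'c mark_choice = "'c state \<Rightarrow> 'c point set \<Rightarrow> 'c point"

definition global_orders :: "'c abstract_diagram \<Rightarrow> 'c order_choice \<Rightarrow> bool" where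
  "global_orders G ord \<longleftrightarrow> (\<forall>S\<in>states G. distinct (ord S) \<and> set (ord S) = cycles G S)"

definition marked_points :: "'c abstract_diagram \<Rightarrow> 'c mark_choice \<Rightarrow> bool" where
  "marked_points G mark \<longleftrightarrow> (\<forall>S\<in>states G. \<forall>C\<in>cycles G S. mark S C \<in> C)"

definition state_space :: "'c order_choice \<Rightarrow> 'c state \<Rightarrow> word vec set" where
  "state_space ord S = {v. Poly_Mapping.keys v \<subseteq> {w. length w = length (ord S)}}"

text \<open>The one or two cycles through \<open>\<tau>\<close>, in local order.\<close>

definition local_cycles :: "'c abstract_diagram \<Rightarrow> 'c state \<Rightarrow> 'c \<Rightarrow> 'c point set list" where
  "local_cycles G S \<tau> =
     (let C1 = cycle_of G S (point1 G S \<tau>); C2 = cycle_of G S (point2 G S \<tau>)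
      in if C1 = C2 then [C1] else [C1, C2])"

text \<open>A point at \<open>\<tau>\<close> on the cycle \<open>C\<close> passing through \<open>\<tau>\<close>.\<close>

definition point_at :: "'c abstract_diagram \<Rightarrow> 'c state \<Rightarrow> 'c \<Rightarrow> 'c point set \<Rightarrow> 'c point" where
  "point_at G S \<tau> C = (if point1 G S \<tau> \<in> C then point1 G S \<tau> else point2 G S \<tau>)"

definition partial_diff ::
  "'c abstract_diagram \<Rightarrow> 'c order_choice \<Rightarrow> 'c mark_choice \<Rightarrow> 'c state \<Rightarrow> 'c \<Rightarrow> word vec \<Rightarrow> word vec"
where
  "partial_diff G ord mark S \<tau> =
     (let S' = insert \<tau> S;
          L = local_cycles G S \<tau>;
          L' = local_cycles G S' \<tau>;
          rest = filter (\<lambda>C. C \<notin> set L) (ord S);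
          bars_before = map (\<lambda>C. cuts_met G S (mark S C) (point_at G S \<tau> C)) L @
                        map (\<lambda>C. 0) rest;
          bars_after = map (\<lambda>C. cuts_met G S' (point_at G S' \<tau> C) (mark S' C)) L' @
                       map (\<lambda>C. cuts_met G S (mark S C) (mark S' C)) rest
      in if length L = 1 \<and> length L' = 1 then (\<lambda>v. 0)
         else reorder (L' @ rest) (ord S')
              \<circ> factorwise (map (\<lambda>n. bar ^^ n) bars_after)
              \<circ> (if length L = 2 then merge else split_off)
              \<circ> factorwise (map (\<lambda>n. bar ^^ n) bars_before)
              \<circ> reorder (ord S) (L @ rest))"

definition khovanov_lee ::
  "'c abstract_diagram \<Rightarrow> 'c order_choice \<Rightarrow> 'c mark_choice \<Rightarrow> ('c state \<times> word) kcomplex"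
where
  "khovanov_lee G ord mark =
     (\<lambda>i. kar_sum {S \<in> states G. hom_degree G S = i} (\<lambda>S. (state_space ord S, id)),
      \<lambda>i v. \<Sum>S | S \<in> states G \<and> hom_degree G S = i. \<Sum>\<tau>\<in>crossings G - S.
        inject (insert \<tau> S) (partial_diff G ord mark S \<tau> (component S v)))"


section \<open>Alternately coloured smoothings\<close>

datatype colour = Red | Green

definition alternately_coloured ::
  "'c abstract_diagram \<Rightarrow> ('c state \<times> ('c point set \<Rightarrow> colour)) set" where
  "alternately_coloured G =
     {(S, col). S \<in> states G \<and> col \<in> arcs G S \<rightarrow>\<^sub>E UNIV \<and>
        (\<forall>p q. semi_arc G p q \<and> cut p q \<longrightarrow> col (arc_of G S p) \<noteq> col (arc_of G S q)) \<and>
        (\<forall>c\<in>crossings G. col (arc_of G S (point1 G S c)) \<noteq> col (arc_of G S (point2 G S c)))}"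

fun colour_idem :: "colour \<Rightarrow> gen vec" where
  "colour_idem Red = vscale (1 / 2) (basis_vec V1 + basis_vec VX)"
| "colour_idem Green = vscale (1 / 2) (basis_vec V1 - basis_vec VX)"

text \<open>The object of the Karoubi envelope given by a coloured smoothing: on the factor of each cycle
  the idempotent is multiplication by \<open>r\<close> or \<open>g\<close>, according to the colour at the marked point.\<close>

definition colour_obj ::
  "'c abstract_diagram \<Rightarrow> 'c order_choice \<Rightarrow> 'c mark_choice \<Rightarrow>
   'c state \<times> ('c point set \<Rightarrow> colour) \<Rightarrow> word kobj" where
  "colour_obj G ord mark = (\<lambda>(S, col).
     (state_space ord S,
      factorwise (map (\<lambda>C. V_mult (colour_idem (col (arc_of G S (mark S C))))) (ord S))))"

end

theory Submission
  imports Defs "HOL-Combinatorics.Orbits"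
begin

text \<open>In the basis of red and green idempotents the bar operation exchanges the two colours, so a basis
  vector of \<open>V(S)\<close> is a colouring of the points of the diagram which changes exactly at the cut loci
  and is constant along the strands of \<open>S\<close>. A partial differential either kills such a vector (if the
  two strands at the crossing have different colours) or keeps the colouring and multiplies the vector by a
  nonzero scalar. So the complex is a direct sum over the colourings of cubes whose directions are
  the crossings with four corners of the same colour; such a cube is contractible unless it is a point, and
  the points are the alternately coloured smoothings.

  What remains is to see that the scalars anticommute around the squares of a cube. A colouring orients
  all cycles: red arcs carry the canonical orientation, green ones the opposite orientation. The cycles
  become the orbits of a permutation of the ends of the oriented strands, and resmoothing a crossing composes it with
  a transposition. The cycles missing the two crossings of a square contribute only squares of signs, so
  anticommutation depends only on the first return permutation on four points, which leaves 24 cases.\<close>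

text \<open>The scalars mix data that cannot be compared between states: the global orders, the
  local order of the strands, and the colour, as \<open>Delta\<close> sends \<open>r\<close> to
  \<open>2 (r tensor r)\<close> but \<open>g\<close> to \<open>-2 (g tensor g)\<close>. Two devices
  separate them. The sign of a reordering is the product of the inversion signs of the two lists
  under any common injective numbering of the cycles, so a global order contributes one factor
  attached to its state; around a square the factors of the two intermediate states square to 1, and
  those of the first and the last state are common to both ways. The colour disappears when the
  strands are named after their exits: in a green splitting the exits are numbered against the local
  order of the new state, and the sign of this exchange is the minus sign in \<open>-2\<close>. One
  cycle turned into one cycle causes no trouble: resmoothing a crossing of one colour respects the
  orientation and so changes the number of cycles, while at a crossing of two colours the parity of
  cut loci forbids one cycle to split. The homotopy divides by the scalars, which are 1 or 2 up to
  sign.\<close>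

interpretation vec: vector_space "vscale :: rat \<Rightarrow> 'b vec \<Rightarrow> 'b vec"
  by (rule vector_space_vscale)

interpretation vlin: vector_space_pair "vscale :: rat \<Rightarrow> 'a vec \<Rightarrow> 'a vec" "vscale :: rat \<Rightarrow> 'b vec \<Rightarrow> 'b vec"
  by unfold_locales

section \<open>Linear maps given by their values on the standard basis\<close>

abbreviation coef :: "'b vec \<Rightarrow> 'b \<Rightarrow> rat" where
  "coef \<equiv> Poly_Mapping.lookup"

abbreviation vlinear :: "('a vec \<Rightarrow> 'b vec) \<Rightarrow> bool" where
  "vlinear \<equiv> Vector_Spaces.linear vscale vscale"

lemma vlinearI:
  assumes "\<And>u v. f (u + v) = f u + f v" "\<And>c u. f (vscale c u) = vscale c (f u)"
  shows "vlinear f"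
  unfolding Vector_Spaces.linear_iff by (intro conjI allI vector_space_vscale assms)

lemma vlinear_id [simp]: "vlinear (\<lambda>v. v)" "vlinear id"
  by (auto intro: vlinearI)

lemma vlinear_o: "vlinear f \<Longrightarrow> vlinear g \<Longrightarrow> vlinear (g \<circ> f)"
  by (rule Vector_Spaces.linear_compose)

lemma vlinear_compose: "vlinear f \<Longrightarrow> vlinear g \<Longrightarrow> vlinear (\<lambda>v. g (f v))"
  using vlinear_o[of f g] by (simp add: o_def)

lemma vlinear_sum:
  assumes "\<And>i. i \<in> I \<Longrightarrow> vlinear (f i)"
  shows "vlinear (\<lambda>v. \<Sum>i\<in>I. f i v)"
  by (rule vlin.linear_compose_sum) (use assms in auto)

lemma vlinear_vscale: "vlinear f \<Longrightarrow> vlinear (\<lambda>v. vscale c (f v))"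
  by (rule vlin.linear_compose_scale_right)

text \<open>The sum defining \<open>lin_ext\<close> runs over the support of its argument, which
  varies with the argument. Over a common finite superset of the supports such sums can be added
  term by term.\<close>

lemma lin_ext_superset:
  assumes "finite A" "Poly_Mapping.keys v \<subseteq> A"
  shows "lin_ext \<phi> v = (\<Sum>b\<in>A. vscale (coef v b) (\<phi> b))"
  unfolding lin_ext_def
  by (rule sum.mono_neutral_left) (use assms in \<open>auto simp: in_keys_iff\<close>)

lemma vlinear_lin_ext: "vlinear (lin_ext \<phi>)"
proof (rule vlinearI)
  fix u v :: "'a vec" and c
  let ?A = "Poly_Mapping.keys u \<union> Poly_Mapping.keys v"
  have "Poly_Mapping.keys (u + v) \<subseteq> ?A"
    by (rule Poly_Mapping.keys_add)
  then show "lin_ext \<phi> (u + v) = lin_ext \<phi> u + lin_ext \<phi> v"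
    by (simp add: lin_ext_superset[where A = ?A] lookup_add vec.scale_left_distrib sum.distrib)
  have "Poly_Mapping.keys (vscale c u) \<subseteq> Poly_Mapping.keys u"
    by (auto simp: in_keys_iff lookup_vscale)
  then show "lin_ext \<phi> (vscale c u) = vscale c (lin_ext \<phi> u)"
    by (simp add: lin_ext_superset[where A = "Poly_Mapping.keys u"] lookup_vscale
        vec.scale_sum_right)
qed

lemma lin_ext_basis_vec [simp]: "lin_ext \<phi> (basis_vec b) = \<phi> b"
  by (simp add: lin_ext_def)

lemma vec_expansion:
  "v = (\<Sum>b\<in>Poly_Mapping.keys v. vscale (coef v b) (basis_vec b))"
  by (rule poly_mapping_eqI)
    (simp add: lookup_sum lookup_vscale lookup_single mult_when, simp add: when_def in_keys_iff)

lemma in_span_basis_vec: "v \<in> vec.span (basis_vec ` Poly_Mapping.keys v)"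
  by (subst (1) vec_expansion) (intro vec.span_sum vec.span_scale vec.span_base imageI)

lemma vlinear_eqI:
  assumes "vlinear f" "vlinear g" "\<And>b. f (basis_vec b) = g (basis_vec b)"
  shows "f v = g v"
  by (rule vlin.linear_eq_on[OF assms(1,2) in_span_basis_vec]) (use assms(3) in auto)

text \<open>Linearity in a parameter of the family instead of the argument; it makes
  \<open>V_mult\<close> and \<open>tcons\<close> linear in their second arguments.\<close>

lemma vlinear_lin_ext_family:
  assumes "\<And>a. vlinear (\<lambda>v. \<phi> v a)"
  shows "vlinear (\<lambda>v. lin_ext (\<phi> v) x)"
  unfolding lin_ext_def by (intro vlinear_sum vlinear_vscale assms)

lemma lookup_lin_ext:
  "coef (lin_ext \<phi> v) a =
     (\<Sum>b\<in>Poly_Mapping.keys v. coef v b * coef (\<phi> b) a)"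
  by (simp add: lin_ext_def lookup_sum lookup_vscale)

lemma vlinear_factorwise: "vlinear (factorwise fs)"
  and vlinear_merge: "vlinear merge"
  and vlinear_split_off: "vlinear split_off"
  and vlinear_reorder: "vlinear (reorder L M)"
  and vlinear_inject: "vlinear (inject s)"
  and vlinear_component: "vlinear (component s)"
  and vlinear_bar: "vlinear bar"
  by (simp_all add: factorwise_def merge_def split_off_def reorder_def inject_def component_def
      bar_def Let_def vlinear_lin_ext)

lemma vlinear_V_mult: "vlinear (V_mult x)"
  unfolding V_mult_def[abs_def]
  by (intro vlinear_lin_ext_family vlinear_lin_ext)

lemma vlinear_V_mult_left: "vlinear (\<lambda>x. V_mult x y)"
  unfolding V_mult_def[abs_def] by (rule vlinear_lin_ext)

lemma V_mult_basis_vec [simp]: "V_mult (basis_vec a) (basis_vec b) = basis_vec (gen_mult a b)"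
  by (simp add: V_mult_def)

subsection \<open>Tensors\<close>

text \<open>The binary product contained in \<open>tensor\<close>, for arbitrary second arguments,
  so that bilinearity can be used where the tail is not a pure tensor.\<close>

definition tcons :: "gen vec \<Rightarrow> word vec \<Rightarrow> word vec" where
  "tcons x t = lin_ext (\<lambda>a. lin_ext (\<lambda>w. basis_vec (a # w)) t) x"

lemma tensor_Cons: "tensor (x # xs) = tcons x (tensor xs)"
  by (simp add: tcons_def)

lemma vlinear_tcons: "vlinear (tcons x)"
  unfolding tcons_def[abs_def] by (intro vlinear_lin_ext_family vlinear_lin_ext)

lemma vlinear_tcons_left: "vlinear (\<lambda>x. tcons x t)"
  unfolding tcons_def[abs_def] by (rule vlinear_lin_ext)

lemma tcons_basis_vec [simp]: "tcons (basis_vec a) (basis_vec w) = basis_vec (a # w)"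
  by (simp add: tcons_def)

declare tensor.simps(2) [simp del]
declare tensor_Cons [simp]

lemmas vlinear_intros =
  vlinear_id vlinear_tcons vlinear_tcons_left vlinear_factorwise vlinear_merge vlinear_split_off
  vlinear_V_mult vlinear_V_mult_left vlinear_vscale
  vlinear_compose[OF _ vlinear_tcons] vlinear_compose[OF _ vlinear_tcons_left]
  vlinear_compose[OF _ vlinear_factorwise] vlinear_compose[OF _ vlinear_merge]
  vlinear_compose[OF _ vlinear_split_off] vlinear_compose[OF _ vlinear_V_mult]
  vlinear_compose[OF _ vlinear_V_mult_left]

lemma bilinear_eqI:
  assumes "\<And>t. vlinear (\<lambda>x. F x t)" "\<And>x. vlinear (F x)"
    and "\<And>t. vlinear (\<lambda>x. G x t)" "\<And>x. vlinear (G x)"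
    and "\<And>a b. F (basis_vec a) (basis_vec b) = G (basis_vec a) (basis_vec b)"
  shows "F x t = G x t"
proof -
  have "F (basis_vec a) t = G (basis_vec a) t" for a
    by (rule vlinear_eqI[of "F (basis_vec a)" "G (basis_vec a)"]) (use assms in auto)
  then show ?thesis
    by (rule vlinear_eqI[of "\<lambda>x. F x t" "\<lambda>x. G x t", OF assms(1,3)])
qed

text \<open>Both sides are bilinear in \<open>x\<close> and \<open>t\<close>, and on basis vectors
  the equation is the definition of \<open>factorwise\<close>.\<close>

lemma factorwise_Cons_tcons:
  assumes "vlinear f"
  shows "factorwise (f # fs) (tcons x t) = tcons (f x) (factorwise fs t)"
proof (rule bilinear_eqI[of "\<lambda>x t. factorwise (f # fs) (tcons x t)"
      "\<lambda>x t. tcons (f x) (factorwise fs t)"])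
  show "factorwise (f # fs) (tcons (basis_vec a) (basis_vec b)) =
      tcons (f (basis_vec a)) (factorwise fs (basis_vec b))" for a b
    by (simp add: factorwise_def)
qed (intro vlinear_intros assms vlinear_compose[OF assms])+

lemma factorwise_tensor:
  assumes "length fs = length xs" "\<And>f. f \<in> set fs \<Longrightarrow> vlinear f"
  shows "factorwise fs (tensor xs) = tensor (map2 (\<lambda>f x. f x) fs xs)"
  using assms
proof (induction fs xs rule: list_induct2)
  case Nil
  then show ?case by (simp add: factorwise_def)
next
  case (Cons f fs x xs)
  then show ?case by (simp add: factorwise_Cons_tcons)
qed

lemma merge_tcons: "merge (tcons x (tcons y t)) = tcons (V_mult x y) t"
proof -
  have "merge (tcons (basis_vec a) (tcons y t)) = tcons (V_mult (basis_vec a) y) t" for a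
    by (rule bilinear_eqI[of "\<lambda>y t. merge (tcons (basis_vec a) (tcons y t))"
          "\<lambda>y t. tcons (V_mult (basis_vec a) y) t"])
      (intro vlinear_intros | simp add: merge_def)+
  then show ?thesis
    by (rule vlinear_eqI[of "\<lambda>x. merge (tcons x (tcons y t))" "\<lambda>x. tcons (V_mult x y) t",
          rotated 2]) (intro vlinear_intros)+
qed

text \<open>From here on colours are Booleans, with \<open>True\<close> for red, so that a colouring
  is a predicate on points and the bar operation is negation.\<close>

abbreviation cidem :: "bool \<Rightarrow> gen vec" where
  "cidem b \<equiv> colour_idem (if b then Red else Green)"

lemma vec_gen_eqI:
  "coef x V1 = coef y V1 \<Longrightarrow>
   coef x VX = coef y VX \<Longrightarrow> x = (y :: gen vec)"
  by (rule poly_mapping_eqI) (metis gen.exhaust)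

lemmas vlin_simps =
  vlin.linear_add vlin.linear_scale vlin.linear_0 vlin.linear_diff vlin.linear_sum

lemma V_mult_cidem: "V_mult (cidem a) (cidem b) = (if a = b then cidem a else 0)"
  by (auto simp: vlin_simps[OF vlinear_V_mult] vlin_simps[OF vlinear_V_mult_left]
      intro!: vec_gen_eqI simp: lookup_vscale lookup_add lookup_minus lookup_single when_def)

lemma bar_cidem: "bar (cidem b) = cidem (\<not> b)"
  by (auto simp: vlin_simps[OF vlinear_bar]) (simp_all add: bar_def)

lemma bar_funpow_cidem: "(bar ^^ n) (cidem b) = cidem (b = even n)"
  by (induction n) (auto simp: bar_cidem simp del: colour_idem.simps)

lemma vlinear_bar_funpow: "vlinear (bar ^^ n)"
proof (induction n)
  case (Suc n)
  then show ?case
    using vlinear_compose[OF _ vlinear_bar] by (simp add: o_def)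
qed simp

text \<open>\<open>Delta(1 + X)\<close> is \<open>(1 + X) tensor (1 + X)\<close> and
  \<open>Delta(1 - X)\<close> is \<open>-(1 - X) tensor (1 - X)\<close>. Halving the arguments
  leaves the factors \<open>2\<close> and \<open>-2\<close>, because the tensor squares of the
  idempotents carry \<open>1/4\<close>.\<close>

lemma split_off_tcons:
  "split_off (tcons (cidem b) t) =
     vscale (if b then 2 else - 2) (tcons (cidem b) (tcons (cidem b) t))"
proof (rule vlinear_eqI[of "\<lambda>t. split_off (tcons (cidem b) t)"
      "\<lambda>t. vscale (if b then 2 else - 2) (tcons (cidem b) (tcons (cidem b) t))"])
  fix w
  show "split_off (tcons (cidem b) (basis_vec w)) =
    vscale (if b then 2 else - 2) (tcons (cidem b) (tcons (cidem b) (basis_vec w)))"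
    by (auto simp: vlin_simps[OF vlinear_tcons] vlin_simps[OF vlinear_tcons_left]
      vlin_simps[OF vlinear_split_off])
     (auto simp: split_off_def intro!: poly_mapping_eqI
       simp: lookup_vscale lookup_add lookup_minus algebra_simps)
qed (intro vlinear_intros)+

lemma lookup_tcons:
  "coef (tcons x t) (a # w) = coef x a * coef t w"
  "coef (tcons x t) [] = 0"
proof -
  have *: "coef (lin_ext (\<lambda>w. basis_vec (b # w)) t) (a # w) =
      (if a = b then coef t w else 0)" for b
    by (cases "a = b") (simp_all add: lookup_lin_ext lookup_single mult_when, simp add: when_def in_keys_iff)
  show "coef (tcons x t) (a # w) = coef x a * coef t w"
    by (auto simp: tcons_def lookup_lin_ext[of _ x] * in_keys_iff if_distrib cong: if_cong)
  show "coef (tcons x t) [] = 0"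
    by (simp add: tcons_def lookup_lin_ext lookup_single)
qed

lemma lookup_tensor:
  "coef (tensor xs) w =
     (if length w = length xs then \<Prod>i<length xs. coef (xs ! i) (w ! i) else 0)"
proof (induction xs arbitrary: w)
  case Nil
  then show ?case by (simp add: lookup_single when_def)
next
  case (Cons x xs)
  show ?case
    by (cases w) (simp_all add: lookup_tcons Cons.IH prod.lessThan_Suc_shift del: prod.lessThan_Suc)
qed

lemma tensor_zero: "0 \<in> set xs \<Longrightarrow> tensor xs = 0"
  by (induction xs) (auto simp: vlin_simps[OF vlinear_tcons] vlin_simps[OF vlinear_tcons_left])

lemma keys_tensor: "Poly_Mapping.keys (tensor xs) \<subseteq> {w. length w = length xs}"
  by (auto simp: in_keys_iff lookup_tensor split: if_splits)

text \<open>Compared coefficientwise: among words of the right length exactly one is permuted to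
  \<open>w\<close>, namely the inversely permuted \<open>w\<close>, and its coefficient is a product
  over positions, which is reindexed along \<open>\<pi>\<close>.\<close>

lemma permute_list_basis_tensor:
  assumes \<pi>: "\<pi> permutes {..<length xs}"
  shows "lin_ext (\<lambda>w. basis_vec (permute_list \<pi> w)) (tensor xs) = tensor (permute_list \<pi> xs)"
proof (rule poly_mapping_eqI)
  fix w :: word
  let ?n = "length xs" and ?v = "tensor xs"
  show "coef (lin_ext (\<lambda>w. basis_vec (permute_list \<pi> w)) ?v) w =
      coef (tensor (permute_list \<pi> xs)) w"
  proof (cases "length w = ?n")
    case False
    then have "permute_list \<pi> u \<noteq> w" if "u \<in> Poly_Mapping.keys ?v" for u
      using that keys_tensor[of xs] by auto
    then show ?thesis
      using False by (simp add: lookup_lin_ext lookup_single lookup_tensor sum.neutral)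
  next
    case True
    let ?u = "permute_list (inv \<pi>) w"
    have inv: "inv \<pi> permutes {..<?n}"
      using \<pi> by (rule permutes_inv)
    have iff: "permute_list \<pi> u = w \<longleftrightarrow> u = ?u" if "u \<in> Poly_Mapping.keys ?v" for u
    proof -
      have "length u = ?n"
        using that keys_tensor[of xs] by auto
      then show ?thesis
        using True \<pi> inv permute_list_compose[of "inv \<pi>" u \<pi>] permute_list_compose[of \<pi> w "inv \<pi>"]
          permutes_inv_o[OF \<pi>] permute_list_compose[of \<pi> u "inv \<pi>"]
          permute_list_compose[of "inv \<pi>" w \<pi>]
        by auto
    qed
    have "coef (lin_ext (\<lambda>w. basis_vec (permute_list \<pi> w)) ?v) w =
        (\<Sum>u\<in>Poly_Mapping.keys ?v. if u = ?u then coef ?v u else 0)"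
      unfolding lookup_lin_ext lookup_single by (intro sum.cong) (auto simp: iff when_def)
    also have "\<dots> = coef ?v ?u"
      by (simp add: in_keys_iff)
    also have "\<dots> = (\<Prod>i<?n. coef (xs ! i) (?u ! i))"
      using True by (simp add: lookup_tensor)
    also have "\<dots> = (\<Prod>i<?n. coef (xs ! i) (w ! inv \<pi> i))"
      using True inv by (intro prod.cong) (auto simp: permute_list_nth)
    also have "\<dots> = (\<Prod>i<?n. coef (xs ! \<pi> i) (w ! inv \<pi> (\<pi> i)))"
      by (rule prod.reindex_bij_betw[OF permutes_imp_bij[OF \<pi>], symmetric])
    also have "\<dots> = coef (tensor (permute_list \<pi> xs)) w"
      using True \<pi> by (auto simp: lookup_tensor permute_list_nth permutes_inverses intro!: prod.cong)
    finally show ?thesis .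
  qed
qed

subsection \<open>Inversion signs\<close>

abbreviation transp :: "'x \<Rightarrow> 'x \<Rightarrow> 'x \<Rightarrow> 'x" where
  "transp \<equiv> Transposition.transpose"

definition less_sign :: "nat \<Rightarrow> nat \<Rightarrow> int" where
  "less_sign x y = (if x < y then 1 else - 1)"

text \<open>For a list without repetitions this is the sign of the permutation that sorts it,
  computed from its inversions.\<close>

fun inv_sign :: "nat list \<Rightarrow> int" where
  "inv_sign [] = 1"
| "inv_sign (x # xs) = (\<Prod>y\<leftarrow>xs. less_sign x y) * inv_sign xs"

text \<open>The inversions between two blocks of a list, that is, the correction by which
  \<open>inv_sign\<close> fails to be multiplicative under concatenation.\<close>

definition cross :: "nat list \<Rightarrow> nat list \<Rightarrow> int" where
  "cross xs ys = (\<Prod>x\<leftarrow>xs. \<Prod>y\<leftarrow>ys. less_sign x y)"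

lemma prod_list_1 [simp]: "(\<Prod>x\<leftarrow>xs. 1 :: int) = 1"
  by (induction xs) auto

lemma cross_Nil [simp]: "cross [] ys = 1" "cross xs [] = 1"
  by (simp_all add: cross_def)

lemma prod_list_mult: "(\<Prod>x\<leftarrow>xs. f x * g x :: int) = (\<Prod>x\<leftarrow>xs. f x) * (\<Prod>x\<leftarrow>xs. g x)"
  by (induction xs) auto

lemma cross_append_right: "cross xs (ys @ zs) = cross xs ys * cross xs zs"
  by (simp add: cross_def prod_list_mult)

lemma cross_Cons_right: "cross xs (y # ys) = cross xs [y] * cross xs ys"
  using cross_append_right[of xs "[y]" ys] by simp

lemma inv_sign_append: "inv_sign (xs @ ys) = inv_sign xs * inv_sign ys * cross xs ys"
  by (induction xs) (simp_all add: cross_def mult_ac)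

lemma inv_sign_Cons: "inv_sign (x # xs) = cross [x] xs * inv_sign xs"
  by (simp add: cross_def)

declare inv_sign.simps(2) [simp del]

lemma less_sign_swap: "x \<noteq> y \<Longrightarrow> less_sign y x = - less_sign x y"
  by (auto simp: less_sign_def)

lemma less_sign_square [simp]: "less_sign x y * less_sign x y = 1"
  by (simp add: less_sign_def)

lemma cross_square [simp]: "cross xs ys * cross xs ys = 1"
proof -
  have "(\<Prod>y\<leftarrow>ys. less_sign x y) * (\<Prod>y\<leftarrow>ys. less_sign x y) = 1" for x
    by (simp flip: prod_list_mult)
  then show ?thesis
    by (simp add: cross_def flip: prod_list_mult)
qed

lemma inv_sign_square [simp]: "inv_sign xs * inv_sign xs = 1"
proof (induction xs)
  case (Cons x xs)
  have "inv_sign (x # xs) * inv_sign (x # xs) = (cross [x] xs * cross [x] xs) * (inv_sign xs * inv_sign xs)"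
    by (simp only: inv_sign_Cons mult_ac)
  with Cons show ?case by simp
qed simp

lemma cross_swap_singleton:
  "x \<notin> set xs \<Longrightarrow> cross xs [x] = (- 1) ^ length xs * cross [x] xs"
proof (induction xs)
  case (Cons y ys)
  then have "less_sign y x = - less_sign x y"
    by (intro less_sign_swap) auto
  with Cons show ?case
    by (simp add: cross_def)
qed simp

text \<open>Each of \<open>x\<close> and \<open>y\<close> is moved past \<open>B\<close>, which
  changes the sign \<open>2 * length B\<close> times altogether, and the comparison of
  \<open>x\<close> with \<open>y\<close> is reversed once.\<close>

lemma inv_sign_swap:
  assumes "distinct (A @ x # B @ y # C)"
  shows "inv_sign (A @ y # B @ x # C) = - inv_sign (A @ x # B @ y # C)"
proof -
  have "cross B [x] = (- 1) ^ length B * cross [x] B" "cross B [y] = (- 1) ^ length B * cross [y] B"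
    "cross [y] [x] = - cross [x] [y]"
    using assms less_sign_swap[of x y] cross_swap_singleton[of x B] cross_swap_singleton[of y B]
    by (auto simp: cross_def)
  moreover have gen: "inv_sign (A @ U @ B @ V @ C) = inv_sign A * inv_sign B * inv_sign C * inv_sign U * inv_sign V * cross U B *
      cross U V * cross U C * cross B V * cross B C * cross V C * cross A U * cross A B *
      cross A V * cross A C" for U V
    by (simp add: inv_sign_append cross_append_right mult_ac)
  moreover have "inv_sign [u] = 1" for u
    by (simp add: inv_sign_Cons)
  ultimately show ?thesis
    using gen[of "[x]" "[y]"] gen[of "[y]" "[x]"] by simp
qed

lemma inv_sign_transpose:
  assumes "distinct xs" "i < j" "j < length xs"
  shows "inv_sign (permute_list (transp i j) xs) = - inv_sign xs"
proof -
  define A B C x y where ABC: "A = take i xs" "B = take (j - Suc i) (drop (Suc i) xs)"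
    "C = drop (Suc j) xs" and xy: "x = xs ! i" "y = xs ! j"
  have l: "length A = i" "length B = j - Suc i"
    using assms by (auto simp: ABC)
  have "xs = A @ x # drop (Suc i) xs"
    unfolding ABC xy using assms by (intro id_take_nth_drop) auto
  moreover have "drop (Suc i) xs = B @ drop (Suc i) xs ! (j - Suc i) # drop (Suc (j - Suc i)) (drop (Suc i) xs)"
    unfolding ABC using assms by (intro id_take_nth_drop) auto
  moreover have "drop (Suc i) xs ! (j - Suc i) = y" "drop (Suc (j - Suc i)) (drop (Suc i) xs) = C"
    using assms by (simp_all add: ABC xy)
  ultimately have xs: "xs = A @ x # B @ y # C"
    by metis
  have "permute_list (transp i j) xs = A @ y # B @ x # C"
  proof (rule nth_equalityI)
    show "length (permute_list (transp i j) xs) = length (A @ y # B @ x # C)"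
      by (simp add: xs)
    fix k assume "k < length (permute_list (transp i j) xs)"
    then have k: "k < length xs" by simp
    have "transp i j permutes {..<length xs}"
      using assms by (intro permutes_swap_id) auto
    then have "permute_list (transp i j) xs ! k = xs ! transp i j k"
      using k by (simp add: permute_list_nth)
    also have "\<dots> = (A @ x # B @ y # C) ! transp i j k"
      by (simp only: xs[symmetric])
    also have "\<dots> = (A @ y # B @ x # C) ! k"
    proof -
      consider "k = i" | "k = j" | "k \<noteq> i" "k \<noteq> j"
        by blast
      then show ?thesis
      proof cases
        case 1
        then show ?thesis
          using assms(2) l by (simp add: nth_append)
      next
        case 2
        then show ?thesis
          using assms(2) l by (simp add: nth_append nth_Cons')
      next
        case 3
        then show ?thesis
          using assms(2) l by (auto simp: nth_append nth_Cons')
      qed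
    qed
    finally show "permute_list (transp i j) xs ! k = (A @ y # B @ x # C) ! k" .
  qed
  then show ?thesis
    using inv_sign_swap[of A x B y C] assms(1) by (simp add: xs)
qed

text \<open>Every permutation of the positions is composed of transpositions, and each of these
  changes both \<open>sign\<close> and \<open>inv_sign\<close> by the factor -1.\<close>

lemma inv_sign_permute_list:
  assumes "\<pi> permutes {..<length xs}" "distinct xs"
  shows "inv_sign (permute_list \<pi> xs) = sign \<pi> * inv_sign xs"
proof -
  have "length xs = n \<Longrightarrow> distinct xs \<Longrightarrow> inv_sign (permute_list \<pi> xs) = sign \<pi> * inv_sign xs"
    if "\<pi> permutes {..<n}" for n
    using that finite_lessThan
  proof (induction \<pi> arbitrary: xs rule: permutes_induct)
    case id
    then show ?case by simp
  next
    case (swap a b p)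
    let ?t = "transp a b"
    have t: "?t permutes {..<length xs}"
      using swap.hyps swap.prems by (intro permutes_swap_id) auto
    have "inv_sign (permute_list ?t xs) = - inv_sign xs"
      using inv_sign_transpose[of xs a b] inv_sign_transpose[of xs b a] swap.hyps swap.prems
      by (cases a b rule: linorder_cases) (auto simp: Transposition.transpose_commute)
    moreover have "inv_sign (permute_list p (permute_list ?t xs)) = sign p * inv_sign (permute_list ?t xs)"
      using swap.prems t by (intro swap.IH) auto
    moreover have "permutation p" "permutation ?t"
      using swap.hyps permutation_permutes[of p] by (auto simp: permutation_swap_id)
    ultimately show ?case
      using swap.hyps t sign_compose[of ?t p] permute_list_compose[of p xs ?t] swap.prems
      by (simp add: sign_swap_id del: comp_apply)
  qed
  then show ?thesis
    using assms by blast
qed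

text \<open>Distinct entries determine the permutation on the positions of the list, and beyond them
  it is the identity; so the definite description in \<open>reorder\<close> denotes.\<close>

lemma permute_list_THE:
  assumes "distinct L" "distinct M" "set L = set M"
  obtains p where "p permutes {..<length L}" "permute_list p L = M"
    "(THE \<pi>. \<pi> permutes {..<length L} \<and> permute_list \<pi> L = M) = p"
proof -
  have "mset M = mset L"
    using assms by (simp add: set_eq_iff_mset_eq_distinct)
  then obtain p where p: "p permutes {..<length L}" "permute_list p L = M"
    by (rule mset_eq_permutation)
  have "(THE \<pi>. \<pi> permutes {..<length L} \<and> permute_list \<pi> L = M) = p"
  proof (rule the_equality)
    fix q assume q: "q permutes {..<length L} \<and> permute_list q L = M"
    show "q = p"
    proof
      fix i
      show "q i = p i"
      proof (cases "i < length L")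
        case True
        then have "L ! q i = L ! p i"
          using p q by (metis permute_list_nth)
        moreover have "q i < length L" "p i < length L"
          using True p q permutes_in_image[of q "{..<length L}" i] permutes_in_image[of p "{..<length L}" i]
          by auto
        ultimately show ?thesis
          using assms(1) by (simp add: nth_eq_iff_index_eq)
      next
        case False
        then show ?thesis
          using p q by (metis lessThan_iff permutes_not_in)
      qed
    qed
  qed (use p in auto)
  with p show thesis
    by (rule that)
qed

definition ord_sign :: "'x list \<Rightarrow> 'x list \<Rightarrow> int" where
  "ord_sign L M = sign (THE \<pi>. \<pi> permutes {..<length L} \<and> permute_list \<pi> L = M)"

text \<open>Numbering the entries turns a sign that depends on two lists into a product of one
  factor per list, because inversion signs are their own inverses. Any injective numbering will do,
  so one can be chosen that suits all states of a square at once.\<close>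

lemma ord_sign_eq:
  assumes "distinct L" "distinct M" "set L = set M" "inj_on lab (set L)"
  shows "ord_sign L M = inv_sign (map lab L) * inv_sign (map lab M)"
proof -
  obtain p where p: "p permutes {..<length L}" "permute_list p L = M"
    "(THE \<pi>. \<pi> permutes {..<length L} \<and> permute_list \<pi> L = M) = p"
    using permute_list_THE[OF assms(1-3)] by blast
  have "distinct (map lab L)"
    using assms by (simp add: distinct_map)
  then have "inv_sign (map lab M) = sign p * inv_sign (map lab L)"
    using p inv_sign_permute_list[of p "map lab L"] permute_list_map[of p L lab] by simp
  then show ?thesis
    using p by (simp add: ord_sign_def mult_ac)
qed

lemma reorder_tensor:
  assumes "distinct L" "distinct M" "set L = set M"
  shows "reorder L M (tensor (map \<phi> L)) = vscale (of_int (ord_sign L M)) (tensor (map \<phi> M))"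
proof -
  obtain p where p: "p permutes {..<length L}" "permute_list p L = M"
    "(THE \<pi>. \<pi> permutes {..<length L} \<and> permute_list \<pi> L = M) = p"
    using permute_list_THE[OF assms] by blast
  have "reorder L M (tensor (map \<phi> L)) =
      vscale (of_int (sign p)) (lin_ext (\<lambda>w. basis_vec (permute_list p w)) (tensor (map \<phi> L)))"
    unfolding reorder_def Let_def p(3)
    by (rule vlinear_eqI[of _ "\<lambda>v. vscale (of_int (sign p)) (lin_ext (\<lambda>w. basis_vec (permute_list p w)) v)"])
      (auto intro: vlinear_lin_ext vlinear_vscale)
  also have "lin_ext (\<lambda>w. basis_vec (permute_list p w)) (tensor (map \<phi> L)) = tensor (map \<phi> M)"
    using p permute_list_basis_tensor[of p "map \<phi> L"] permute_list_map[of p L \<phi>] by simp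
  finally show ?thesis
    by (simp add: ord_sign_def p(3))
qed

text \<open>The shape of the list of local cycles: a single entry if both strands at the crossing
  lie on the same cycle.\<close>

definition pair :: "'x \<Rightarrow> 'x \<Rightarrow> 'x list" where
  "pair x y = (if x = y then [x] else [x, y])"

lemma set_pair [simp]: "set (pair x y) = {x, y}"
  by (auto simp: pair_def)

lemma distinct_pair [simp]: "distinct (pair x y)"
  by (auto simp: pair_def)

lemma map_pair: "inj_on f {x, y} \<Longrightarrow> map f (pair x y) = pair (f x) (f y)"
  by (auto simp: pair_def inj_on_def)

subsection \<open>Four points on the cycles of a permutation\<close>

text \<open>The permutation is given by its table of values. A cycle on four points is exhausted
  after three steps, so this is the least point of the cycle of \<open>i\<close>.\<close>

definition cycle_min :: "nat list \<Rightarrow> nat \<Rightarrow> nat" where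
  "cycle_min r i = min (min i (r ! i)) (min (r ! (r ! i)) (r ! (r ! (r ! i))))"

text \<open>The scalar of a resmoothing at the points \<open>i\<close> and \<open>j\<close>, up to signs depending on one state only,
  when the permutations before and after it induce \<open>r\<close> and \<open>r'\<close> on four points; cycles are
  represented by their least points.\<close>

definition coef4 :: "nat list \<Rightarrow> nat list \<Rightarrow> nat \<Rightarrow> nat \<Rightarrow> int" where
  "coef4 r r' i j =
     (let L = pair (cycle_min r i) (cycle_min r j);
          L' = pair (cycle_min r' i) (cycle_min r' j);
          R = filter (\<lambda>l. l \<notin> set L) (remdups (map (cycle_min r) [0..<4]))
      in (if cycle_min r i = cycle_min r j then 2 else 1) * inv_sign L * inv_sign L' * cross L R * cross L' R)"

definition swap01 :: "nat \<Rightarrow> nat" where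
  "swap01 x = (if x = 0 then 1 else if x = 1 then 0 else x)"

definition swap23 :: "nat \<Rightarrow> nat" where
  "swap23 x = (if x = 2 then 3 else if x = 3 then 2 else x)"

definition perms4 :: "nat list list" where
  "perms4 =
    [[0,1,2,3], [0,1,3,2], [0,2,1,3], [0,2,3,1], [0,3,1,2], [0,3,2,1], [1,0,2,3], [1,0,3,2],
     [1,2,0,3], [1,2,3,0], [1,3,0,2], [1,3,2,0], [2,0,1,3], [2,0,3,1], [2,1,0,3], [2,1,3,0],
     [2,3,0,1], [2,3,1,0], [3,0,1,2], [3,0,2,1], [3,1,0,2], [3,1,2,0], [3,2,0,1], [3,2,1,0]]"

text \<open>The explicit list is tested against all 256 tables with entries below 4.\<close>

lemma perms4_complete: "list_all (\<lambda>r. distinct r \<longrightarrow> r \<in> set perms4) (List.n_lists 4 [0..<4])"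
  by code_simp

text \<open>The points 0 and 1 stand for the exits of one crossing, 2 and 3 for those of the other,
  so \<open>swap01\<close> and \<open>swap23\<close> are the two resmoothings. In each of the 24
  ways in which cycles can connect the exits, evaluation compares the powers of 2 from the
  splittings as well as the signs.\<close>

lemma coef4_anticommute_all:
  "list_all (\<lambda>r. coef4 r (map swap01 r) 0 1 * coef4 (map swap01 r) (map swap01 (map swap23 r)) 2 3 =
     - (coef4 r (map swap23 r) 2 3 * coef4 (map swap23 r) (map swap01 (map swap23 r)) 0 1)) perms4"
  by code_simp

lemma fourth_power_all:
  "list_all (\<lambda>r. list_all (\<lambda>i. r ! (r ! (r ! (r ! i))) \<in> set [i, r ! i, r ! (r ! i), r ! (r ! (r ! i))])
     [0, 1, 2, 3]) perms4"
  by (simp add: perms4_def)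

lemma all_less_4: fixes P :: "nat \<Rightarrow> bool" shows "(\<forall>i<4. P i) \<longleftrightarrow> P 0 \<and> P 1 \<and> P 2 \<and> P (3 :: nat)"
  by (auto simp: less_Suc_eq numeral_eq_Suc)

lemma map_permutes_in_perms4:
  fixes f :: "nat \<Rightarrow> nat"
  assumes "f permutes {..<4}"
  shows "map f [0..<4] \<in> set perms4"
proof -
  have inj: "f i = f j \<longleftrightarrow> i = j" for i j
    using permutes_inj[OF assms] by (auto dest: injD)
  have "f i < 4" if "i < 4" for i
    using permutes_in_image[OF assms, of i] that by simp
  then have "map f [0..<4] \<in> set (List.n_lists 4 [0..<4])"
    by (auto simp: set_n_lists)
  moreover have "distinct (map f [0..<4])"
    by (simp add: distinct_map inj_on_def inj)
  ultimately show ?thesis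
    using perms4_complete unfolding list_all_iff by blast
qed

lemma orbit_four:
  fixes f :: "nat \<Rightarrow> nat"
  assumes f: "f permutes {..<4}" and i: "i < 4"
  shows "orbit f i = {i, f i, f (f i), f (f (f i))}" (is "_ = ?A")
proof
  have less: "f j < 4 \<longleftrightarrow> j < 4" for j
    using permutes_in_image[OF f, of j] by simp
  have nth: "map f [0..<4] ! j = f j" if "j < 4" for j
    using that by simp
  have "i \<in> set [0, 1, 2, 3]"
    using i by auto
  then have "(\<lambda>r. r ! (r ! (r ! (r ! i))) \<in> set [i, r ! i, r ! (r ! i), r ! (r ! (r ! i))]) (map f [0..<4])"
    using fourth_power_all map_permutes_in_perms4[OF f] unfolding list_all_iff by blast
  then have closed: "f (f (f (f i))) \<in> ?A"
    using i by (simp add: nth less)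
  show "orbit f i \<subseteq> ?A"
  proof
    fix j assume "j \<in> orbit f i"
    then show "j \<in> ?A"
      by induction (use closed in auto)
  qed
  \<comment> \<open>\<open>orbit\<close> contains the iterates with positive exponent; the point
    itself is among them because \<open>f\<close> has finite order.\<close>
  have "permutation f"
    using f by (auto simp: permutation_permutes)
  then have "i \<in> orbit f i"
    by (rule permutation_self_in_orbit)
  then show "?A \<subseteq> orbit f i"
    by (auto intro: orbit.intros)
qed

lemma cycle_min_eq_Least:
  fixes f :: "nat \<Rightarrow> nat"
  assumes f: "f permutes {..<4}" and i: "i < 4"
  shows "cycle_min (map f [0..<4]) i = (LEAST j. j < 4 \<and> j \<in> orbit f i)"
proof -
  have less: "f j < 4 \<longleftrightarrow> j < 4" for j
    using permutes_in_image[OF f, of j] by simp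
  show ?thesis
    by (rule Least_equality[symmetric])
      (use i in \<open>auto simp: cycle_min_def orbit_four[OF f i] less min_def\<close>)
qed

section \<open>First return permutations\<close>

definition first_return :: "('p \<Rightarrow> 'p) \<Rightarrow> 'p set \<Rightarrow> 'p \<Rightarrow> 'p" where
  "first_return \<pi> Q x = (\<pi> ^^ (LEAST k. 0 < k \<and> (\<pi> ^^ k) x \<in> Q)) x"

lemma first_return_time:
  assumes "permutation \<pi>" "x \<in> Q"
  obtains k where "0 < k" "first_return \<pi> Q x = (\<pi> ^^ k) x" "(\<pi> ^^ k) x \<in> Q"
    "\<And>j. 0 < j \<Longrightarrow> j < k \<Longrightarrow> (\<pi> ^^ j) x \<notin> Q"
proof -
  have "x \<in> orbit \<pi> x"
    using assms(1) by (rule permutation_self_in_orbit)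
  then have ex: "\<exists>k. 0 < k \<and> (\<pi> ^^ k) x \<in> Q"
    using assms(2) by (auto simp: orbit_altdef)
  show ?thesis
    by (rule that[of "LEAST k. 0 < k \<and> (\<pi> ^^ k) x \<in> Q"])
      (use LeastI_ex[OF ex] not_less_Least[of _ "\<lambda>k. 0 < k \<and> (\<pi> ^^ k) x \<in> Q"]
        in \<open>auto simp: first_return_def\<close>)
qed

text \<open>As \<open>t\<close> fixes everything outside \<open>Q\<close>, both permutations follow
  the same path until it returns to \<open>Q\<close>, and there \<open>t\<close> acts once.\<close>

lemma first_return_compose:
  assumes \<pi>: "permutation \<pi>" and x: "x \<in> Q" and t: "t permutes Q"
  shows "first_return (t \<circ> \<pi>) Q x = t (first_return \<pi> Q x)"
proof -
  obtain k where k: "0 < k" "first_return \<pi> Q x = (\<pi> ^^ k) x" "(\<pi> ^^ k) x \<in> Q"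
    "\<And>j. 0 < j \<Longrightarrow> j < k \<Longrightarrow> (\<pi> ^^ j) x \<notin> Q"
    using first_return_time[OF \<pi> x] by metis
  have eq: "((t \<circ> \<pi>) ^^ j) x = (\<pi> ^^ j) x" if "j < k" for j
    using that
  proof (induction j)
    case (Suc j)
    then have "(\<pi> ^^ Suc j) x \<notin> Q"
      using k(4)[of "Suc j"] by simp
    then have "t ((\<pi> ^^ Suc j) x) = (\<pi> ^^ Suc j) x"
      by (rule permutes_not_in[OF t])
    with Suc show ?case by simp
  qed simp
  obtain k' where k': "k = Suc k'"
    using k(1) gr0_implies_Suc by blast
  have tk: "((t \<circ> \<pi>) ^^ k) x = t ((\<pi> ^^ k) x)"
    using eq[of k'] by (simp add: k')
  have "(LEAST k. 0 < k \<and> ((t \<circ> \<pi>) ^^ k) x \<in> Q) = k"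
  proof (rule Least_equality)
    show "0 < k \<and> ((t \<circ> \<pi>) ^^ k) x \<in> Q"
      using k(1,3) tk permutes_in_image[OF t] by simp
    show "k \<le> j" if "0 < j \<and> ((t \<circ> \<pi>) ^^ j) x \<in> Q" for j
      using that eq[of j] k(4)[of j] by (cases "j < k") auto
  qed
  then show ?thesis
    by (simp only: first_return_def[of "t \<circ> \<pi>"] tk k(2))
qed

text \<open>A positive exponent leading into \<open>Q\<close> is at least the first return time.
  Subtracting this time gives a shorter path that starts at the point of first return, to which the
  induction applies.\<close>

lemma orbit_first_return:
  assumes \<pi>: "permutation \<pi>" and x: "x \<in> Q"
  shows "orbit (first_return \<pi> Q) x = orbit \<pi> x \<inter> Q"
proof
  let ?f = "first_return \<pi> Q"
  have step: "?f z \<in> orbit \<pi> z \<inter> Q" if z: "z \<in> Q" for z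
  proof -
    obtain k where "0 < k" "?f z = (\<pi> ^^ k) z" "(\<pi> ^^ k) z \<in> Q"
      using first_return_time[OF \<pi> z] by metis
    then show ?thesis
      by (auto simp: orbit_altdef)
  qed
  show "orbit ?f x \<subseteq> orbit \<pi> x \<inter> Q"
  proof
    fix y assume "y \<in> orbit ?f x"
    then show "y \<in> orbit \<pi> x \<inter> Q"
      by induction (use step x in \<open>auto intro: orbit_trans\<close>)
  qed
  have "y \<in> orbit ?f x" if "y = (\<pi> ^^ n) x" "0 < n" "y \<in> Q" for n y
    using that x
  proof (induction n arbitrary: x rule: less_induct)
    case (less n)
    obtain k where k: "0 < k" "?f x = (\<pi> ^^ k) x" "(\<pi> ^^ k) x \<in> Q"
      "\<And>j. 0 < j \<Longrightarrow> j < k \<Longrightarrow> (\<pi> ^^ j) x \<notin> Q"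
      using first_return_time[OF \<pi> less.prems(4)] by metis
    have "k \<le> n"
      using k(4)[of n] less.prems by (cases "n < k") auto
    show ?case
    proof (cases "k = n")
      case True
      then show ?thesis
        using k(2) less.prems orbit.base[of ?f x] by simp
    next
      case False
      have "y = (\<pi> ^^ (n - k)) (?f x)"
        using \<open>k \<le> n\<close> less.prems(1) k(2) by (metis funpow_add comp_apply le_add_diff_inverse2)
      then have "y \<in> orbit ?f (?f x)"
        using less.IH[of "n - k" "?f x"] False \<open>k \<le> n\<close> k less.prems by simp
      then show ?thesis
        by (rule orbit_trans[OF _ orbit.base])
    qed
  qed
  then show "orbit \<pi> x \<inter> Q \<subseteq> orbit ?f x"
    by (auto simp: orbit_altdef[of \<pi>])
qed

text \<open>Each point of \<open>Q\<close> lies in its own orbit under the first return map and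
  therefore has a predecessor there. So the map is onto, and \<open>Q\<close> is finite.\<close>

lemma bij_betw_first_return:
  assumes \<pi>: "permutation \<pi>" and Q: "finite Q"
  shows "bij_betw (first_return \<pi> Q) Q Q"
proof -
  let ?f = "first_return \<pi> Q"
  have "?f ` Q = Q"
  proof
    show "?f ` Q \<subseteq> Q"
      using orbit_first_return[OF \<pi>] orbit.base[of ?f] by blast
    show "Q \<subseteq> ?f ` Q"
    proof
      fix y assume y: "y \<in> Q"
      then have "y \<in> orbit ?f y"
        using orbit_first_return[OF \<pi> y] permutation_self_in_orbit[OF \<pi>] by simp
      then show "y \<in> ?f ` Q"
        by cases (use y orbit_first_return[OF \<pi> y] in auto)
    qed
  qed
  then show ?thesis
    using Q by (simp add: bij_betw_def finite_surj_inj)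
qed

lemma orbit_transfer:
  assumes q: "inj_on q A" and s: "\<And>i. i \<in> A \<Longrightarrow> s i \<in> A" "\<And>i. i \<in> A \<Longrightarrow> f (q i) = q (s i)"
    and "i \<in> A" "j \<in> A"
  shows "q j \<in> orbit f (q i) \<longleftrightarrow> j \<in> orbit s i"
proof -
  have *: "(s ^^ n) i \<in> A \<and> (f ^^ n) (q i) = q ((s ^^ n) i)" for n
    by (induction n) (use assms in auto)
  then have "q j = (f ^^ n) (q i) \<longleftrightarrow> j = (s ^^ n) i" for n
    using q assms(5) by (auto simp: inj_on_def)
  then show ?thesis
    by (auto simp: orbit_altdef)
qed

text \<open>More than saying that \<open>\<rho>\<close> describes how the cycles of
  \<open>\<pi>\<close> connect the four points: it has to remain correct after composition with any
  permutation of these points. So a single \<open>\<rho>\<close> serves all four states of a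
  square.\<close>

definition induces :: "('p \<Rightarrow> 'p) \<Rightarrow> (nat \<Rightarrow> 'p) \<Rightarrow> (nat \<Rightarrow> nat) \<Rightarrow> bool" where
  "induces \<pi> q \<rho> \<longleftrightarrow> (\<forall>t t'. t permutes {..<4} \<and> t' permutes q ` {..<4} \<and> (\<forall>i<4. t' (q i) = q (t i)) \<longrightarrow>
     (\<forall>i<4. \<forall>j<4. q j \<in> orbit (t' \<circ> \<pi>) (q i) \<longleftrightarrow> j \<in> orbit (t \<circ> \<rho>) i))"

text \<open>\<open>\<rho>\<close> is the first return map to the four points, transported along
  \<open>q\<close>. Composition with a permutation of the points commutes with taking first
  returns.\<close>

lemma four_points:
  assumes \<pi>: "permutation \<pi>" and q: "inj_on q {..<4::nat}"
  obtains \<rho> where "\<rho> permutes {..<4}" "induces \<pi> q \<rho>"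
proof -
  let ?Q = "q ` {..<4}" and ?f = "first_return \<pi> (q ` {..<4})"
  define \<rho> where "\<rho> i = (if i < 4 then inv_into {..<4} q (?f (q i)) else i)" for i
  have f: "bij_betw ?f ?Q ?Q"
    by (rule bij_betw_first_return[OF \<pi>]) simp
  have bq: "bij_betw q {..<4} ?Q"
    using q by (simp add: bij_betw_def)
  have "bij_betw (inv_into {..<4} q \<circ> (?f \<circ> q)) {..<4} {..<4}"
    by (intro bij_betw_trans[OF bij_betw_trans[OF bq f]] bij_betw_inv_into bq)
  then have "bij_betw \<rho> {..<4} {..<4}"
    by (rule bij_betw_cong[THEN iffD1, rotated]) (simp add: \<rho>_def)
  then have \<rho>: "\<rho> permutes {..<4}"
    by (rule bij_imp_permutes) (simp add: \<rho>_def)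
  have q\<rho>: "?f (q i) = q (\<rho> i)" if "i < 4" for i
  proof -
    have "?f (q i) \<in> ?Q"
      using f that by (auto simp: bij_betw_def)
    then show ?thesis
      using that by (simp add: \<rho>_def f_inv_into_f)
  qed
  show ?thesis
  proof (rule that[OF \<rho>], unfold induces_def, intro allI impI)
    fix t t' and i j :: nat
    assume "t permutes {..<4} \<and> t' permutes ?Q \<and> (\<forall>i<4. t' (q i) = q (t i))" and ij: "i < 4" "j < 4"
    then have t: "t permutes {..<4}" and t': "t' permutes ?Q" and tt: "\<And>i. i < 4 \<Longrightarrow> t' (q i) = q (t i)"
      by auto
    have less: "\<rho> i < 4 \<longleftrightarrow> i < 4" "t i < 4 \<longleftrightarrow> i < 4" for i
      using permutes_in_image[OF \<rho>, of i] permutes_in_image[OF t, of i] by auto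
    have "permutation t'"
      using t' by (auto simp: permutation_permutes)
    then have "permutation (t' \<circ> \<pi>)"
      using \<pi> by (rule permutation_compose)
    then have "q j \<in> orbit (t' \<circ> \<pi>) (q i) \<longleftrightarrow> q j \<in> orbit (first_return (t' \<circ> \<pi>) ?Q) (q i)"
      using orbit_first_return[of "t' \<circ> \<pi>" "q i" ?Q] ij by auto
    also have "\<dots> \<longleftrightarrow> j \<in> orbit (t \<circ> \<rho>) i"
      by (rule orbit_transfer[OF q])
        (use ij in \<open>auto simp: less first_return_compose[OF \<pi> _ t'] q\<rho> tt\<close>)
    finally show "q j \<in> orbit (t' \<circ> \<pi>) (q i) \<longleftrightarrow> j \<in> orbit (t \<circ> \<rho>) i" .
  qed
qed

section \<open>Scalars of resmoothings and their anticommutation\<close>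

definition edge_coeff :: "'x list \<Rightarrow> 'x list \<Rightarrow> 'x \<Rightarrow> 'x \<Rightarrow> 'x \<Rightarrow> 'x \<Rightarrow> int" where
  "edge_coeff O1 O2 A B A' B' =
     (let R = filter (\<lambda>C. C \<notin> {A, B}) O1
      in (if A = B then 2 else 1) * ord_sign O1 (pair A B @ R) * ord_sign (pair A' B' @ R) O2)"

text \<open>The effect of one resmoothing on the lists of cycles: the cycles \<open>A\<close> and
  \<open>B\<close> through the crossing give way to \<open>A'\<close> and \<open>B'\<close>, and all
  others persist. Equalities \<open>A = B\<close> and \<open>A' = B'\<close> are allowed, so merging
  and splitting are covered together.\<close>

definition resmooths :: "'x list \<Rightarrow> 'x list \<Rightarrow> 'x \<Rightarrow> 'x \<Rightarrow> 'x \<Rightarrow> 'x \<Rightarrow> bool" where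
  "resmooths O1 O2 A B A' B' \<longleftrightarrow> A \<in> set O1 \<and> B \<in> set O1 \<and> A' \<notin> set O1 - {A, B} \<and>
     B' \<notin> set O1 - {A, B} \<and> set O2 = {A', B'} \<union> (set O1 - {A, B})"

text \<open>Here \<open>Ol\<close> is the list of cycles of a state, \<open>K i\<close> is the cycle
  through the point \<open>q i\<close>, and the cycles of \<open>f\<close> tell which of the four
  points share a cycle of the state.\<close>

definition tracks :: "(nat \<Rightarrow> 'p) \<Rightarrow> (nat \<Rightarrow> nat) \<Rightarrow> 'p set list \<Rightarrow> (nat \<Rightarrow> 'p set) \<Rightarrow> bool" where
  "tracks q f Ol K \<longleftrightarrow> f permutes {..<4} \<and> distinct Ol \<and> (\<forall>i<4. K i \<in> set Ol) \<and>
     (\<forall>C\<in>set Ol. \<forall>i<4. q i \<in> C \<longrightarrow> C = K i) \<and>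
     (\<forall>i<4. \<forall>j<4. q j \<in> K i \<longleftrightarrow> j \<in> orbit f i)"

lemma tracksD:
  assumes "tracks q f Ol K"
  shows "f permutes {..<4}" "distinct Ol" "\<And>i. i < 4 \<Longrightarrow> K i \<in> set Ol"
    "\<And>C i. C \<in> set Ol \<Longrightarrow> i < 4 \<Longrightarrow> q i \<in> C \<Longrightarrow> C = K i"
    "\<And>i j. i < 4 \<Longrightarrow> j < 4 \<Longrightarrow> q j \<in> K i \<longleftrightarrow> j \<in> orbit f i"
  using assms unfolding tracks_def by blast+

lemma tracks_self:
  assumes "tracks q f Ol K" "i < 4"
  shows "i \<in> orbit f i" "q i \<in> K i"
proof -
  have "permutation f"
    using tracksD(1)[OF assms(1)] by (auto simp: permutation_permutes)
  then show "i \<in> orbit f i"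
    by (rule permutation_self_in_orbit)
  then show "q i \<in> K i"
    using tracksD(5)[OF assms(1)] assms(2) by simp
qed

text \<open>Numbering the cycles through the four points by their least points makes the numbers comparable
  between the four states of a square.\<close>

definition label4 :: "(nat \<Rightarrow> 'p) \<Rightarrow> ('p set \<Rightarrow> nat) \<Rightarrow> 'p set \<Rightarrow> nat" where
  "label4 q g C = (if \<exists>i<4. q i \<in> C then LEAST i. i < 4 \<and> q i \<in> C else 4 + g C)"

lemma cross_mset_cong: "mset ys = mset zs \<Longrightarrow> cross xs ys = cross xs zs"
  unfolding cross_def by (simp flip: prod_mset_prod_list)

text \<open>An entry from \<open>n\<close> upwards exceeds all of \<open>xs\<close> and contributes
  the factor 1. This removes the cycles that miss the four points, as their labels start at
  4.\<close>

lemma cross_filter_less: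
  assumes "\<forall>x\<in>set xs. x < n"
  shows "cross xs ys = cross xs (filter (\<lambda>y. y < n) ys)"
proof (induction ys)
  case (Cons y ys)
  have "cross xs [y] = 1" if "\<not> y < n"
  proof -
    have "map (\<lambda>x. less_sign x y) xs = map (\<lambda>x. 1) xs"
      using assms that by (auto simp: less_sign_def)
    then have "(\<Prod>x\<leftarrow>xs. less_sign x y) = (\<Prod>x\<leftarrow>xs. 1)"
      by (rule arg_cong)
    then show ?thesis
      by (simp add: cross_def)
  qed
  with Cons show ?case
    by (auto simp: cross_Cons_right[of xs y ys] cross_Cons_right[of xs y "filter _ ys"])
qed simp

lemma label4_cycle:
  assumes "tracks q f Ol K" "i < 4"
  shows "label4 q g (K i) = cycle_min (map f [0..<4]) i"
proof -
  have "\<exists>j<4. q j \<in> K i"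
    using tracks_self(2)[OF assms] assms(2) by blast
  moreover have "j < 4 \<and> q j \<in> K i \<longleftrightarrow> j < 4 \<and> j \<in> orbit f i" for j
    using tracksD(5)[OF assms(1), of i j] assms(2) by blast
  ultimately show ?thesis
    using assms(2) cycle_min_eq_Least[OF tracksD(1)[OF assms(1)], of i] by (simp add: label4_def)
qed

lemma label4_less: "label4 q g C < 4 \<longleftrightarrow> (\<exists>i<4. q i \<in> C)"
proof (cases "\<exists>i<4. q i \<in> C")
  case True
  then show ?thesis
    using LeastI_ex[of "\<lambda>i. i < 4 \<and> q i \<in> C"] by (auto simp: label4_def)
qed (auto simp: label4_def)

text \<open>A label below 4 is the index of a point on the cycle and so determines it; the other
  labels are shifted values of the injective \<open>g\<close>.\<close>

lemma inj_on_label4: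
  assumes tr: "tracks q f Ol K" and g: "inj_on g (set Ol)"
  shows "inj_on (label4 q g) (set Ol)"
proof (rule inj_onI)
  fix C D assume CD: "C \<in> set Ol" "D \<in> set Ol" "label4 q g C = label4 q g D"
  show "C = D"
  proof (cases "\<exists>i<4. q i \<in> C")
    case True
    then have D: "\<exists>i<4. q i \<in> D"
      using CD(3) label4_less by metis
    have "q (label4 q g E) \<in> E \<and> label4 q g E < 4" if "\<exists>i<4. q i \<in> E" for E
      using LeastI_ex[of "\<lambda>i. i < 4 \<and> q i \<in> E"] that by (auto simp: label4_def)
    from this[OF True] this[OF D] have "C = K (label4 q g C)" "D = K (label4 q g C)"
      using tracksD(4)[OF tr] CD by metis+
    then show ?thesis
      by simp
  next
    case False
    then have "\<not> (\<exists>i<4. q i \<in> D)"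
      using CD(3) label4_less by metis
    then have "label4 q g D = 4 + g D" "label4 q g C = 4 + g C"
      unfolding label4_def using False by (auto intro!: if_not_P)
    with CD g show ?thesis
      by (auto simp: inj_on_def)
  qed
qed

text \<open>With the signs expressed by labels, the inversion signs of the two global orders split
  off, and that of the unaffected cycles \<open>R\<close> occurs twice and cancels. What remains of
  \<open>R\<close> are its comparisons with the local cycles, where only cycles through the four
  points count.\<close>

lemma edge_coeff_eq_coef4:
  assumes tr: "tracks q f O1 K" "tracks q f' O2 K'" and g: "inj_on g (set O1)" "inj_on g (set O2)"
    and ij: "i < 4" "j < 4" and rs: "resmooths O1 O2 (K i) (K j) (K' i) (K' j)"
  shows "edge_coeff O1 O2 (K i) (K j) (K' i) (K' j) =
    inv_sign (map (label4 q g) O1) * inv_sign (map (label4 q g) O2) *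
    coef4 (map f [0..<4]) (map f' [0..<4]) i j"
proof -
  let ?lab = "label4 q g" and ?r = "map f [0..<4]" and ?r' = "map f' [0..<4]"
  define R where "R = filter (\<lambda>C. C \<notin> {K i, K j}) O1"
  define L where "L = pair (cycle_min ?r i) (cycle_min ?r j)"
  define L' where "L' = pair (cycle_min ?r' i) (cycle_min ?r' j)"
  define R4 where "R4 = filter (\<lambda>l. l \<notin> set L) (remdups (map (cycle_min ?r) [0..<4]))"
  have lab: "inj_on ?lab (set O1)" "inj_on ?lab (set O2)"
    using tr g by (auto intro: inj_on_label4)
  have dO: "distinct O1" "distinct O2"
    using tr tracksD(2) by blast+
  have K: "K m \<in> set O1" "K' m \<in> set O2" if "m < 4" for m
    using tracksD(3)[OF tr(1)] tracksD(3)[OF tr(2)] that by auto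
  have setR: "set R = set O1 - {K i, K j}"
    by (auto simp: R_def)
  have d: "distinct (pair (K i) (K j) @ R)" "distinct (pair (K' i) (K' j) @ R)"
    using dO rs by (auto simp: R_def resmooths_def)
  have s: "set O1 = set (pair (K i) (K j) @ R)" "set (pair (K' i) (K' j) @ R) = set O2"
    using rs K ij by (auto simp: setR resmooths_def)
  have p: "map ?lab (pair (K i) (K j)) = L" "map ?lab (pair (K' i) (K' j)) = L'"
    using K[OF ij(1)] K[OF ij(2)] lab ij unfolding L_def L'_def
    by (auto simp: label4_cycle[OF tr(1)] label4_cycle[OF tr(2)] map_pair[of ?lab] inj_on_def)
  have ord_sign: "ord_sign O1 (pair (K i) (K j) @ R) = inv_sign (map ?lab O1) * inv_sign (L @ map ?lab R)"
    "ord_sign (pair (K' i) (K' j) @ R) O2 = inv_sign (L' @ map ?lab R) * inv_sign (map ?lab O2)"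
    using ord_sign_eq[OF dO(1) d(1) s(1) lab(1)] ord_sign_eq[OF d(2) dO(2) s(2) lab(2)[folded s(2)]]
    by (simp_all only: map_append p)
  have "K i = K j \<longleftrightarrow> cycle_min ?r i = cycle_min ?r j"
    using label4_cycle[OF tr(1), of _ g] ij lab(1) K by (metis inj_on_def)
  then have w: "(if K i = K j then 2 else 1 :: int) = (if cycle_min ?r i = cycle_min ?r j then 2 else 1)"
    by simp
  have cm4: "cycle_min ?r m < 4" "cycle_min ?r' m < 4" if "m < 4" for m
    using label4_cycle[OF tr(1) that, of g] label4_cycle[OF tr(2) that, of g] label4_less[of q g]
      tracks_self(2)[OF tr(1) that] tracks_self(2)[OF tr(2) that] that by metis+
  \<comment> \<open>The order of these labels depends on the global order of the state and differs
    from that in \<open>coef4\<close>, but \<open>cross\<close> sees only their multiset.\<close>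
  have "mset (filter (\<lambda>y. y < 4) (map ?lab R)) = mset R4"
  proof (subst set_eq_iff_mset_eq_distinct[symmetric])
    show "distinct (filter (\<lambda>y. y < 4) (map ?lab R))"
    proof (rule distinct_filter)
      show "distinct (map ?lab R)"
        using d(1) inj_on_subset[OF lab(1), of "set R"] by (auto simp: distinct_map setR)
    qed
    show "distinct R4"
      by (simp add: R4_def)
    have "{C \<in> set O1. ?lab C < 4} = K ` {..<4}"
    proof
      show "{C \<in> set O1. ?lab C < 4} \<subseteq> K ` {..<4}"
        using tracksD(4)[OF tr(1)] unfolding label4_less by blast
      show "K ` {..<4} \<subseteq> {C \<in> set O1. ?lab C < 4}"
        using K label4_cycle[OF tr(1), of _ g] cm4 by auto
    qed
    then have "{C \<in> set R. ?lab C < 4} = K ` {..<4} - {K i, K j}"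
      by (auto simp: setR)
    moreover have "set (filter (\<lambda>y. y < 4) (map ?lab R)) = ?lab ` {C \<in> set R. ?lab C < 4}"
      by auto
    moreover have "?lab ` (K ` {..<4} - {K i, K j}) = ?lab ` K ` {..<4} - ?lab ` {K i, K j}"
      by (rule inj_on_image_set_diff[OF lab(1)]) (use K ij in auto)
    moreover have "?lab ` K ` {..<4} = cycle_min ?r ` {..<4}" "?lab ` {K i, K j} = set L"
      using label4_cycle[OF tr(1), of _ g] ij by (auto simp: L_def image_image)
    ultimately show "set (filter (\<lambda>y. y < 4) (map ?lab R)) = set R4"
      by (auto simp: R4_def)
  qed
  then have cr: "cross l (map ?lab R) = cross l R4" if "\<forall>x\<in>set l. x < 4" for l
    using cross_filter_less[OF that, of "map ?lab R"] cross_mset_cong by metis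
  have "\<forall>x\<in>set L. x < 4" "\<forall>x\<in>set L'. x < 4"
    using cm4 ij by (auto simp: L_def L'_def)
  note cr = cr[OF this(1)] cr[OF this(2)]
  have "edge_coeff O1 O2 (K i) (K j) (K' i) (K' j) = (if cycle_min ?r i = cycle_min ?r j then 2 else 1) *
      (inv_sign (map ?lab O1) * inv_sign (L @ map ?lab R)) * (inv_sign (L' @ map ?lab R) * inv_sign (map ?lab O2))"
    unfolding edge_coeff_def Let_def R_def[symmetric] ord_sign w ..
  also have "\<dots> = inv_sign (map ?lab O1) * inv_sign (map ?lab O2) *
      ((if cycle_min ?r i = cycle_min ?r j then 2 else 1) * inv_sign L * inv_sign L' * cross L R4 * cross L' R4) *
      (inv_sign (map ?lab R) * inv_sign (map ?lab R))"
    unfolding inv_sign_append cr by (simp only: mult_ac)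
  also have "\<dots> = inv_sign (map ?lab O1) * inv_sign (map ?lab O2) * coef4 ?r ?r' i j"
    by (simp add: coef4_def Let_def L_def L'_def R4_def)
  finally show ?thesis .
qed

text \<open>The numbering \<open>g\<close> is injective on the cycles of all four states, so each
  state has the same inversion sign in both of its edges. Those of \<open>O1\<close> and
  \<open>O2\<close> then square to 1, and those of \<open>O0\<close> and \<open>O3\<close> appear on
  both sides, which leaves the finite check.\<close>

lemma edge_coeff_square_anticommute:
  assumes \<rho>: "\<rho> permutes {..<4}"
    and tr: "tracks q \<rho> O0 K0" "tracks q (swap01 \<circ> \<rho>) O1 K1" "tracks q (swap23 \<circ> \<rho>) O2 K2"
      "tracks q (swap01 \<circ> swap23 \<circ> \<rho>) O3 K3"
    and rs: "resmooths O0 O1 (K0 0) (K0 1) (K1 0) (K1 1)" "resmooths O1 O3 (K1 2) (K1 3) (K3 2) (K3 3)"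
      "resmooths O0 O2 (K0 2) (K0 3) (K2 2) (K2 3)" "resmooths O2 O3 (K2 0) (K2 1) (K3 0) (K3 1)"
  shows "edge_coeff O0 O1 (K0 0) (K0 1) (K1 0) (K1 1) * edge_coeff O1 O3 (K1 2) (K1 3) (K3 2) (K3 3) =
    - (edge_coeff O0 O2 (K0 2) (K0 3) (K2 2) (K2 3) * edge_coeff O2 O3 (K2 0) (K2 1) (K3 0) (K3 1))"
proof -
  let ?U = "set O0 \<union> set O1 \<union> set O2 \<union> set O3"
  obtain g :: "'a set \<Rightarrow> nat" where "inj_on g ?U"
    using finite_imp_inj_to_nat_seg[of ?U] by auto
  then have g: "inj_on g (set O0)" "inj_on g (set O1)" "inj_on g (set O2)" "inj_on g (set O3)"
    by (auto intro: inj_on_subset)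
  let ?p = "\<lambda>Ol. inv_sign (map (label4 q g) Ol)"
  let ?r = "map \<rho> [0..<4]"
  have maps: "map (swap01 \<circ> \<rho>) [0..<4] = map swap01 ?r" "map (swap23 \<circ> \<rho>) [0..<4] = map swap23 ?r"
    "map (swap01 \<circ> swap23 \<circ> \<rho>) [0..<4] = map swap01 (map swap23 ?r)"
    by simp_all
  have c: "coef4 ?r (map swap01 ?r) 0 1 * coef4 (map swap01 ?r) (map swap01 (map swap23 ?r)) 2 3 =
     - (coef4 ?r (map swap23 ?r) 2 3 * coef4 (map swap23 ?r) (map swap01 (map swap23 ?r)) 0 1)"
    using coef4_anticommute_all map_permutes_in_perms4[OF \<rho>] unfolding list_all_iff by blast
  have e: "edge_coeff O0 O1 (K0 0) (K0 1) (K1 0) (K1 1) = ?p O0 * ?p O1 * coef4 ?r (map swap01 ?r) 0 1"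
    "edge_coeff O1 O3 (K1 2) (K1 3) (K3 2) (K3 3) =
      ?p O1 * ?p O3 * coef4 (map swap01 ?r) (map swap01 (map swap23 ?r)) 2 3"
    "edge_coeff O0 O2 (K0 2) (K0 3) (K2 2) (K2 3) = ?p O0 * ?p O2 * coef4 ?r (map swap23 ?r) 2 3"
    "edge_coeff O2 O3 (K2 0) (K2 1) (K3 0) (K3 1) =
      ?p O2 * ?p O3 * coef4 (map swap23 ?r) (map swap01 (map swap23 ?r)) 0 1"
    using edge_coeff_eq_coef4[OF tr(1,2) g(1,2) _ _ rs(1)] edge_coeff_eq_coef4[OF tr(2,4) g(2,4) _ _ rs(2)]
      edge_coeff_eq_coef4[OF tr(1,3) g(1,3) _ _ rs(3)] edge_coeff_eq_coef4[OF tr(3,4) g(3,4) _ _ rs(4)]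
    unfolding maps by simp_all
  let ?c1 = "coef4 ?r (map swap01 ?r) 0 1"
  let ?c2 = "coef4 (map swap01 ?r) (map swap01 (map swap23 ?r)) 2 3"
  let ?c3 = "coef4 ?r (map swap23 ?r) 2 3"
  let ?c4 = "coef4 (map swap23 ?r) (map swap01 (map swap23 ?r)) 0 1"
  have "(?p O0 * ?p O1 * ?c1) * (?p O1 * ?p O3 * ?c2) = (?p O1 * ?p O1) * (?p O0 * ?p O3 * (?c1 * ?c2))"
    by (simp only: mult_ac)
  also have "\<dots> = - ((?p O2 * ?p O2) * (?p O0 * ?p O3 * (?c3 * ?c4)))"
    unfolding c by simp
  also have "\<dots> = - ((?p O0 * ?p O2 * ?c3) * (?p O2 * ?p O3 * ?c4))"
    by (simp only: mult_ac)
  finally show ?thesis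
    unfolding e .
qed

lemma edge_coeff_nonzero:
  assumes "distinct O1" "distinct O2" "resmooths O1 O2 A B A' B'"
  shows "edge_coeff O1 O2 A B A' B' \<noteq> 0"
  by (simp add: edge_coeff_def Let_def ord_sign_def)

text \<open>On two points the first return map is the identity or the exchange, and composing with
  the transposition turns one into the other.\<close>

lemma two_points:
  assumes \<pi>: "permutation \<pi>" and ab: "a \<noteq> b"
  shows "b \<in> orbit (transp a b \<circ> \<pi>) a \<longleftrightarrow> b \<notin> orbit \<pi> a"
proof -
  let ?Q = "{a, b}" and ?t = "transp a b"
  let ?f = "first_return \<pi> ?Q"
  have t: "?t permutes ?Q"
    by (rule permutes_swap_id) auto
  have "permutation (?t \<circ> \<pi>)"
    using \<pi> by (intro permutation_compose permutation_swap_id)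
  then have o: "b \<in> orbit (?t \<circ> \<pi>) a \<longleftrightarrow> b \<in> orbit (first_return (?t \<circ> \<pi>) ?Q) a"
    "b \<in> orbit \<pi> a \<longleftrightarrow> b \<in> orbit ?f a"
    using orbit_first_return[of "?t \<circ> \<pi>" a ?Q] orbit_first_return[OF \<pi>, of a ?Q] by auto
  have c: "first_return (?t \<circ> \<pi>) ?Q a = ?t (?f a)"
    by (rule first_return_compose[OF \<pi> _ t]) simp
  have "?f a \<in> ?Q"
    using bij_betw_first_return[OF \<pi>, of ?Q] by (auto simp: bij_betw_def)
  then consider "?f a = a" | "?f a = b"
    by blast
  then show ?thesis
  proof cases
    case 1
    then have "orbit ?f a = {a}" "b \<in> orbit (first_return (?t \<circ> \<pi>) ?Q) a"
      using c orbit.base[of "first_return (?t \<circ> \<pi>) ?Q" a] by (auto simp: orbit_eq_singleton_iff)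
    then show ?thesis
      using o ab by simp
  next
    case 2
    then have "b \<in> orbit ?f a" "orbit (first_return (?t \<circ> \<pi>) ?Q) a = {a}"
      using c orbit.base[of ?f a] by (auto simp: orbit_eq_singleton_iff)
    then show ?thesis
      using o ab by simp
  qed
qed

text \<open>Two fixed point free involutions generate a dihedral group, whose odd elements have no fixed
  points; so its orbits can be 2-coloured.\<close>

lemma involutions_two_colouring:
  fixes P T :: "'p \<Rightarrow> 'p"
  assumes P: "\<And>x. P (P x) = x" "\<And>x. x \<in> E \<Longrightarrow> P x \<in> E \<and> P x \<noteq> x"
    and T: "\<And>x. T (T x) = x" "\<And>x. x \<in> E \<Longrightarrow> T x \<in> E \<and> T x \<noteq> x"
    and perm: "permutation (T \<circ> P)"
  obtains dir where "\<And>x. x \<in> E \<Longrightarrow> dir (P x) \<longleftrightarrow> \<not> dir x" "\<And>x. x \<in> E \<Longrightarrow> dir (T x) \<longleftrightarrow> \<not> dir x"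
proof -
  let ?\<sigma> = "T \<circ> P"
  have inj: "inj (?\<sigma> ^^ n)" for n
    using perm by (intro inj_fn permutation_bijective[THEN bij_is_inj])
  have self: "x \<in> orbit ?\<sigma> x" for x
    using perm by (rule permutation_self_in_orbit)
  have sym: "x \<in> orbit ?\<sigma> y \<longleftrightarrow> y \<in> orbit ?\<sigma> x" for x y
    using self orbit_swap by metis
  have E: "(?\<sigma> ^^ n) x \<in> E" if "x \<in> E" for n x
    by (induction n) (use that P T in auto)
  \<comment> \<open>The dihedral relation: conjugation by \<open>P\<close> inverts
    \<open>T \<circ> P\<close>, and hence its powers.\<close>
  have conj: "P ((?\<sigma> ^^ n) (P ((?\<sigma> ^^ n) y))) = y" for n y
  proof (induction n arbitrary: y)
    case (Suc n)
    have "P ((?\<sigma> ^^ Suc n) (P ((?\<sigma> ^^ Suc n) y))) = P (?\<sigma> ((?\<sigma> ^^ n) (P ((?\<sigma> ^^ n) (?\<sigma> y)))))"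
      by (simp add: funpow_swap1)
    also have "(?\<sigma> ^^ n) (P ((?\<sigma> ^^ n) (?\<sigma> y))) = P (?\<sigma> y)"
      using Suc.IH[of "?\<sigma> y"] P(1) by metis
    finally show ?case
      using P(1) T(1) by simp
  qed (simp add: P)
  \<comment> \<open>Halve the exponent that leads from \<open>x\<close> to \<open>P x\<close>. If it
    is even, \<open>P\<close> fixes the point \<open>y\<close> halfway; if it is odd,
    \<open>T\<close> fixes \<open>P y\<close>.\<close>
  have free: "P x \<notin> orbit ?\<sigma> x" if x: "x \<in> E" for x
  proof
    assume "P x \<in> orbit ?\<sigma> x"
    then obtain n where n: "P x = (?\<sigma> ^^ n) x"
      by (auto simp: orbit_altdef)
    define m where "m = n div 2"
    define y where "y = (?\<sigma> ^^ m) x"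
    have y: "y \<in> E"
      using E x by (simp add: y_def)
    have 1: "(?\<sigma> ^^ m) (P y) = P x"
      using conj[of m x] P(1) unfolding y_def by metis
    show False
    proof (cases "even n")
      case True
      then have "n = m + m"
        unfolding m_def by presburger
      then have "(?\<sigma> ^^ m) (P y) = (?\<sigma> ^^ m) y"
        using 1 n by (simp add: y_def funpow_add)
      then have "P y = y"
        using inj by (auto dest: injD)
      then show ?thesis
        using P(2)[OF y] by simp
    next
      case False
      then have n_eq: "n = m + (1 + m)"
        unfolding m_def by presburger
      have "(?\<sigma> ^^ n) x = (?\<sigma> ^^ m) (?\<sigma> y)"
        by (subst n_eq) (simp only: y_def funpow_add funpow.simps comp_apply One_nat_def id_apply)
      then have "(?\<sigma> ^^ m) (P y) = (?\<sigma> ^^ m) (?\<sigma> y)"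
        using 1 n by simp
      then have "P y = ?\<sigma> y"
        using inj by (auto dest: injD)
      then show ?thesis
        using T(2)[of "P y"] P(2)[OF y] by auto
    qed
  qed
  have P\<sigma>: "P x \<in> orbit ?\<sigma> (P y)" if xy: "x \<in> orbit ?\<sigma> y" for x y
  proof -
    obtain n where "x = (?\<sigma> ^^ n) y"
      using xy unfolding orbit_altdef by blast
    then have "P y = (?\<sigma> ^^ n) (P x)"
      using conj[of n y] P(1) by metis
    then have "P y \<in> orbit ?\<sigma> (P x)"
      using perm by (metis funpow_in_orbit self)
    then show ?thesis
      using sym by blast
  qed
  \<comment> \<open>\<open>D x\<close> is the orbit of \<open>x\<close> under the dihedral group, a
    union of two orbits of \<open>?\<sigma>\<close>. Since the representative depends on
    \<open>D x\<close> only, \<open>dir\<close> distinguishes these two orbits consistently.\<close>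
  define D where "D x = orbit ?\<sigma> x \<union> orbit ?\<sigma> (P x)" for x
  define dir where "dir x = (x \<in> orbit ?\<sigma> (SOME y. y \<in> D x))" for x
  have orb_sub: "orbit ?\<sigma> x \<subseteq> orbit ?\<sigma> y" if "x \<in> orbit ?\<sigma> y" for x y
    by (rule subsetI) (rule orbit_trans[OF _ that])
  have orb: "orbit ?\<sigma> x = orbit ?\<sigma> y" if "x \<in> orbit ?\<sigma> y" for x y
    by (intro equalityI orb_sub that sym[THEN iffD1, OF that])
  have DP: "D (P x) = D x" for x
    by (auto simp: D_def P)
  have T\<sigma>: "T x \<in> orbit ?\<sigma> (P x)" for x
    using orbit.base[of ?\<sigma> "P x"] P by simp
  have DT: "D (T x) = D x" for x
  proof -
    have "orbit ?\<sigma> (T x) = orbit ?\<sigma> (P x)" "orbit ?\<sigma> (P (T x)) = orbit ?\<sigma> x"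
      using orb[OF T\<sigma>] orb[OF P\<sigma>[OF T\<sigma>]] P(1) by simp_all
    then show ?thesis
      by (auto simp: D_def)
  qed
  have dirP: "dir (P x) \<longleftrightarrow> \<not> dir x" if x: "x \<in> E" for x
  proof -
    let ?r = "SOME y. y \<in> D x"
    have "?r \<in> D x"
      by (rule someI[of _ x]) (simp add: D_def self)
    then have "x \<in> orbit ?\<sigma> ?r \<or> P x \<in> orbit ?\<sigma> ?r"
      using sym by (auto simp: D_def)
    moreover have "\<not> (x \<in> orbit ?\<sigma> ?r \<and> P x \<in> orbit ?\<sigma> ?r)"
      using free[OF x] orb by metis
    ultimately show ?thesis
      by (auto simp: dir_def DP)
  qed
  have dirT: "dir (T x) \<longleftrightarrow> dir (P x)" for x
    unfolding dir_def DP DT using T\<sigma>[of x] sym orb by metis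
  show ?thesis
    by (rule that[of dir]) (simp_all add: dirP dirT)
qed

subsection \<open>Cycles of states\<close>

fun other :: "bool \<Rightarrow> corner \<Rightarrow> corner" where
  "other True SW = NW" | "other True NW = SW" | "other True SE = NE" | "other True NE = SE"
| "other False SW = SE" | "other False SE = SW" | "other False NW = NE" | "other False NE = NW"

lemma other_other [simp]: "other v (other v k) = k"
  and other_neq [simp]: "other v k \<noteq> k"
  and toward_other [simp]: "toward (other v k) \<longleftrightarrow> \<not> toward k"
  by (cases v; cases k; simp)+

lemma strand_iff:
  "{k, k'} \<subseteq> strand1 G S c \<or> {k, k'} \<subseteq> strand2 G S c \<longleftrightarrow> k' = k \<or> k' = other (vertical G S c) k"
  by (cases k; cases k'; cases "vertical G S c") (auto simp: strand1_def strand2_def)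

fun toward_at :: "'c point \<Rightarrow> bool" where
  "toward_at (End c k) = toward k"
| "toward_at (Circle i) = False"

text \<open>All that is used of a plane diagram: there are finitely many crossings and circles, and
  passing on to the next crossing permutes the passages.\<close>

locale diagram =
  fixes G :: "'c abstract_diagram"
  assumes finite_crossings: "finite (crossings G)"
    and finite_circles: "finite (circles G)"
    and bij_next_pass: "bij_betw (next_pass G) (crossings G \<times> UNIV) (crossings G \<times> UNIV)"
begin

abbreviation cyc :: "'c state \<Rightarrow> 'c point \<Rightarrow> 'c point set" where
  "cyc \<equiv> cycle_of G"

definition ends :: "'c point set" where
  "ends = {End c k | c k. c \<in> crossings G}"

definition adj :: "'c point \<Rightarrow> 'c point \<Rightarrow> bool" where
  "adj p q \<longleftrightarrow> semi_arc G p q \<or> semi_arc G q p"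

text \<open>The other end of the semi-arc. Extended by the identity it becomes an involution of all
  points, as \<open>strand_end\<close> is for the strands of a state; a cycle alternates between the
  two.\<close>

definition partner :: "'c point \<Rightarrow> 'c point" where
  "partner p = (if p \<in> ends then THE q. adj p q else p)"

fun strand_end :: "'c state \<Rightarrow> 'c point \<Rightarrow> 'c point" where
  "strand_end S (End c k) = (if c \<in> crossings G then End c (other (vertical G S c) k) else End c k)"
| "strand_end S (Circle i) = Circle i"

lemma End_in_ends [simp]: "End c k \<in> ends \<longleftrightarrow> c \<in> crossings G"
  and Circle_notin_ends [simp]: "Circle i \<notin> ends"
  by (auto simp: ends_def)

lemma points_eq: "points G = ends \<union> Circle ` circles G"
  by (auto simp: points_def ends_def)

lemma finite_ends: "finite ends"
proof -
  have "ends \<subseteq> (\<lambda>(c, k). End c k) ` (crossings G \<times> {SW, SE, NW, NE})"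
    unfolding ends_def using corner.exhaust by (force simp: image_iff)
  then show ?thesis
    by (rule finite_subset) (simp add: finite_crossings)
qed

lemma finite_points: "finite (points G)"
  by (simp add: points_eq finite_ends finite_circles)

lemma semi_arc_ends:
  assumes "semi_arc G p q"
  shows "p \<in> ends" "q \<in> ends" "p \<noteq> q"
proof -
  obtain c r c' r' where *: "c \<in> crossings G" "next_pass G (c, r) = (c', r')"
    "p = End c (if r then NE else NW)" "q = End c' (if r' then SW else SE)"
    using assms unfolding semi_arc_def by blast
  then have "c' \<in> crossings G"
    using bspec[OF bij_betwE[OF bij_next_pass], of "(c, r)"] by simp
  with * show "p \<in> ends" "q \<in> ends" "p \<noteq> q"
    by auto
qed

lemma semi_arc_out:
  assumes "next_pass G (c, k = NE) = (c', r')"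
  shows "semi_arc G (End c k) q \<longleftrightarrow>
    c \<in> crossings G \<and> (k = NE \<or> k = NW) \<and> q = End c' (if r' then SW else SE)"
proof
  assume "semi_arc G (End c k) q"
  then obtain r c2 r2 where *: "c \<in> crossings G" "next_pass G (c, r) = (c2, r2)"
    "k = (if r then NE else NW)" "q = End c2 (if r2 then SW else SE)"
    unfolding semi_arc_def by blast
  have r: "r = (k = NE)" and k: "k = NE \<or> k = NW"
    using *(3) by (cases r; simp)+
  have "c2 = c' \<and> r2 = r'"
    using *(2) assms unfolding r by simp
  then show "c \<in> crossings G \<and> (k = NE \<or> k = NW) \<and> q = End c' (if r' then SW else SE)"
    using *(1,4) k by simp
next
  assume *: "c \<in> crossings G \<and> (k = NE \<or> k = NW) \<and> q = End c' (if r' then SW else SE)"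
  then have "End c k = End c (if k = NE then NE else NW)"
    by auto
  with * assms show "semi_arc G (End c k) q"
    unfolding semi_arc_def by blast
qed

text \<open>For an outgoing corner the neighbour is read off from \<open>next_pass\<close>. For an
  incoming one, surjectivity of \<open>next_pass\<close> provides the preceding passage and
  injectivity its uniqueness.\<close>

lemma adj_unique:
  assumes "p \<in> ends"
  shows "\<exists>!q. adj p q"
proof -
  obtain c k where p: "p = End c k" and c: "c \<in> crossings G"
    using assms by (auto simp: ends_def)
  have inj: "next_pass G (c1, r1) = next_pass G (c2, r2) \<longleftrightarrow> c1 = c2 \<and> r1 = r2"
    if "c1 \<in> crossings G" "c2 \<in> crossings G" for c1 c2 r1 r2
    using bij_next_pass that by (auto simp: bij_betw_def inj_on_def)
  show ?thesis
  proof (cases "k = NE \<or> k = NW")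
    case True
    obtain c' r' where n: "next_pass G (c, k = NE) = (c', r')"
      by (metis surj_pair)
    have "adj p q \<longleftrightarrow> q = End c' (if r' then SW else SE)" for q
    proof -
      have "\<not> semi_arc G q p"
        using True unfolding semi_arc_def p by (metis corner.distinct corner.simps point.inject(1))
      then show ?thesis
        using semi_arc_out[OF n, of q] True c by (simp add: adj_def p)
    qed
    then show ?thesis
      by simp
  next
    case False
    then have k: "k = SW \<or> k = SE"
      using corner.exhaust by blast
    have "(c, k = SW) \<in> next_pass G ` (crossings G \<times> UNIV)"
      using bij_next_pass c by (auto simp: bij_betw_def)
    then obtain c0 r0 where n: "c0 \<in> crossings G" "next_pass G (c0, r0) = (c, k = SW)"
      by (metis (no_types, lifting) imageE mem_Sigma_iff surj_pair)
    have "adj p q \<longleftrightarrow> q = End c0 (if r0 then NE else NW)" for q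
    proof
      assume "adj p q"
      then obtain c1 r1 where 1: "c1 \<in> crossings G" "next_pass G (c1, r1) = (c, k = SW)"
        "q = End c1 (if r1 then NE else NW)"
      proof -
        obtain c2 r2 where n2: "next_pass G (c, k = NE) = (c2, r2)"
          by (metis surj_pair)
        have "semi_arc G q p"
          using \<open>adj p q\<close> semi_arc_out[OF n2, of q] k by (auto simp: adj_def p)
        then obtain c1 r1 c2 r2 where 1: "c1 \<in> crossings G" "next_pass G (c1, r1) = (c2, r2)"
          "q = End c1 (if r1 then NE else NW)" "p = End c2 (if r2 then SW else SE)"
          unfolding semi_arc_def by blast
        then have "c2 = c" "r2 = (k = SW)"
          using k by (auto simp: p split: if_splits)
        with 1 show thesis
          by (intro that[of c1 r1]) auto
      qed
      then show "q = End c0 (if r0 then NE else NW)"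
        using inj[of c1 c0 r1 r0] n by simp
    next
      show "adj p q" if q: "q = End c0 (if r0 then NE else NW)"
      proof -
        have "p = End c (if k = SW then SW else SE)"
          using k by (auto simp: p)
        with n q show ?thesis
          unfolding adj_def semi_arc_def by blast
      qed
    qed
    then show ?thesis
      by simp
  qed
qed

lemma adj_iff: "adj p q \<longleftrightarrow> p \<in> ends \<and> q = partner p"
proof
  assume a: "adj p q"
  then have "p \<in> ends"
    using semi_arc_ends by (auto simp: adj_def)
  then show "p \<in> ends \<and> q = partner p"
    using a adj_unique by (auto simp: partner_def intro: the1_equality[symmetric])
next
  assume "p \<in> ends \<and> q = partner p"
  then show "adj p q"
    using theI'[OF adj_unique, of p] by (simp add: partner_def)
qed

lemma adj_sym: "adj p q \<longleftrightarrow> adj q p"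
  by (auto simp: adj_def)

lemma partner_ends [simp]: "partner p \<in> ends \<longleftrightarrow> p \<in> ends"
  and partner_partner [simp]: "partner (partner p) = p"
  and partner_neq: "p \<in> ends \<Longrightarrow> partner p \<noteq> p"
proof -
  have *: "partner p \<in> ends \<and> partner (partner p) = p \<and> partner p \<noteq> p" if "p \<in> ends" for p
    using that adj_iff[of p "partner p"] adj_sym[of p "partner p"] adj_iff[of "partner p" p]
      semi_arc_ends(3)[of p p] by (auto simp: adj_def)
  have **: "partner p = p" if "p \<notin> ends" for p
    using that by (simp add: partner_def)
  show "partner p \<in> ends \<longleftrightarrow> p \<in> ends" "partner (partner p) = p" "p \<in> ends \<Longrightarrow> partner p \<noteq> p"
    using *[of p] **[of p] by metis+
qed

lemma strand_end_ends [simp]: "strand_end S p \<in> ends \<longleftrightarrow> p \<in> ends"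
  and strand_end_strand_end [simp]: "strand_end S (strand_end S p) = p"
  and strand_end_neq: "p \<in> ends \<Longrightarrow> strand_end S p \<noteq> p"
  and toward_strand_end: "p \<in> ends \<Longrightarrow> toward_at (strand_end S p) \<longleftrightarrow> \<not> toward_at p"
  by (cases p; simp)+

lemma cut_iff: "p \<in> ends \<Longrightarrow> q \<in> ends \<Longrightarrow> cut p q \<longleftrightarrow> toward_at p = toward_at q"
  by (cases p; cases q) auto

lemma travel_arc:
  assumes "travel G S p n q" "q \<in> ends"
  shows "travel G S p (if cut q (partner q) then Suc n else n) (partner q)"
  using assms adj_iff[of q "partner q"] by (intro travel.along_arc) (auto simp: adj_def)

lemma travel_strand:
  assumes "travel G S p n q" "q \<in> ends"
  shows "travel G S p n (strand_end S q)"
proof -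
  obtain c k where q: "q = End c k" "c \<in> crossings G"
    using assms(2) by (auto simp: ends_def)
  show ?thesis
    using travel.along_strand[OF _ q(2) strand_iff[THEN iffD2], of S p n k "other (vertical G S c) k"]
      assms(1) q by simp
qed

text \<open>Each step of \<open>travel\<close> is an application of one of the two involutions; the
  remaining possibility, moving along a strand from a corner to itself, changes nothing.\<close>

lemma travel_induct [consumes 1, case_names start arc strand]:
  assumes "travel G S p n q"
    and "Q 0 p"
    and "\<And>n q. travel G S p n q \<Longrightarrow> Q n q \<Longrightarrow> q \<in> ends \<Longrightarrow>
      Q (if cut q (partner q) then Suc n else n) (partner q)"
    and "\<And>n q. travel G S p n q \<Longrightarrow> Q n q \<Longrightarrow> q \<in> ends \<Longrightarrow> Q n (strand_end S q)"
  shows "Q n q"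
  using assms(1)
proof induction
  case start
  then show ?case by (rule assms(2))
next
  case (along_arc n q r)
  then have "q \<in> ends" "r = partner q"
    using adj_iff[of q r] by (auto simp: adj_def)
  then show ?case
    using assms(3) along_arc by blast
next
  case (along_strand n c k k')
  then have "k' = k \<or> k' = other (vertical G S c) k"
    by (simp only: strand_iff)
  then show ?case
    using assms(4)[of n "End c k"] along_strand by auto
qed

lemma travel_trans:
  assumes "travel G S p n q" "travel G S q m r"
  shows "travel G S p (n + m) r"
  using assms(2)
proof (induction rule: travel_induct)
  case (arc m r)
  then show ?case
    using travel_arc[of S p "n + m" r] by (cases "cut r (partner r)") simp_all
next
  case (strand m r)
  then show ?case
    using travel_strand[of S p "n + m" r] by simp
qed (use assms(1) in simp)

lemma cut_sym: "cut p q \<longleftrightarrow> cut q p"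
  by (cases p; cases q) auto

lemma travel_sym:
  assumes "travel G S p n q"
  shows "travel G S q n p"
  using assms
proof (induction rule: travel_induct)
  case start
  then show ?case by (rule travel.start)
next
  case (arc n q)
  have "travel G S (partner q) (if cut (partner q) q then Suc 0 else 0) q"
    using travel_arc[OF travel.start, of "partner q" S] arc.hyps(2) by simp
  from travel_trans[OF this arc.IH] show ?case
    by (cases "cut q (partner q)") (simp_all add: cut_sym[of q])
next
  case (strand n q)
  have "travel G S (strand_end S q) 0 q"
    using travel_strand[OF travel.start, of "strand_end S q" S] strand.hyps(2) by simp
  from travel_trans[OF this strand.IH] show ?case
    by simp
qed

lemma cycle_of_iff: "q \<in> cyc S p \<longleftrightarrow> (\<exists>n. travel G S p n q)"
  by (simp add: cycle_of_def)

lemma cycle_of_self [simp]: "p \<in> cyc S p"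
  unfolding cycle_of_iff using travel.start by blast

lemma cycle_of_eq: "q \<in> cyc S p \<Longrightarrow> cyc S q = cyc S p"
  unfolding set_eq_iff cycle_of_iff using travel_trans travel_sym by metis

lemma cycle_of_eq_iff: "cyc S q = cyc S p \<longleftrightarrow> q \<in> cyc S p"
  using cycle_of_eq cycle_of_self by blast

lemma cycles_unique: "C \<in> cycles G S \<Longrightarrow> q \<in> C \<Longrightarrow> C = cyc S q"
  unfolding cycles_def using cycle_of_eq by blast

lemma travel_ends: "travel G S p n q \<Longrightarrow> q \<noteq> p \<Longrightarrow> p \<in> ends \<and> q \<in> ends"
  by (induction rule: travel_induct) auto

lemma cycle_of_points: "p \<in> points G \<Longrightarrow> q \<in> cyc S p \<Longrightarrow> q \<in> points G"
  unfolding cycle_of_iff using travel_ends by (metis UnI1 points_eq)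

lemma cycles_points: "C \<in> cycles G S \<Longrightarrow> q \<in> C \<Longrightarrow> q \<in> points G"
  unfolding cycles_def using cycle_of_points by blast

lemma cycle_of_in_cycles: "p \<in> points G \<Longrightarrow> cyc S p \<in> cycles G S"
  by (simp add: cycles_def)

lemma finite_states: "finite (states G)"
  by (simp add: states_def finite_crossings)

lemma ends_points: "p \<in> ends \<Longrightarrow> p \<in> points G"
  by (simp add: points_eq)

subsection \<open>Colourings and orientations\<close>

definition coherent :: "'c state \<Rightarrow> ('c point \<Rightarrow> bool) \<Rightarrow> bool" where
  "coherent S K \<longleftrightarrow> (\<forall>p\<in>ends. (K (partner p) \<noteq> K p) = cut p (partner p)) \<and>
     (\<forall>p\<in>ends. K (strand_end S p) = K p)"

lemma coherent_travel:
  assumes "coherent S K" "travel G S p n q"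
  shows "K q \<longleftrightarrow> K p = even n"
  using assms(2) by (induction rule: travel_induct) (use assms(1) in \<open>auto simp: coherent_def\<close>)

text \<open>A coloured cycle is the same thing as an oriented one: red arcs carry the canonical
  orientation and green arcs the opposite one. The points \<open>p\<close> with \<open>exit K p\<close> are those at which
  the oriented strands leave their crossings.\<close>

definition exit :: "('c point \<Rightarrow> bool) \<Rightarrow> 'c point \<Rightarrow> bool" where
  "exit K p \<longleftrightarrow> K p \<noteq> toward_at p"

text \<open>A cut locus sits on a semi-arc exactly if its ends agree in \<open>toward_at\<close>,
  and exactly then the colour changes. In both cases the orientation given by the colours runs from
  one end of the semi-arc to the other.\<close>

lemma exit_partner: "coherent S K \<Longrightarrow> p \<in> ends \<Longrightarrow> exit K (partner p) \<longleftrightarrow> \<not> exit K p"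
  using cut_iff[of p "partner p"] by (auto simp: coherent_def exit_def)

lemma exit_strand_end: "coherent S K \<Longrightarrow> p \<in> ends \<Longrightarrow> exit K (strand_end S p) \<longleftrightarrow> \<not> exit K p"
  by (auto simp: coherent_def exit_def toward_strand_end)

lemma permutes_ends: "strand_end S \<circ> partner permutes ends"
proof (rule bij_imp_permutes)
  show "bij_betw (strand_end S \<circ> partner) ends ends"
    by (rule bij_betw_byWitness[where f' = "partner \<circ> strand_end S"]) auto
  show "(strand_end S \<circ> partner) x = x" if "x \<notin> ends" for x
    using that by (cases x) (auto simp: partner_def)
qed

text \<open>An orientation of all cycles is a 2-colouring that alternates under both involutions;
  comparing it with the source-sink orientation gives a coherent colouring.\<close>

lemma coherent_exists: "\<exists>K. coherent S K"
proof -
  have "permutation (strand_end S \<circ> partner)"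
    using permutes_ends finite_ends by (auto simp: permutation_permutes)
  then obtain dir where dir: "\<And>x. x \<in> ends \<Longrightarrow> dir (partner x) \<longleftrightarrow> \<not> dir x"
    "\<And>x. x \<in> ends \<Longrightarrow> dir (strand_end S x) \<longleftrightarrow> \<not> dir x"
    using involutions_two_colouring[of partner ends "strand_end S"] partner_neq strand_end_neq
    by (metis partner_ends partner_partner strand_end_ends strand_end_strand_end)
  have "coherent S (\<lambda>p. dir p \<noteq> toward_at p)"
    using dir cut_iff by (auto simp: coherent_def toward_strand_end)
  then show ?thesis
    by blast
qed

text \<open>A coherent colouring changes once at every cut locus, so its values at the two ends fix
  the parity. With \<open>q = p\<close> this says that a cycle contains an even number of cut
  loci.\<close>

lemma travel_parity: "travel G S p n q \<Longrightarrow> travel G S p m q \<Longrightarrow> even n = even m"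
  using coherent_exists coherent_travel by metis

lemma cuts_met_parity: "travel G S p n q \<Longrightarrow> even (cuts_met G S p q) = even n"
  unfolding cuts_met_def using travel_parity LeastI[of "\<lambda>n. travel G S p n q"] by blast

lemma coherent_cuts_met:
  assumes "coherent S K" "q \<in> cyc S p"
  shows "K q \<longleftrightarrow> K p = even (cuts_met G S p q)"
  using assms coherent_travel cuts_met_parity unfolding cycle_of_iff by metis

lemma coherent_eq_on_cycle:
  assumes "coherent S K" "coherent S K'" "q \<in> cyc S p" "K p = K' p"
  shows "K q = K' q"
  using coherent_cuts_met[OF assms(1,3)] coherent_cuts_met[OF assms(2,3)] assms(4) by simp

text \<open>Coherence is preserved by exchanging the colours on a whole cycle, so an arbitrary
  coherent colouring can be corrected on each cycle where it has the wrong value at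
  \<open>m C\<close>.\<close>

lemma coherent_prescribed:
  assumes "\<And>C. C \<in> cycles G S \<Longrightarrow> m C \<in> C"
  obtains K where "coherent S K" "\<And>C. C \<in> cycles G S \<Longrightarrow> K (m C) = col C"
proof -
  obtain K0 where K0: "coherent S K0"
    using coherent_exists by blast
  define K where "K p = (K0 p = (K0 (m (cyc S p)) = col (cyc S p)))" for p
  have "cyc S (partner p) = cyc S p" "cyc S (strand_end S p) = cyc S p"
    if "p \<in> ends" for p
    using travel_arc[OF travel.start that, of S] travel_strand[OF travel.start that, of S]
    by (auto intro!: cycle_of_eq simp: cycle_of_iff)
  then have "coherent S K"
    using K0 by (auto simp: coherent_def K_def)
  moreover have "K (m C) = col C" if "C \<in> cycles G S" for C
    unfolding K_def cycles_unique[OF that assms[OF that], symmetric] by blast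
  ultimately show ?thesis
    by (rule that)
qed

definition exits :: "('c point \<Rightarrow> bool) \<Rightarrow> 'c point set" where
  "exits K = {p \<in> ends. exit K p}"

text \<open>From an exit along the semi-arc to the next crossing, then along the strand to the exit
  there. The orbits on \<open>exits K\<close> are the oriented cycles of the state.\<close>

definition flow :: "('c point \<Rightarrow> bool) \<Rightarrow> 'c state \<Rightarrow> 'c point \<Rightarrow> 'c point" where
  "flow K S p = (if p \<in> exits K then strand_end S (partner p) else p)"

lemma flow_permutes:
  assumes "coherent S K"
  shows "flow K S permutes exits K"
proof (rule bij_imp_permutes)
  have "flow K S ` exits K \<subseteq> exits K"
    using exit_partner[OF assms] exit_strand_end[OF assms] by (auto simp: flow_def exits_def)
  moreover have "inj_on (flow K S) (exits K)"
    by (rule inj_onI) (metis flow_def partner_partner strand_end_strand_end)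
  moreover have "finite (exits K)"
    using finite_ends by (simp add: exits_def)
  ultimately show "bij_betw (flow K S) (exits K) (exits K)"
    by (simp add: bij_betw_def endo_inj_surj)
qed (simp add: flow_def)

lemma permutation_flow: "coherent S K \<Longrightarrow> permutation (flow K S)"
  using flow_permutes finite_ends unfolding permutation_permutes exits_def
  by (metis finite_Collect_conjI Collect_mem_eq)

text \<open>\<open>travel\<close> may run against the orientation, whereas an orbit is followed in
  one direction only; finite order lets orbits be traced backwards as well. The invariant assigns to
  each point reached that end of its semi-arc which is an exit.\<close>

lemma cycle_of_exit_iff:
  assumes K: "coherent S K" and x: "x \<in> exits K" and y: "y \<in> exits K"
  shows "y \<in> cyc S x \<longleftrightarrow> y \<in> orbit (flow K S) x"
proof
  note perm = permutation_flow[OF K]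
  let ?f = "flow K S"
  have pull: "z \<in> orbit ?f x" if "?f z \<in> orbit ?f x" for z
    using that permutation_orbit_step[OF perm] permutation_self_in_orbit[OF perm]
    by (metis orbit.base orbit_swap orbit_trans)
  assume "y \<in> cyc S x"
  then obtain n where n: "travel G S x n y"
    by (auto simp: cycle_of_iff)
  have "q \<in> ends \<and> (if exit K q then q else partner q) \<in> orbit ?f x" if "travel G S x n q" for n q
    using that
  proof (induction rule: travel_induct)
    case start
    then show ?case
      using x permutation_self_in_orbit[OF perm] by (auto simp: exits_def)
  next
    case (arc n q)
    then show ?case
      using exit_partner[OF K, of q] by (auto split: if_splits)
  next
    case (strand n q)
    show ?case
    proof (cases "exit K q")
      case True
      then have "partner (strand_end S q) \<in> exits K"
        using strand exit_partner[OF K] exit_strand_end[OF K] by (auto simp: exits_def)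
      then have "?f (partner (strand_end S q)) = q"
        by (simp add: flow_def)
      then have "partner (strand_end S q) \<in> orbit ?f x"
        using pull strand True by auto
      then show ?thesis
        using True strand exit_strand_end[OF K] by auto
    next
      case False
      then have "partner q \<in> exits K"
        using strand exit_partner[OF K] by (auto simp: exits_def)
      then have "?f (partner q) = strand_end S q"
        by (simp add: flow_def)
      moreover have "?f (partner q) \<in> orbit ?f x"
        using strand False by (auto intro: orbit.step)
      ultimately show ?thesis
        using False strand exit_strand_end[OF K] by auto
    qed
  qed
  from this[OF n] show "y \<in> orbit ?f x"
    using y by (auto simp: exits_def)
next
  let ?f = "flow K S"
  have step: "?f z \<in> exits K \<and> ?f z \<in> cyc S z" if "z \<in> exits K" for z
  proof
    show "?f z \<in> exits K"
      using permutes_in_image[OF flow_permutes[OF K]] that by simp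
    have z: "z \<in> ends"
      using that by (simp add: exits_def)
    then have "\<exists>n. travel G S z n (strand_end S (partner z))"
      using travel_strand[OF travel_arc[OF travel.start]] by (metis partner_ends)
    then show "?f z \<in> cyc S z"
      using that by (simp add: flow_def cycle_of_iff)
  qed
  assume "y \<in> orbit ?f x"
  then have "y \<in> exits K \<and> y \<in> cyc S x"
  proof induction
    case base
    then show ?case
      using step x by blast
  next
    case (step z)
    then show ?case
      using \<open>\<And>z. z \<in> exits K \<Longrightarrow> ?f z \<in> exits K \<and> ?f z \<in> cyc S z\<close> cycle_of_eq by blast
  qed
  then show "y \<in> cyc S x" ..
qed

end

lemma map2_append_maps:
  "map2 (\<lambda>f x. f x) (map F L @ map F' R) (map x L @ map x' R) = map (\<lambda>C. F C (x C)) L @ map (\<lambda>C. F' C (x' C)) R"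
  by (simp add: map2_map_map)

text \<open>The two blocks are those of a partial differential, cycles through the crossing and
  remaining cycles, which carry different numbers of bars. An exponent matters only by its parity,
  as the bar exchanges the idempotents.\<close>

lemma factorwise_bars:
  assumes "\<And>C. C \<in> set L \<Longrightarrow> h1' C = (h1 C = even (n1 C))"
    and "\<And>C. C \<in> set R \<Longrightarrow> h2' C = (h2 C = even (n2 C))"
  shows "factorwise (map (\<lambda>n. bar ^^ n) (map n1 L @ map n2 R))
      (tensor (map (\<lambda>C. cidem (h1 C)) L @ map (\<lambda>C. cidem (h2 C)) R)) =
    tensor (map (\<lambda>C. cidem (h1' C)) L @ map (\<lambda>C. cidem (h2' C)) R)"
proof -
  have "factorwise (map (\<lambda>C. bar ^^ n1 C) L @ map (\<lambda>C. bar ^^ n2 C) R)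
      (tensor (map (\<lambda>C. cidem (h1 C)) L @ map (\<lambda>C. cidem (h2 C)) R)) =
    tensor (map2 (\<lambda>f x. f x) (map (\<lambda>C. bar ^^ n1 C) L @ map (\<lambda>C. bar ^^ n2 C) R)
      (map (\<lambda>C. cidem (h1 C)) L @ map (\<lambda>C. cidem (h2 C)) R))"
    by (rule factorwise_tensor) (auto simp: vlinear_bar_funpow)
  also have "\<dots> = tensor (map (\<lambda>C. cidem (h1' C)) L @ map (\<lambda>C. cidem (h2' C)) R)"
    unfolding map2_append_maps bar_funpow_cidem using assms
    by (intro arg_cong[of _ _ tensor] arg_cong2[of _ _ _ _ append] map_cong) auto
  finally show ?thesis
    by (simp add: comp_def)
qed

section \<open>Resmoothing one crossing\<close>

context diagram
begin

lemma vertical_insert: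
  "c \<noteq> \<tau> \<Longrightarrow> vertical G (insert \<tau> S) c = vertical G S c"
  "\<tau> \<notin> S \<Longrightarrow> vertical G (insert \<tau> S) \<tau> = (\<not> vertical G S \<tau>)"
  "\<tau> \<notin> S \<Longrightarrow> vertical G S \<tau> = positive G \<tau>"
  by (auto simp: vertical_def)

text \<open>A symmetric substitute for \<open>S' = insert \<tau> S\<close>, so that each argument
  covers smoothing a crossing differently and undoing this.\<close>

definition agree_off :: "'c \<Rightarrow> 'c state \<Rightarrow> 'c state \<Rightarrow> bool" where
  "agree_off \<tau> S S' \<longleftrightarrow> (\<forall>c. c \<noteq> \<tau> \<longrightarrow> vertical G S c = vertical G S' c)"

lemma agree_off_insert: "agree_off \<tau> S (insert \<tau> S)" "agree_off \<tau> (insert \<tau> S) S"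
  by (auto simp: agree_off_def vertical_insert)

lemma strand_end_agree_off:
  "agree_off \<tau> S S' \<Longrightarrow> (\<And>k. p \<noteq> End \<tau> k) \<Longrightarrow> strand_end S p = strand_end S' p"
proof (cases p)
  case (End c k)
  assume "agree_off \<tau> S S'" "\<And>k. p \<noteq> End \<tau> k"
  then have "vertical G S c = vertical G S' c"
    unfolding agree_off_def End by blast
  then show ?thesis
    by (simp add: End)
qed simp

lemma travel_agree_off:
  assumes agree: "agree_off \<tau> S S'" and off: "\<And>k. End \<tau> k \<notin> cyc S p"
  shows "travel G S' p n q \<longleftrightarrow> travel G S p n q"
proof -
  \<comment> \<open>Both conclusions are carried along together: travel in \<open>S\<close> keeps
    the route on a cycle without corners of \<open>\<tau>\<close>, and there the two states have the
    same strands.\<close>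
  have "travel G S p n q \<and> travel G S' p n q" if "travel G T p n q" "T \<in> {S, S'}" for T
    using that(1)
  proof (induction rule: travel_induct)
    case start
    then show ?case by (simp add: travel.start)
  next
    case (arc n q)
    then show ?case by (intro conjI travel_arc) auto
  next
    case (strand n q)
    then have "q \<noteq> End \<tau> k" for k
      using off by (auto simp: cycle_of_iff)
    then have "strand_end S q = strand_end S' q"
      by (rule strand_end_agree_off[OF agree])
    then show ?case
      using strand travel_strand[of S p n q] travel_strand[of S' p n q] that(2) by auto
  qed
  then show ?thesis
    by blast
qed

lemma cycle_of_agree_off:
  assumes "agree_off \<tau> S S'" "\<And>k. End \<tau> k \<notin> cyc S p"
  shows "cyc S' p = cyc S p"
  using travel_agree_off[OF assms] by (auto simp: cycle_of_def)

lemma cycles_agree_off: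
  assumes "agree_off \<tau> S S'" "C \<in> cycles G S" "\<And>k. End \<tau> k \<notin> C"
  shows "C \<in> cycles G S'"
  using assms cycle_of_agree_off[OF assms(1)] by (force simp: cycles_def)

lemma cycle_of_other:
  assumes "\<tau> \<in> crossings G"
  shows "cyc S (End \<tau> (other (vertical G S \<tau>) k)) = cyc S (End \<tau> k)"
  using assms travel_strand[OF travel.start, of "End \<tau> k" S]
  by (intro cycle_of_eq) (auto simp: cycle_of_iff)

lemma End_in_local_cycle:
  assumes "\<tau> \<in> crossings G"
  shows "cyc S (End \<tau> k) \<in> {cyc S (point1 G S \<tau>), cyc S (point2 G S \<tau>)}"
  using cycle_of_other[OF assms, of S k]
  by (cases k; cases "vertical G S \<tau>") (auto simp: point1_def point2_def)

definition mono_at :: "('c point \<Rightarrow> bool) \<Rightarrow> 'c \<Rightarrow> bool" where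
  "mono_at K \<tau> \<longleftrightarrow> (\<forall>k. K (End \<tau> k) = K (End \<tau> SW))"

lemma mono_at_eq: "mono_at K \<tau> \<Longrightarrow> K (End \<tau> k) = K (End \<tau> k')"
  unfolding mono_at_def by metis

lemma mono_at_iff:
  assumes "coherent S K" "\<tau> \<in> crossings G"
  shows "mono_at K \<tau> \<longleftrightarrow> K (point1 G S \<tau>) = K (point2 G S \<tau>)"
proof
  assume "mono_at K \<tau>"
  then show "K (point1 G S \<tau>) = K (point2 G S \<tau>)"
    using mono_at_eq by (simp add: point1_def point2_def)
next
  have o: "K (End \<tau> (other (vertical G S \<tau>) k)) = K (End \<tau> k)" for k
    using assms unfolding coherent_def by (metis End_in_ends strand_end.simps(1))
  assume "K (point1 G S \<tau>) = K (point2 G S \<tau>)"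
  then have "K (End \<tau> k) = K (End \<tau> SW)" for k
    using o[of k] o[of SW] o[of NE] o[of NW] o[of SE]
    by (cases k; cases "vertical G S \<tau>") (auto simp: point1_def point2_def)
  then show "mono_at K \<tau>"
    by (simp add: mono_at_def)
qed

text \<open>When the four corners at the crossing have the same colour, every way of joining them is
  compatible with the colouring.\<close>

lemma coherent_agree_off:
  assumes "coherent S K" "mono_at K \<tau>" "agree_off \<tau> S S'"
  shows "coherent S' K"
proof -
  have "K (strand_end S' p) = K p" if p: "p \<in> ends" for p
  proof (cases "\<exists>k. p = End \<tau> k")
    case True
    then obtain k where k: "p = End \<tau> k" by blast
    then show ?thesis
      using p mono_at_eq[OF assms(2), of "other (vertical G S' \<tau>) k" k] by simp
  next
    case False
    then have "strand_end S' p = strand_end S p"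
      using strand_end_agree_off[OF assms(3), of p] by auto
    then show ?thesis
      using assms(1) p by (simp add: coherent_def)
  qed
  then show ?thesis
    using assms(1) by (simp add: coherent_def)
qed

lemmas coherent_insert = coherent_agree_off[OF _ _ agree_off_insert(1)]

text \<open>At a monochromatic crossing these are the exits of the two strands, numbered as in the state
  before the crossing is resmoothed.\<close>

definition exit1 :: "('c point \<Rightarrow> bool) \<Rightarrow> 'c \<Rightarrow> 'c point" where
  "exit1 K \<tau> = End \<tau> (if K (End \<tau> SW) then NW else if positive G \<tau> then SW else NE)"

definition exit2 :: "('c point \<Rightarrow> bool) \<Rightarrow> 'c \<Rightarrow> 'c point" where
  "exit2 K \<tau> = End \<tau> (if K (End \<tau> SW) then SE else if positive G \<tau> then NE else SW)"

lemma exit_neq: "exit1 K \<tau> \<noteq> exit2 K \<tau>"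
  by (simp add: exit1_def exit2_def)

lemma exits_mono:
  assumes "mono_at K \<tau>" "\<tau> \<in> crossings G"
  shows "exit1 K \<tau> \<in> exits K" "exit2 K \<tau> \<in> exits K"
  using assms mono_at_eq[OF assms(1), of NW SW] mono_at_eq[OF assms(1), of NE SW]
    mono_at_eq[OF assms(1), of SE SW]
  by (simp_all add: exits_def exit_def exit1_def exit2_def)

text \<open>The two exits are opposite corners, hence lie on different strands in either smoothing,
  and each corner shares a strand with one of them.\<close>

lemma End_in_exit_cycle:
  assumes "\<tau> \<in> crossings G"
  shows "cyc S (End \<tau> k) \<in> {cyc S (exit1 K \<tau>), cyc S (exit2 K \<tau>)}"
  using cycle_of_other[OF assms, of S k]
  by (cases k; cases "vertical G S \<tau>") (auto simp: exit1_def exit2_def)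

text \<open>\<open>NW\<close> always lies on strand 1 and \<open>SE\<close> on strand 2, while
  \<open>SW\<close> and \<open>NE\<close> change their strands between the vertical and the
  horizontal smoothing. So the red exits keep their local numbers and the green ones exchange
  them.\<close>

lemma local_cycles_exits:
  assumes "\<tau> \<in> crossings G" "\<tau> \<notin> S"
  shows "cyc S (point1 G S \<tau>) = cyc S (exit1 K \<tau>)"
    "cyc S (point2 G S \<tau>) = cyc S (exit2 K \<tau>)"
    "cyc (insert \<tau> S) (point1 G (insert \<tau> S) \<tau>) =
      cyc (insert \<tau> S) (if K (End \<tau> SW) then exit1 K \<tau> else exit2 K \<tau>)"
    "cyc (insert \<tau> S) (point2 G (insert \<tau> S) \<tau>) =
      cyc (insert \<tau> S) (if K (End \<tau> SW) then exit2 K \<tau> else exit1 K \<tau>)"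
  using cycle_of_other[OF assms(1), of S SW] cycle_of_other[OF assms(1), of S SE]
    cycle_of_other[OF assms(1), of S NE] cycle_of_other[OF assms(1), of "insert \<tau> S" SW]
    cycle_of_other[OF assms(1), of "insert \<tau> S" NE] cycle_of_other[OF assms(1), of "insert \<tau> S" SE]
    vertical_insert(2,3)[OF assms(2)]
  by (cases "positive G \<tau>"; auto simp: point1_def point2_def exit1_def exit2_def)+

text \<open>A strand entering the crossing is joined to one exit before and to the other exit after
  the resmoothing; elsewhere nothing changes.\<close>

lemma flow_insert:
  assumes K: "coherent S K" and mono: "mono_at K \<tau>" and \<tau>: "\<tau> \<in> crossings G" "\<tau> \<notin> S"
  shows "flow K (insert \<tau> S) = transp (exit1 K \<tau>) (exit2 K \<tau>) \<circ> flow K S"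
proof
  fix p
  let ?t = "transp (exit1 K \<tau>) (exit2 K \<tau>)"
  show "flow K (insert \<tau> S) p = (?t \<circ> flow K S) p"
  proof (cases "p \<in> exits K")
    case False
    then have "?t p = p"
      using exits_mono[OF mono \<tau>(1)] by (intro transpose_apply_other) auto
    with False show ?thesis
      by (simp add: flow_def)
  next
    case True
    let ?q = "partner p"
    have q: "?q \<in> ends" "\<not> exit K ?q"
      using True exit_partner[OF K] by (auto simp: exits_def)
    have "strand_end (insert \<tau> S) ?q = ?t (strand_end S ?q)"
    proof (cases "\<exists>k. ?q = End \<tau> k")
      case True
      then obtain k where k: "?q = End \<tau> k" by blast
      have "K (End \<tau> SW) = toward k"
        using q(2) mono_at_eq[OF mono, of k SW] by (simp add: k exit_def)
      then show ?thesis
        using \<tau> vertical_insert(2,3)[OF \<tau>(2)]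
        by (cases k; cases "positive G \<tau>")
          (simp_all add: k exit1_def exit2_def Transposition.transpose_def)
    next
      case False
      then have "strand_end (insert \<tau> S) ?q = strand_end S ?q"
        using strand_end_agree_off[OF agree_off_insert(1), of ?q \<tau> S] by auto
      moreover have "strand_end S ?q \<noteq> End \<tau> k" for k
        using False \<tau> by (cases ?q) (auto split: if_splits)
      then have "?t (strand_end S ?q) = strand_end S ?q"
        by (intro transpose_apply_other) (auto simp: exit1_def exit2_def)
      ultimately show ?thesis
        by simp
    qed
    with True show ?thesis
      by (simp add: flow_def)
  qed
qed

text \<open>Resmoothing a monochromatic crossing is orientable, hence never turns one cycle into one.\<close>

lemma exits_same_cycle_insert:
  assumes K: "coherent S K" and mono: "mono_at K \<tau>" and \<tau>: "\<tau> \<in> crossings G" "\<tau> \<notin> S"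
  shows "cyc (insert \<tau> S) (exit1 K \<tau>) = cyc (insert \<tau> S) (exit2 K \<tau>) \<longleftrightarrow>
    cyc S (exit1 K \<tau>) \<noteq> cyc S (exit2 K \<tau>)"
proof -
  note e = exits_mono[OF mono \<tau>(1)]
  have "exit2 K \<tau> \<in> cyc (insert \<tau> S) (exit1 K \<tau>) \<longleftrightarrow> exit2 K \<tau> \<notin> cyc S (exit1 K \<tau>)"
    unfolding cycle_of_exit_iff[OF K e] cycle_of_exit_iff[OF coherent_insert[OF K mono] e]
      flow_insert[OF assms] by (rule two_points[OF permutation_flow[OF K] exit_neq])
  then show ?thesis
    unfolding cycle_of_eq_iff[symmetric] by metis
qed

end

section \<open>Global orders, marked points and squares of states\<close>

locale khovanov_data = diagram G
  for G :: "'c abstract_diagram" +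
  fixes ord :: "'c order_choice" and mark :: "'c mark_choice"
  assumes orders: "global_orders G ord" and marks: "marked_points G mark"
begin

lemma set_ord: "S \<in> states G \<Longrightarrow> set (ord S) = cycles G S"
  and distinct_ord: "S \<in> states G \<Longrightarrow> distinct (ord S)"
  using orders by (auto simp: global_orders_def)

lemma mark_in: "S \<in> states G \<Longrightarrow> C \<in> cycles G S \<Longrightarrow> mark S C \<in> C"
  using marks by (auto simp: marked_points_def)

lemma insert_states: "S \<in> states G \<Longrightarrow> \<tau> \<in> crossings G \<Longrightarrow> insert \<tau> S \<in> states G"
  by (auto simp: states_def)

lemma cycles_diff_subset:
  assumes "agree_off \<tau> S S'" "\<tau> \<in> crossings G" "C \<in> cycles G S"
    and "\<And>k. cyc S (End \<tau> k) \<in> {A, B}" "C \<notin> {A, B}"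
  shows "C \<in> cycles G S'" "\<And>k. End \<tau> k \<notin> C"
proof -
  show *: "End \<tau> k \<notin> C" for k
    using cycles_unique[OF assms(3)] assms(4,5) by metis
  show "C \<in> cycles G S'"
    using cycles_agree_off[OF assms(1,3) *] .
qed

text \<open>Cycles avoiding the crossing belong to both states, so only those through its corners
  are exchanged. The corners \<open>a\<close>, \<open>b\<close> and \<open>a'\<close>,
  \<open>b'\<close> may be chosen freely as long as they meet all of these; both strands and exits
  are used.\<close>

lemma resmooths_points:
  assumes S: "S \<in> states G" and \<tau>: "\<tau> \<in> crossings G"
    and P: "\<And>k. cyc S (End \<tau> k) \<in> {cyc S (End \<tau> a), cyc S (End \<tau> b)}"
    and P': "\<And>k. cyc (insert \<tau> S) (End \<tau> k) \<in>
      {cyc (insert \<tau> S) (End \<tau> a'), cyc (insert \<tau> S) (End \<tau> b')}"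
  shows "resmooths (ord S) (ord (insert \<tau> S)) (cyc S (End \<tau> a)) (cyc S (End \<tau> b))
    (cyc (insert \<tau> S) (End \<tau> a')) (cyc (insert \<tau> S) (End \<tau> b'))"
proof -
  let ?S' = "insert \<tau> S"
  let ?A = "cyc S (End \<tau> a)" and ?B = "cyc S (End \<tau> b)"
  let ?A' = "cyc ?S' (End \<tau> a')" and ?B' = "cyc ?S' (End \<tau> b')"
  have pts: "End \<tau> k \<in> points G" for k
    using \<tau> by (simp add: ends_points)
  note sub = cycles_diff_subset[OF agree_off_insert(1) \<tau> _ P]
  note sub' = cycles_diff_subset[OF agree_off_insert(2) \<tau> _ P']
  have notin: "cyc ?S' (End \<tau> k) \<notin> cycles G S - {?A, ?B}" for k
    using sub(2) cycle_of_self by blast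
  have notin': "cyc S (End \<tau> k) \<notin> cycles G ?S' - {?A', ?B'}" for k
    using sub'(2) cycle_of_self by blast
  have "cycles G ?S' = {?A', ?B'} \<union> (cycles G S - {?A, ?B})"
  proof
    show "cycles G ?S' \<subseteq> {?A', ?B'} \<union> (cycles G S - {?A, ?B})"
      using sub'(1) notin' by blast
    show "{?A', ?B'} \<union> (cycles G S - {?A, ?B}) \<subseteq> cycles G ?S'"
      using sub(1) cycle_of_in_cycles[OF pts] by blast
  qed
  then show ?thesis
    using notin cycle_of_in_cycles[OF pts] S \<tau> by (simp add: resmooths_def set_ord insert_states)
qed

definition coloured :: "'c state \<Rightarrow> ('c point \<Rightarrow> bool) \<Rightarrow> word vec" where
  "coloured S K = tensor (map (\<lambda>C. cidem (K (mark S C))) (ord S))"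

text \<open>Naming the cycles after exits instead of local strands makes the scalar depend on the
  oriented cycles alone, with no separate sign for green.\<close>

definition edge :: "'c state \<Rightarrow> ('c point \<Rightarrow> bool) \<Rightarrow> 'c \<Rightarrow> int" where
  "edge S K \<tau> = edge_coeff (ord S) (ord (insert \<tau> S))
     (cyc S (exit1 K \<tau>)) (cyc S (exit2 K \<tau>))
     (cyc (insert \<tau> S) (exit1 K \<tau>)) (cyc (insert \<tau> S) (exit2 K \<tau>))"

lemma resmooths_exits:
  assumes "S \<in> states G" "\<tau> \<in> crossings G"
  shows "resmooths (ord S) (ord (insert \<tau> S))
     (cyc S (exit1 K \<tau>)) (cyc S (exit2 K \<tau>))
     (cyc (insert \<tau> S) (exit1 K \<tau>)) (cyc (insert \<tau> S) (exit2 K \<tau>))"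
  using End_in_exit_cycle[OF assms(2), of _ _ K] unfolding exit1_def exit2_def
  by (intro resmooths_points assms)

lemma edge_nonzero: "S \<in> states G \<Longrightarrow> \<tau> \<in> crossings G \<Longrightarrow> edge S K \<tau> \<noteq> 0"
  unfolding edge_def
  by (intro edge_coeff_nonzero resmooths_exits distinct_ord insert_states)

text \<open>For the states of a square: their flows are those of \<open>S\<close> followed by a
  permutation \<open>t'\<close> of the four exits, which acts on the indices as
  \<open>t\<close>.\<close>

lemma tracks_state:
  assumes \<rho>: "induces (flow K S) q \<rho>"
    and "\<rho> permutes {..<4}" "\<forall>i<4. q i \<in> exits K"
    and "t permutes {..<4}" "t' permutes q ` {..<4}" "\<forall>i<4. t' (q i) = q (t i)"
    and "S' \<in> states G" "coherent S' K" "flow K S' = t' \<circ> flow K S"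
  shows "tracks q (t \<circ> \<rho>) (ord S') (\<lambda>i. cyc S' (q i))"
  unfolding tracks_def
proof (intro conjI allI impI ballI)
  show "t \<circ> \<rho> permutes {..<4}"
    using assms by (intro permutes_compose)
  show "distinct (ord S')"
    using assms by (simp add: distinct_ord)
  show "cyc S' (q i) \<in> set (ord S')" if "i < 4" for i
    using assms(3) that assms(7) by (simp add: set_ord cycle_of_in_cycles ends_points exits_def)
  show "C = cyc S' (q i)" if "C \<in> set (ord S')" "i < 4" "q i \<in> C" for C i
    using that cycles_unique unfolding set_ord[OF assms(7)] by blast
  show "q j \<in> cyc S' (q i) \<longleftrightarrow> j \<in> orbit (t \<circ> \<rho>) i" if "i < 4" "j < 4" for i j
  proof -
    have "q j \<in> cyc S' (q i) \<longleftrightarrow> q j \<in> orbit (t' \<circ> flow K S) (q i)"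
      using cycle_of_exit_iff[OF assms(8)] assms(3) that unfolding assms(9) by blast
    also have "\<dots> \<longleftrightarrow> j \<in> orbit (t \<circ> \<rho>) i"
      using \<rho> assms(4-6) that unfolding induces_def by blast
    finally show ?thesis .
  qed
qed

text \<open>The exits at the two crossings are the same points in all four states, because the
  colouring stays coherent. So the four flows differ only by the two transpositions of
  exits.\<close>

lemma edge_anticommute:
  assumes S: "S \<in> states G" and K: "coherent S K" and neq: "\<sigma> \<noteq> \<tau>"
    and \<sigma>: "\<sigma> \<in> crossings G" "\<sigma> \<notin> S" "mono_at K \<sigma>"
    and \<tau>: "\<tau> \<in> crossings G" "\<tau> \<notin> S" "mono_at K \<tau>"
  shows "edge S K \<sigma> * edge (insert \<sigma> S) K \<tau> = - (edge S K \<tau> * edge (insert \<tau> S) K \<sigma>)"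
proof -
  \<comment> \<open>The numbering fits \<open>swap01\<close> and \<open>swap23\<close>: indices 0
    and 1 for \<open>\<sigma>\<close>, 2 and 3 for \<open>\<tau>\<close>.\<close>
  define q where "q i = [exit1 K \<sigma>, exit2 K \<sigma>, exit1 K \<tau>, exit2 K \<tau>] ! i" for i :: nat
  have q_simps: "q 0 = exit1 K \<sigma>" "q 1 = exit2 K \<sigma>" "q (Suc 0) = exit2 K \<sigma>" "q 2 = exit1 K \<tau>" "q 3 = exit2 K \<tau>"
    by (simp_all add: q_def)
  have lt4: "{..<4} = {0, 1, 2, 3 :: nat}"
    by auto
  have neqs: "exit1 K \<sigma> \<noteq> exit1 K \<tau>" "exit1 K \<sigma> \<noteq> exit2 K \<tau>" "exit2 K \<sigma> \<noteq> exit1 K \<tau>"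
    "exit2 K \<sigma> \<noteq> exit2 K \<tau>"
    using neq by (auto simp: exit1_def exit2_def)
  note neqs = neqs neqs[symmetric] exit_neq exit_neq[symmetric]
  have inj: "inj_on q {..<4}"
    using neqs by (simp add: lt4 q_simps)
  obtain \<rho> where \<rho>: "\<rho> permutes {..<4}" "induces (flow K S) q \<rho>"
    using four_points[OF permutation_flow[OF K] inj] by blast
  let ?s = "transp (exit1 K \<sigma>) (exit2 K \<sigma>)"
  let ?t = "transp (exit1 K \<tau>) (exit2 K \<tau>)"
  have ex: "\<forall>i<4. q i \<in> exits K"
    using exits_mono[OF \<sigma>(3,1)] exits_mono[OF \<tau>(3,1)] unfolding all_less_4 by (simp add: q_simps)
  have swaps: "swap01 = transp 0 1" "swap23 = transp 2 3"
    by (auto simp: swap01_def swap23_def Transposition.transpose_def)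
  have perms: "swap01 permutes {..<4}" "swap23 permutes {..<4}" "?s permutes q ` {..<4}" "?t permutes q ` {..<4}"
    unfolding swaps by (intro permutes_swap_id; auto simp: lt4 q_simps)+
  have s: "\<forall>i<4. ?s (q i) = q (swap01 i)" and t: "\<forall>i<4. ?t (q i) = q (swap23 i)"
    unfolding all_less_4 using neqs
    by (simp_all add: q_simps swap01_def swap23_def Transposition.transpose_def)
  have "swap23 i < 4" if "i < 4" for i
    using that by (simp add: swap23_def)
  then have st: "\<forall>i<4. (?s \<circ> ?t) (q i) = q ((swap01 \<circ> swap23) i)"
    using s t by simp
  note K_s = coherent_insert[OF K \<sigma>(3)] and K_t = coherent_insert[OF K \<tau>(3)]
  note K_st = coherent_insert[OF K_t \<sigma>(3)]
  have f: "flow K (insert \<sigma> S) = ?s \<circ> flow K S" "flow K (insert \<tau> S) = ?t \<circ> flow K S"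
    "flow K (insert \<sigma> (insert \<tau> S)) = ?s \<circ> ?t \<circ> flow K S"
    using flow_insert[OF K \<sigma>(3,1,2)] flow_insert[OF K \<tau>(3,1,2)] flow_insert[OF K_t \<sigma>(3,1)] neq \<sigma>(2)
    by (auto simp: comp_assoc)
  have st': "insert \<sigma> S \<in> states G" "insert \<tau> S \<in> states G" "insert \<sigma> (insert \<tau> S) \<in> states G"
    using S \<sigma> \<tau> by (simp_all add: insert_states)
  note tr = tracks_state[OF \<rho>(2,1) ex]
  have tracks: "tracks q \<rho> (ord S) (\<lambda>i. cyc S (q i))"
    "tracks q (swap01 \<circ> \<rho>) (ord (insert \<sigma> S)) (\<lambda>i. cyc (insert \<sigma> S) (q i))"
    "tracks q (swap23 \<circ> \<rho>) (ord (insert \<tau> S)) (\<lambda>i. cyc (insert \<tau> S) (q i))"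
    "tracks q (swap01 \<circ> swap23 \<circ> \<rho>) (ord (insert \<sigma> (insert \<tau> S)))
      (\<lambda>i. cyc (insert \<sigma> (insert \<tau> S)) (q i))"
    using tr[OF permutes_id permutes_id _ S K] tr[OF perms(1,3) s st'(1) K_s f(1)]
      tr[OF perms(2,4) t st'(2) K_t f(2)]
      tr[OF permutes_compose[OF perms(2,1)] permutes_compose[OF perms(4,3)] st st'(3) K_st f(3)]
    by (simp_all add: comp_def)
  have comm: "insert \<tau> (insert \<sigma> S) = insert \<sigma> (insert \<tau> S)"
    by (rule insert_commute)
  show ?thesis
    using edge_coeff_square_anticommute[OF \<rho>(1) tracks] resmooths_exits S st' \<sigma>(1) \<tau>(1)
      resmooths_exits[OF st'(1) \<tau>(1), of K]
    unfolding edge_def q_simps comm by simp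
qed

end

section \<open>Partial differentials of coloured states\<close>

lemma length_pair: "length (pair x y) = 1 \<longleftrightarrow> x = y" "length (pair x y) = Suc 0 \<longleftrightarrow> x = y"
  "length (pair x y) = 2 \<longleftrightarrow> x \<noteq> y"
  by (auto simp: pair_def)

text \<open>The exchange at the front reverses a single comparison. It is needed for green
  splittings, where the exits are numbered against the local order.\<close>

lemma ord_sign_swap:
  assumes "distinct (x # y # R)" "distinct M" "set M = set (x # y # R)"
  shows "ord_sign (y # x # R) M = - ord_sign (x # y # R) M"
proof -
  obtain lab :: "'a \<Rightarrow> nat" where lab: "inj_on lab (set M)"
    using finite_imp_inj_to_nat_seg[of "set M"] by auto
  have "distinct (map lab (x # y # R))"
    using assms lab by (simp only: distinct_map)
  then have "inv_sign (map lab (y # x # R)) = - inv_sign (map lab (x # y # R))"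
    using inv_sign_swap[of "[]" "lab x" "[]" "lab y" "map lab R"] by simp
  moreover have "ord_sign (x # y # R) M = inv_sign (map lab (x # y # R)) * inv_sign (map lab M)"
    using assms lab by (intro ord_sign_eq) auto
  moreover have "ord_sign (y # x # R) M = inv_sign (map lab (y # x # R)) * inv_sign (map lab M)"
    using assms lab by (intro ord_sign_eq) (auto simp: insert_commute)
  ultimately show ?thesis
    by simp
qed

context khovanov_data
begin

lemma partial_diff_unfold:
  fixes S \<tau>
  defines "A \<equiv> cyc S (point1 G S \<tau>)" and "B \<equiv> cyc S (point2 G S \<tau>)"
    and "A' \<equiv> cyc (insert \<tau> S) (point1 G (insert \<tau> S) \<tau>)"
    and "B' \<equiv> cyc (insert \<tau> S) (point2 G (insert \<tau> S) \<tau>)"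
  defines "R \<equiv> filter (\<lambda>C. C \<notin> {A, B}) (ord S)"
  shows "partial_diff G ord mark S \<tau> v =
    (if A = B \<and> A' = B' then 0
     else reorder (pair A' B' @ R) (ord (insert \<tau> S))
       (factorwise (map (\<lambda>n. bar ^^ n)
          (map (\<lambda>C. cuts_met G (insert \<tau> S) (point_at G (insert \<tau> S) \<tau> C) (mark (insert \<tau> S) C)) (pair A' B') @
           map (\<lambda>C. cuts_met G S (mark S C) (mark (insert \<tau> S) C)) R))
       ((if A \<noteq> B then merge else split_off)
       (factorwise (map (\<lambda>n. bar ^^ n)
          (map (\<lambda>C. cuts_met G S (mark S C) (point_at G S \<tau> C)) (pair A B) @ map (\<lambda>C. 0) R))
       (reorder (ord S) (pair A B @ R) v)))))"
proof -
  have "local_cycles G S \<tau> = pair A B" "local_cycles G (insert \<tau> S) \<tau> = pair A' B'"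
    by (simp_all add: local_cycles_def pair_def A_def B_def A'_def B'_def Let_def)
  then show ?thesis
    by (simp add: partial_diff_def Let_def length_pair R_def)
qed

lemma vlinear_partial_diff: "vlinear (partial_diff G ord mark S \<tau>)"
proof -
  have "vlinear (\<lambda>v :: word vec. 0 :: word vec)"
    by (rule vlinearI) auto
  then show ?thesis
    by (auto simp: partial_diff_def Let_def
        intro!: vlinear_o vlinear_reorder vlinear_factorwise vlinear_merge vlinear_split_off)
qed

context
  fixes S \<tau> S' A B A' B' R
  assumes S: "S \<in> states G" and \<tau>: "\<tau> \<in> crossings G" "\<tau> \<notin> S" and S': "S' = insert \<tau> S"
    and A: "A = cyc S (point1 G S \<tau>)" and B: "B = cyc S (point2 G S \<tau>)"
    and A': "A' = cyc S' (point1 G S' \<tau>)" and B': "B' = cyc S' (point2 G S' \<tau>)"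
    and R: "R = filter (\<lambda>C. C \<notin> {A, B}) (ord S)"
begin

lemma resmooths_local: "resmooths (ord S) (ord S') A B A' B'"
  unfolding A B A' B' S' point1_def point2_def
  by (intro resmooths_points S \<tau>(1)) (use End_in_local_cycle[OF \<tau>(1)] in \<open>simp add: point1_def point2_def\<close>)+

lemma S'_states: "S' \<in> states G"
  unfolding S' using S \<tau>(1) by (rule insert_states)

lemma set_R: "set R = cycles G S - {A, B}"
  by (auto simp: R set_ord[OF S])

lemma AB_cycles: "A \<in> cycles G S" "B \<in> cycles G S" "A' \<in> cycles G S'" "B' \<in> cycles G S'"
  using \<tau>(1) unfolding A B A' B' point1_def point2_def
  by (auto intro!: cycle_of_in_cycles ends_points)

lemma R_cycles: "C \<in> set R \<Longrightarrow> C \<in> cycles G S \<and> C \<in> cycles G S'"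
  using resmooths_local set_R by (auto simp: resmooths_def set_ord[OF S] set_ord[OF S'_states])

lemma lists_distinct: "distinct (pair A B @ R)" "distinct (pair A' B' @ R)"
  using resmooths_local set_R distinct_ord[OF S] by (auto simp: resmooths_def R)

lemma lists_set: "set (pair A B @ R) = set (ord S)" "set (pair A' B' @ R) = set (ord S')"
  using resmooths_local set_R AB_cycles by (auto simp: resmooths_def set_ord[OF S])

lemma point_at_in: "C \<in> {A, B} \<Longrightarrow> point_at G S \<tau> C \<in> C" "C \<in> {A', B'} \<Longrightarrow> point_at G S' \<tau> C \<in> C"
  unfolding A B A' B' by (auto simp: point_at_def)

lemma point_at_A: "point_at G S \<tau> A = point1 G S \<tau>" "A \<noteq> B \<Longrightarrow> point_at G S \<tau> B = point2 G S \<tau>"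
  using cycles_unique[OF AB_cycles(2)] by (auto simp: point_at_def A) 

lemma point_at_End: "\<exists>k. point_at G T \<tau> C = End \<tau> k"
  by (auto simp: point_at_def point1_def point2_def)

lemma colour_travel:
  assumes "coherent T K" "C \<in> cycles G T" "p \<in> C" "q \<in> C"
  shows "K q = (K p = even (cuts_met G T p q))"
proof -
  have "q \<in> cyc T p"
    using cycles_unique[OF assms(2,3)] assms(4) by simp
  then show ?thesis
    by (rule coherent_cuts_met[OF assms(1)])
qed

text \<open>The bars carry the idempotent from the marked point to the crossing: each cut locus on
  the way changes the colour and each bar exchanges \<open>r\<close> and \<open>g\<close>.
  Afterwards the factors show the colours at the crossing.\<close>

lemma first_half:
  assumes K: "coherent S K"
  shows "factorwise (map (\<lambda>n. bar ^^ n)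
      (map (\<lambda>C. cuts_met G S (mark S C) (point_at G S \<tau> C)) (pair A B) @ map (\<lambda>C. 0) R))
      (reorder (ord S) (pair A B @ R) (coloured S K)) =
    vscale (of_int (ord_sign (ord S) (pair A B @ R)))
      (tensor (map (\<lambda>C. cidem (K (point_at G S \<tau> C))) (pair A B) @ map (\<lambda>C. cidem (K (mark S C))) R))"
proof -
  have "reorder (ord S) (pair A B @ R) (coloured S K) =
      vscale (of_int (ord_sign (ord S) (pair A B @ R))) (tensor (map (\<lambda>C. cidem (K (mark S C))) (pair A B @ R)))"
    unfolding coloured_def
    by (rule reorder_tensor) (use lists_distinct lists_set distinct_ord[OF S] in auto)
  moreover have "factorwise (map (\<lambda>n. bar ^^ n)
      (map (\<lambda>C. cuts_met G S (mark S C) (point_at G S \<tau> C)) (pair A B) @ map (\<lambda>C. 0) R))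
      (tensor (map (\<lambda>C. cidem (K (mark S C))) (pair A B) @ map (\<lambda>C. cidem (K (mark S C))) R)) =
    tensor (map (\<lambda>C. cidem (K (point_at G S \<tau> C))) (pair A B) @ map (\<lambda>C. cidem (K (mark S C))) R)"
  proof (rule factorwise_bars)
    fix C assume "C \<in> set (pair A B)"
    then have C: "C \<in> {A, B}" "C \<in> cycles G S"
      using AB_cycles by auto
    show "K (point_at G S \<tau> C) = (K (mark S C) = even (cuts_met G S (mark S C) (point_at G S \<tau> C)))"
      by (rule colour_travel[OF K C(2) mark_in[OF S C(2)] point_at_in(1)[OF C(1)]])
  qed simp
  ultimately show ?thesis
    by (simp add: vlin.linear_scale[OF vlinear_factorwise])
qed

text \<open>The bars now carry the colours to the marked points of the new state. An unaffected
  cycle is a cycle of both states and can be travelled in the old one.\<close>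

lemma second_half:
  assumes K: "coherent S K" and K': "coherent S' K"
  shows "reorder (pair A' B' @ R) (ord S') (factorwise (map (\<lambda>n. bar ^^ n)
      (map (\<lambda>C. cuts_met G S' (point_at G S' \<tau> C) (mark S' C)) (pair A' B') @
       map (\<lambda>C. cuts_met G S (mark S C) (mark S' C)) R))
      (tensor (map (\<lambda>C. cidem (K (point_at G S' \<tau> C))) (pair A' B') @ map (\<lambda>C. cidem (K (mark S C))) R))) =
    vscale (of_int (ord_sign (pair A' B' @ R) (ord S'))) (coloured S' K)"
proof -
  have "factorwise (map (\<lambda>n. bar ^^ n)
      (map (\<lambda>C. cuts_met G S' (point_at G S' \<tau> C) (mark S' C)) (pair A' B') @
       map (\<lambda>C. cuts_met G S (mark S C) (mark S' C)) R))
      (tensor (map (\<lambda>C. cidem (K (point_at G S' \<tau> C))) (pair A' B') @ map (\<lambda>C. cidem (K (mark S C))) R)) =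
    tensor (map (\<lambda>C. cidem (K (mark S' C))) (pair A' B') @ map (\<lambda>C. cidem (K (mark S' C))) R)"
  proof (rule factorwise_bars)
    fix C assume "C \<in> set (pair A' B')"
    then have C: "C \<in> {A', B'}" "C \<in> cycles G S'"
      using AB_cycles by auto
    show "K (mark S' C) = (K (point_at G S' \<tau> C) = even (cuts_met G S' (point_at G S' \<tau> C) (mark S' C)))"
      by (rule colour_travel[OF K' C(2) point_at_in(2)[OF C(1)] mark_in[OF S'_states C(2)]])
  next
    fix C assume "C \<in> set R"
    then have C: "C \<in> cycles G S" "C \<in> cycles G S'"
      using R_cycles by auto
    show "K (mark S' C) = (K (mark S C) = even (cuts_met G S (mark S C) (mark S' C)))"
      by (rule colour_travel[OF K C(1) mark_in[OF S C(1)] mark_in[OF S'_states C(2)]])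
  qed
  also have "\<dots> = tensor (map (\<lambda>C. cidem (K (mark S' C))) (pair A' B' @ R))"
    by simp
  finally show ?thesis
    unfolding coloured_def
    by (simp only:) (rule reorder_tensor; use lists_distinct lists_set distinct_ord[OF S'_states] in simp)
qed

lemma partial_diff_mono_local:
  assumes K: "coherent S K" and mono: "mono_at K \<tau>"
  shows "partial_diff G ord mark S \<tau> (coloured S K) = vscale (of_int (edge S K \<tau>)) (coloured S' K)"
proof -
  let ?b = "K (End \<tau> SW)" and ?xs = "map (\<lambda>C. cidem (K (mark S C))) R"
  let ?e1 = "exit1 K \<tau>" and ?e2 = "exit2 K \<tau>"
  have K': "coherent S' K"
    unfolding S' by (rule coherent_insert[OF K mono])
  have pt: "K (point_at G T \<tau> C) = ?b" for T C
    using point_at_End[of T C] mono_at_eq[OF mono] by metis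
  note loc = local_cycles_exits[OF \<tau>, of K, folded S']
  have AB: "A = cyc S ?e1" "B = cyc S ?e2"
    "A' = cyc S' (if ?b then ?e1 else ?e2)" "B' = cyc S' (if ?b then ?e2 else ?e1)"
    unfolding A B A' B' by (rule loc)+
  have dich: "A' = B' \<longleftrightarrow> A \<noteq> B"
    using exits_same_cycle_insert[OF K mono \<tau>, folded S'] by (auto simp: AB)
  have edge: "edge S K \<tau> = (if A = B then 2 else 1) * ord_sign (ord S) (pair A B @ R) *
      ord_sign (pair (if ?b then A' else B') (if ?b then B' else A') @ R) (ord S')"
    unfolding edge_def edge_coeff_def Let_def S'[symmetric] AB(1,2)[symmetric] R[symmetric] by (simp add: AB(3,4))
  \<comment> \<open>By \<open>dich\<close> exactly one of the two lists of local cycles has two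
    entries. A merge multiplies equal idempotents; a splitting doubles one, up to the sign belonging
    to its colour.\<close>
  have mid: "(if A \<noteq> B then merge else split_off)
      (tensor (map (\<lambda>C. cidem (K (point_at G S \<tau> C))) (pair A B) @ ?xs)) =
    vscale (if A \<noteq> B then 1 else if ?b then 2 else - 2)
      (tensor (map (\<lambda>C. cidem (K (point_at G S' \<tau> C))) (pair A' B') @ ?xs))"
    using dich by (auto simp: pair_def pt merge_tcons V_mult_cidem split_off_tcons simp del: colour_idem.simps)
  let ?F = "if A \<noteq> B then merge else split_off"
  have F: "vlinear ?F"
    by (simp add: vlinear_merge vlinear_split_off)
  have not_single: "\<not> (A = B \<and> A' = B')"
    using dich by blast
  have "partial_diff G ord mark S \<tau> (coloured S K) =
      vscale (of_int (ord_sign (ord S) (pair A B @ R)) * ((if A \<noteq> B then 1 else if ?b then 2 else - 2) *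
        of_int (ord_sign (pair A' B' @ R) (ord S')))) (coloured S' K)"
    unfolding partial_diff_unfold A[symmetric] B[symmetric] S'[symmetric] A'[symmetric] B'[symmetric] R[symmetric]
      first_half[OF K] if_not_P[OF not_single] vlin.linear_scale[OF F] mid
      vlin.linear_scale[OF vlinear_factorwise] vlin.linear_scale[OF vlinear_reorder]
      second_half[OF K K'] vec.scale_scale
    by (simp only: mult.assoc)
  also have "\<dots> = vscale (of_int (edge S K \<tau>)) (coloured S' K)"
  proof (cases "?b \<or> A' = B'")
    case True
    then have "ord_sign (pair (if ?b then A' else B') (if ?b then B' else A') @ R) (ord S') = ord_sign (pair A' B' @ R) (ord S')"
      by (auto simp: pair_def)
    then show ?thesis
      using True dich unfolding edge by (auto simp: mult_ac)
  next
    \<comment> \<open>A green cycle splits: the sign in \<open>- 2\<close> makes up for the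
      exchanged order of the two new cycles.\<close>
    case False
    then have "ord_sign (B' # A' # R) (ord S') = - ord_sign (A' # B' # R) (ord S')"
      using lists_distinct(2) lists_set(2) distinct_ord[OF S'_states]
      by (intro ord_sign_swap) (auto simp: pair_def)
    then show ?thesis
      using False dich unfolding edge by (auto simp: pair_def mult_ac)
  qed
  finally show ?thesis .
qed

text \<open>If two cycles merge, the product of \<open>r\<close> and \<open>g\<close> vanishes. If
  both strands lie on one cycle, it cannot split, because the different colours mean that an odd
  number of cut loci separates the strands; so the map is 0 by definition.\<close>

lemma partial_diff_not_mono_local:
  assumes K: "coherent S K" and mono: "\<not> mono_at K \<tau>"
  shows "partial_diff G ord mark S \<tau> (coloured S K) = 0"
proof -
  let ?xs = "map (\<lambda>C. cidem (K (mark S C))) R"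
  let ?p1 = "point1 G S \<tau>" and ?p2 = "point2 G S \<tau>"
  have neq: "K ?p1 \<noteq> K ?p2"
    using mono mono_at_iff[OF K \<tau>(1)] by simp
  show ?thesis
  proof (cases "A = B")
    case False
    have "merge (tensor (map (\<lambda>C. cidem (K (point_at G S \<tau> C))) (pair A B) @ ?xs)) = 0"
      using False neq
      by (simp add: pair_def point_at_A merge_tcons V_mult_cidem vlin.linear_0[OF vlinear_tcons_left]
          del: colour_idem.simps)
    then show ?thesis
      using False
      unfolding partial_diff_unfold A[symmetric] B[symmetric] S'[symmetric] A'[symmetric] B'[symmetric] R[symmetric]
        first_half[OF K]
      by (simp add: vlin.linear_scale[OF vlinear_merge] vlin.linear_0[OF vlinear_factorwise]
          vlin.linear_0[OF vlinear_reorder])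
  next
    case True
    have "A' = B'"
    proof (rule ccontr)
      assume "A' \<noteq> B'"
      let ?q1 = "point1 G S' \<tau>" and ?q2 = "point2 G S' \<tau>"
      \<comment> \<open>Two new cycles could be coloured independently, and both are made red at the
        crossing. This colouring is coherent in \<open>S\<close> too, where it gives the two strands
        equal colours, contrary to the parity seen by \<open>K\<close>.\<close>
      obtain \<mu> where \<mu>: "coherent S' \<mu>"
        "\<And>C. C \<in> cycles G S' \<Longrightarrow> \<mu> (if C = A' then ?q1 else if C = B' then ?q2 else mark S' C) = True"
        using coherent_prescribed[of S' "\<lambda>C. if C = A' then ?q1 else if C = B' then ?q2 else mark S' C" "\<lambda>C. True"]
          mark_in[OF S'_states] A' B' cycle_of_self by (smt (verit))
      have "\<mu> ?q1 = \<mu> ?q2"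
        using \<mu>(2)[OF AB_cycles(3)] \<mu>(2)[OF AB_cycles(4)] \<open>A' \<noteq> B'\<close> by simp
      then have m: "mono_at \<mu> \<tau>"
        using mono_at_iff[OF \<mu>(1) \<tau>(1)] by simp
      have \<mu>S: "coherent S \<mu>"
        using coherent_agree_off[OF \<mu>(1) m] agree_off_insert(2)[of \<tau> S] by (simp add: S')
      have "?p1 \<in> A"
        unfolding A by (rule cycle_of_self)
      moreover have "?p2 \<in> A"
        unfolding True B by (rule cycle_of_self)
      ultimately have "K ?p2 = (K ?p1 = even (cuts_met G S ?p1 ?p2))"
        "\<mu> ?p2 = (\<mu> ?p1 = even (cuts_met G S ?p1 ?p2))"
        using colour_travel[OF K AB_cycles(1)] colour_travel[OF \<mu>S AB_cycles(1)] by blast+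
      moreover have "\<mu> ?p1 = \<mu> ?p2"
        using m mono_at_iff[OF \<mu>S \<tau>(1)] by simp
      ultimately show False
        using neq by blast
    qed
    then show ?thesis
      using True unfolding partial_diff_unfold A[symmetric] B[symmetric] S'[symmetric] A'[symmetric] B'[symmetric]
      by simp
  qed
qed

end

lemma partial_diff_mono:
  assumes "S \<in> states G" "\<tau> \<in> crossings G" "\<tau> \<notin> S" "coherent S K" "mono_at K \<tau>"
  shows "partial_diff G ord mark S \<tau> (coloured S K) = vscale (of_int (edge S K \<tau>)) (coloured (insert \<tau> S) K)"
  by (rule partial_diff_mono_local[OF assms(1-3) refl refl refl refl refl refl assms(4,5)])

lemma partial_diff_not_mono:
  assumes "S \<in> states G" "\<tau> \<in> crossings G" "\<tau> \<notin> S" "coherent S K" "\<not> mono_at K \<tau>"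
  shows "partial_diff G ord mark S \<tau> (coloured S K) = 0"
  by (rule partial_diff_not_mono_local[OF assms(1-3) refl refl refl refl refl refl assms(4,5)])

end

subsection \<open>Direct sums\<close>

lemma vlinear_zero: "vlinear (\<lambda>v. 0)"
  by (rule vlinearI) auto

lemma lookup_inject: "coef (inject s v) (s', b) = (if s' = s then coef v b else 0)"
proof -
  have "coef (inject s v) (s', b) =
      (\<Sum>a\<in>Poly_Mapping.keys v. if a = b then (if s' = s then coef v a else 0) else 0)"
    unfolding inject_def lookup_lin_ext lookup_single by (intro sum.cong) (auto simp: when_def)
  then show ?thesis
    by (auto simp: in_keys_iff)
qed

lemma keys_inject: "Poly_Mapping.keys (inject s v) \<subseteq> {s} \<times> UNIV"
  by (auto simp: in_keys_iff lookup_inject split: if_splits)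

lemma component_inject: "component s (inject s' v) = (if s = s' then v else 0)"
proof (cases "s = s'")
  case True
  have "component s (inject s v) = v"
    by (rule vlinear_eqI[OF vlinear_compose[OF vlinear_inject vlinear_component] vlinear_id(1)])
      (simp add: inject_def component_def)
  then show ?thesis
    using True by simp
next
  case False
  have "component s (inject s' v) = 0"
    by (rule vlinear_eqI[OF vlinear_compose[OF vlinear_inject vlinear_component] vlinear_zero])
      (use False in \<open>simp add: inject_def component_def\<close>)
  then show ?thesis
    using False by simp
qed

lemma lookup_component: "coef (component s v) b = coef v (s, b)"
proof -
  have "coef (component s v) b =
      (\<Sum>a\<in>Poly_Mapping.keys v. if a = (s, b) then coef v a else 0)"
    unfolding component_def lookup_lin_ext
    by (intro sum.cong) (auto simp: lookup_single when_def split: prod.split)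
  then show ?thesis
    by (auto simp: in_keys_iff)
qed

lemma sum_inject_component:
  assumes "finite I" "Poly_Mapping.keys v \<subseteq> I \<times> UNIV"
  shows "(\<Sum>s\<in>I. inject s (component s v)) = v"
proof (rule poly_mapping_eqI, clarify)
  fix s b
  have "coef v (s, b) = 0" if "s \<notin> I"
    using that assms(2) by (auto simp: in_keys_iff)
  then show "coef (\<Sum>s\<in>I. inject s (component s v)) (s, b) = coef v (s, b)"
    using assms(1) by (auto simp: lookup_sum lookup_inject lookup_component)
qed

lemma component_sum_inject:
  assumes "finite I"
  shows "component s (\<Sum>t\<in>I. inject t (x t)) = (if s \<in> I then x s else 0)"
  using assms by (simp add: vlin.linear_sum[OF vlinear_component] component_inject)

lemma vlinear_into_span:
  assumes "vlinear f" "\<And>x. x \<in> B \<Longrightarrow> f x \<in> W" "vec.subspace W" "u \<in> vec.span B"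
  shows "f u \<in> W"
  using assms(4)
proof (induction rule: vec.span_induct_alt)
  case base
  then show ?case
    using assms(1,3) by (simp add: vlin.linear_0 vec.subspace_0)
next
  case (step c x y)
  then show ?case
    using assms by (simp add: vlin.linear_add vlin.linear_scale vec.subspace_add vec.subspace_scale)
qed

lemma linear_betweenI: "vlinear f \<Longrightarrow> (\<And>u. u \<in> U \<Longrightarrow> f u \<in> W) \<Longrightarrow> linear_between U W f"
  by (auto simp: linear_between_def vlin.linear_add vlin.linear_scale)

lemma subspace_keys: "vec.subspace {v. Poly_Mapping.keys v \<subseteq> X}"
  unfolding vec.subspace_def
  by (auto simp: in_keys_iff subset_iff lookup_add lookup_vscale) (metis add_0)

lemma subspace_kar_sum:
  assumes "\<And>s. s \<in> I \<Longrightarrow> vec.subspace (fst (A s))"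
  shows "vec.subspace (fst (kar_sum I A))"
proof -
  have 1: "vec.subspace {v. component s v \<in> fst (A s)}" if "s \<in> I" for s
    using vlin.linear_subspace_vimage[OF vlinear_component assms[OF that], of s] by (simp add: vimage_def)
  have "fst (kar_sum I A) = {v. Poly_Mapping.keys v \<subseteq> I \<times> UNIV} \<inter> (\<Inter>s\<in>I. {v. component s v \<in> fst (A s)})"
    by (auto simp: kar_sum_def)
  also have "vec.subspace \<dots>"
    using 1 by (intro vec.subspace_inter subspace_keys vec.subspace_Inter) auto
  finally show ?thesis .
qed

text \<open>The other components are 0, and subspaces contain 0.\<close>

lemma inject_in_kar_sum:
  assumes "s \<in> I" "v \<in> fst (A s)" "\<And>s. s \<in> I \<Longrightarrow> vec.subspace (fst (A s))"
  shows "inject s v \<in> fst (kar_sum I A)"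
  using assms keys_inject[of s v] by (auto simp: kar_sum_def component_inject vec.subspace_0)

lemma vlinear_kar_sum:
  assumes "\<And>s. s \<in> I \<Longrightarrow> vlinear (snd (A s))"
  shows "vlinear (snd (kar_sum I A))"
  unfolding kar_sum_def snd_conv
  by (intro vlinear_sum vlinear_compose[OF _ vlinear_inject] vlinear_compose[OF vlinear_component] assms)

text \<open>The idempotent acts on each component separately, as injecting into one summand and
  projecting to another gives 0.\<close>

lemma kar_obj_kar_sum:
  assumes "finite I" "\<And>s. s \<in> I \<Longrightarrow> kar_obj (A s)" "\<And>s. s \<in> I \<Longrightarrow> vlinear (snd (A s))"
  shows "kar_obj (kar_sum I A)"
  unfolding kar_obj_def
proof (intro conjI ballI)
  have sub: "vec.subspace (fst (A s))" if "s \<in> I" for s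
    using assms(2)[OF that] by (simp add: kar_obj_def)
  show sub_sum: "vec.subspace (fst (kar_sum I A))"
    using sub by (rule subspace_kar_sum)
  have into: "snd (A s) (component s v) \<in> fst (A s)" if "s \<in> I" "v \<in> fst (kar_sum I A)" for s v
    using assms(2)[OF that(1)] that by (auto simp: kar_obj_def linear_between_def kar_sum_def)
  show "linear_between (fst (kar_sum I A)) (fst (kar_sum I A)) (snd (kar_sum I A))"
  proof (rule linear_betweenI[OF vlinear_kar_sum[OF assms(3)]])
    fix u assume u: "u \<in> fst (kar_sum I A)"
    have "snd (kar_sum I A) u = (\<Sum>s\<in>I. inject s (snd (A s) (component s u)))"
      by (simp add: kar_sum_def)
    also have "\<dots> \<in> fst (kar_sum I A)"
      by (intro vec.subspace_sum[OF sub_sum] inject_in_kar_sum into sub u)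
    finally show "snd (kar_sum I A) u \<in> fst (kar_sum I A)" .
  qed
  fix u assume u: "u \<in> fst (kar_sum I A)"
  have "snd (A s) (snd (A s) (component s u)) = snd (A s) (component s u)" if "s \<in> I" for s
    using assms(2)[OF that] that u by (auto simp: kar_obj_def kar_sum_def)
  then show "snd (kar_sum I A) (snd (kar_sum I A) u) = snd (kar_sum I A) u"
    using assms(1) by (simp add: kar_sum_def component_sum_inject)
qed

lemma kar_sum_id:
  assumes "finite I" "v \<in> fst (kar_sum I (\<lambda>s. (X s, id)))"
  shows "snd (kar_sum I (\<lambda>s. (X s, id))) v = v"
  using assms sum_inject_component[of I v] by (simp add: kar_sum_def)

text \<open>Exchanging the summations shows that the sum equals its own negative, and 2 is
  invertible.\<close>

lemma sum_antisymmetric_zero: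
  fixes g :: "'i \<Rightarrow> 'i \<Rightarrow> 'b vec"
  assumes "\<And>i j. i \<in> N \<Longrightarrow> j \<in> N \<Longrightarrow> g j i = - g i j"
  shows "(\<Sum>i\<in>N. \<Sum>j\<in>N. g i j) = 0"
proof -
  let ?x = "\<Sum>i\<in>N. \<Sum>j\<in>N. g i j"
  have "?x = (\<Sum>j\<in>N. \<Sum>i\<in>N. g i j)"
    by (rule sum.swap)
  also have "\<dots> = - ?x"
    unfolding sum_negf[symmetric] by (intro sum.cong refl assms)
  finally have "?x = - ?x" .
  then have "coef ?x b = - coef ?x b" for b
    by (metis lookup_uminus)
  then show ?thesis
    by (intro poly_mapping_eqI) (simp add: eq_neg_iff_add_eq_0 mult_2[symmetric])
qed

subsection \<open>The basis of coloured states\<close>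

text \<open>\<open>1 = r + g\<close> and \<open>X = r - g\<close>, applied letter by letter.\<close>

lemma basis_vec_in_span_cidem:
  "basis_vec w \<in> vec.span {tensor (map (\<lambda>b. cidem b) bs) | bs. length bs = length w}"
proof (induction w)
  case Nil
  have "basis_vec [] = tensor (map (\<lambda>b. cidem b) [])"
    by simp
  then show ?case
    by (intro vec.span_base) force
next
  case (Cons a w)
  let ?T = "\<lambda>n. {tensor (map (\<lambda>b. cidem b) bs) | bs. length bs = n}"
  have *: "tcons (cidem b) (basis_vec w) \<in> vec.span (?T (length (a # w)))" for b
  proof (rule vlinear_into_span[OF vlinear_tcons _ _ Cons.IH])
    fix x assume "x \<in> ?T (length w)"
    then obtain bs where "x = tensor (map (\<lambda>b. cidem b) bs)" "length bs = length w"
      by blast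
    then have "tcons (cidem b) x = tensor (map (\<lambda>b. cidem b) (b # bs)) \<and> length (b # bs) = length (a # w)"
      by simp
    then show "tcons (cidem b) x \<in> vec.span (?T (length (a # w)))"
      by (intro vec.span_base) blast
  qed (rule vec.subspace_span)
  have "basis_vec V1 = cidem True + cidem False" "basis_vec VX = cidem True - cidem False"
    by (auto intro!: vec_gen_eqI simp: lookup_vscale lookup_add lookup_minus lookup_single)
  then have "basis_vec (V1 # w) = tcons (cidem True) (basis_vec w) + tcons (cidem False) (basis_vec w)"
    "basis_vec (VX # w) = tcons (cidem True) (basis_vec w) - tcons (cidem False) (basis_vec w)"
    by (metis tcons_basis_vec vlin.linear_add[OF vlinear_tcons_left])
      (metis tcons_basis_vec vlin.linear_diff[OF vlinear_tcons_left] \<open>basis_vec VX = cidem True - cidem False\<close>)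
  then show ?case
    using *[of True] *[of False] by (cases a) (auto intro: vec.span_add vec.span_diff simp del: colour_idem.simps)
qed

text \<open>Different idempotents are orthogonal, so a single mismatch makes a factor, and with it
  the tensor, vanish.\<close>

lemma factorwise_V_mult_tensor:
  "factorwise (map (\<lambda>C. V_mult (cidem (h C))) L) (tensor (map (\<lambda>C. cidem (h' C)) L)) =
    (if \<forall>C\<in>set L. h C = h' C then tensor (map (\<lambda>C. cidem (h C)) L) else 0)"
proof -
  have "factorwise (map (\<lambda>C. V_mult (cidem (h C))) L) (tensor (map (\<lambda>C. cidem (h' C)) L)) =
      tensor (map2 (\<lambda>f x. f x) (map (\<lambda>C. V_mult (cidem (h C))) L) (map (\<lambda>C. cidem (h' C)) L))"
    by (rule factorwise_tensor) (auto simp: vlinear_V_mult)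
  also have "map2 (\<lambda>f x. f x) (map (\<lambda>C. V_mult (cidem (h C))) L) (map (\<lambda>C. cidem (h' C)) L) =
      map (\<lambda>C. if h C = h' C then cidem (h C) else 0) L"
    by (simp add: map2_map_map V_mult_cidem del: colour_idem.simps)
  also have "tensor \<dots> = (if \<forall>C\<in>set L. h C = h' C then tensor (map (\<lambda>C. cidem (h C)) L) else 0)"
  proof (cases "\<forall>C\<in>set L. h C = h' C")
    case True
    then show ?thesis
      by (simp del: colour_idem.simps cong: map_cong)
  next
    case False
    then have "0 \<in> set (map (\<lambda>C. if h C = h' C then cidem (h C) else 0) L)"
      by force
    then show ?thesis
      unfolding if_not_P[OF False] by (rule tensor_zero)
  qed
  finally show ?thesis .
qed

lemma lookup_tensor_cidem:
  "coef (tensor (map (\<lambda>C. cidem (h C)) L)) (replicate (length L) V1) = (1 / 2) ^ length L"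
proof -
  have *: "coef (cidem b) V1 = 1 / 2" for b
    by (simp add: lookup_vscale lookup_add lookup_minus lookup_single)
  show ?thesis
    by (simp add: lookup_tensor * del: colour_idem.simps)
qed

context khovanov_data
begin

definition proj :: "'c state \<Rightarrow> ('c point \<Rightarrow> bool) \<Rightarrow> word vec \<Rightarrow> word vec" where
  "proj S K = factorwise (map (\<lambda>C. V_mult (cidem (K (mark S C)))) (ord S))"

text \<open>Both idempotents have coefficient \<open>1/2\<close> at \<open>1\<close>. So a coloured
  vector has coefficient \<open>(1/2) ^ n\<close> at the word consisting of \<open>V1\<close> only,
  and the power of 2 normalises this to 1.\<close>

definition coord :: "'c state \<Rightarrow> ('c point \<Rightarrow> bool) \<Rightarrow> word vec \<Rightarrow> rat" where
  "coord S K v = 2 ^ length (ord S) * coef (proj S K v) (replicate (length (ord S)) V1)"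

text \<open>Fixing the values outside the diagram makes colourings with equal values on it equal and
  their number finite, so that they can index a basis.\<close>

definition colourings :: "'c state \<Rightarrow> ('c point \<Rightarrow> bool) set" where
  "colourings S = {K \<in> points G \<rightarrow>\<^sub>E UNIV. coherent S K}"

lemma finite_colourings: "finite (colourings S)"
  by (rule finite_subset[of _ "points G \<rightarrow>\<^sub>E UNIV"])
    (auto simp: colourings_def intro: finite_PiE finite_points)

lemma vlinear_proj: "vlinear (proj S K)"
  unfolding proj_def by (rule vlinear_factorwise)

lemma mark_points: "S \<in> states G \<Longrightarrow> C \<in> cycles G S \<Longrightarrow> mark S C \<in> points G"
  using mark_in cycles_points by blast

lemma colourings_eq_iff:
  assumes S: "S \<in> states G" and K: "K \<in> colourings S" "K' \<in> colourings S"
  shows "(\<forall>C\<in>cycles G S. K (mark S C) = K' (mark S C)) \<longleftrightarrow> K = K'"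
proof
  assume *: "\<forall>C\<in>cycles G S. K (mark S C) = K' (mark S C)"
  show "K = K'"
  proof (rule PiE_ext)
    show "K \<in> points G \<rightarrow>\<^sub>E UNIV" "K' \<in> points G \<rightarrow>\<^sub>E UNIV"
      using K by (auto simp: colourings_def)
    fix p assume p: "p \<in> points G"
    let ?C = "cyc S p"
    have C: "?C \<in> cycles G S"
      using p by (rule cycle_of_in_cycles)
    then have "p \<in> cyc S (mark S ?C)"
      using cycle_of_eq[OF mark_in[OF S C]] cycle_of_self by simp
    then show "K p = K' p"
      by (rule coherent_eq_on_cycle[rotated 2]) (use K * C in \<open>auto simp: colourings_def\<close>)
  qed
qed simp

lemma proj_coloured:
  assumes "S \<in> states G" "K \<in> colourings S" "K' \<in> colourings S"
  shows "proj S K (coloured S K') = (if K = K' then coloured S K else 0)"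
  unfolding proj_def coloured_def factorwise_V_mult_tensor
  using colourings_eq_iff[OF assms] set_ord[OF assms(1)] by simp

lemma subspace_state_space: "vec.subspace (state_space ord S)"
  unfolding state_space_def by (rule subspace_keys)

lemma coloured_state_space: "coloured S K \<in> state_space ord S"
  using keys_tensor[of "map (\<lambda>C. cidem (K (mark S C))) (ord S)"] by (simp add: coloured_def state_space_def)

text \<open>Tensors of idempotents span the state space. The colours of their factors can be
  prescribed at the marked points, and they extend to a coherent colouring.\<close>

lemma state_space_span:
  assumes S: "S \<in> states G"
  shows "state_space ord S \<subseteq> vec.span (coloured S ` colourings S)"
proof
  fix v assume v: "v \<in> state_space ord S"
  let ?n = "length (ord S)"
  have T: "tensor (map (\<lambda>b. cidem b) bs) \<in> coloured S ` colourings S" if bs: "length bs = ?n" for bs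
  proof -
    define col where "col C = the (map_of (zip (ord S) bs) C)" for C
    have col: "map col (ord S) = bs"
      by (rule nth_equalityI) (use bs distinct_ord[OF S] in \<open>auto simp: col_def map_of_zip_nth\<close>)
    obtain K where K: "coherent S K" "\<And>C. C \<in> cycles G S \<Longrightarrow> K (mark S C) = col C"
      using coherent_prescribed[of S "mark S" col] mark_in[OF S] by blast
    have "restrict K (points G) \<in> colourings S"
      using K(1) by (auto simp: colourings_def coherent_def ends_points)
    moreover have "map (\<lambda>C. cidem (restrict K (points G) (mark S C))) (ord S) = map (\<lambda>b. cidem b) (map col (ord S))"
      using K(2) mark_points[OF S] by (simp add: set_ord[OF S])
    then have "coloured S (restrict K (points G)) = tensor (map (\<lambda>b. cidem b) bs)"
      unfolding coloured_def col by simp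
    ultimately show ?thesis
      by (metis image_eqI)
  qed
  have "basis_vec w \<in> vec.span (coloured S ` colourings S)" if "length w = ?n" for w
    using basis_vec_in_span_cidem[of w] vec.span_mono[of "{tensor (map (\<lambda>b. cidem b) bs) | bs. length bs = length w}"] T that
    by (smt (verit) mem_Collect_eq subset_iff)
  then have "basis_vec ` Poly_Mapping.keys v \<subseteq> vec.span (coloured S ` colourings S)"
    using v by (auto simp: state_space_def)
  then have "vec.span (basis_vec ` Poly_Mapping.keys v) \<subseteq> vec.span (coloured S ` colourings S)"
    by (intro vec.span_minimal vec.subspace_span)
  then show "v \<in> vec.span (coloured S ` colourings S)"
    using in_span_basis_vec by blast
qed

lemma vlinear_eq_on_state_space:
  assumes "S \<in> states G" "vlinear f" "vlinear g" "\<And>K. K \<in> colourings S \<Longrightarrow> f (coloured S K) = g (coloured S K)"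
    and "v \<in> state_space ord S"
  shows "f v = g v"
  by (rule vlin.linear_eq_on[OF assms(2,3), of v "coloured S ` colourings S"])
    (use assms state_space_span in auto)

lemma coord_coloured:
  assumes "S \<in> states G" "K \<in> colourings S" "K' \<in> colourings S"
  shows "coord S K (coloured S K') = (if K = K' then 1 else 0)"
  unfolding coord_def proj_coloured[OF assms]
  by (auto simp: coloured_def lookup_tensor_cidem power_one_over simp del: colour_idem.simps)

lemma coord_add: "coord S K (u + v) = coord S K u + coord S K v"
  and coord_scale: "coord S K (vscale c v) = c * coord S K v"
  by (simp_all add: coord_def vlin_simps[OF vlinear_proj]
      lookup_add lookup_vscale algebra_simps)

lemma vlinear_coord: "vlinear f \<Longrightarrow> vlinear (\<lambda>v. vscale (coord S K (f v) * c) x)"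
  by (rule vlinearI)
    (simp_all add: vlin.linear_add vlin.linear_scale coord_add coord_scale vec.scale_left_distrib algebra_simps)

lemma proj_eq_coord:
  assumes "S \<in> states G" "K \<in> colourings S" "v \<in> state_space ord S"
  shows "proj S K v = vscale (coord S K v) (coloured S K)"
proof -
  have "proj S K v = vscale (coord S K v * 1) (coloured S K)"
    by (rule vlinear_eq_on_state_space[OF assms(1) vlinear_proj vlinear_coord[OF vlinear_id(1)] _ assms(3)])
      (use assms in \<open>auto simp: proj_coloured coord_coloured\<close>)
  then show ?thesis
    by simp
qed

end

section \<open>The complex in the basis of coloured states\<close>

context khovanov_data
begin

abbreviation KL :: "('c state \<times> word) kcomplex" where
  "KL \<equiv> khovanov_lee G ord mark"

abbreviation chains :: "int \<Rightarrow> ('c state \<times> word) vec set" where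
  "chains i \<equiv> fst (fst KL i)"

abbreviation diff :: "int \<Rightarrow> ('c state \<times> word) vec \<Rightarrow> ('c state \<times> word) vec" where
  "diff i \<equiv> snd KL i"

definition states_at :: "int \<Rightarrow> 'c state set" where
  "states_at i = {S \<in> states G. hom_degree G S = i}"

definition basis_at :: "int \<Rightarrow> ('c state \<times> ('c point \<Rightarrow> bool)) set" where
  "basis_at i = (SIGMA S : states_at i. colourings S)"

definition gen_of :: "'c state \<times> ('c point \<Rightarrow> bool) \<Rightarrow> ('c state \<times> word) vec" where
  "gen_of k = inject (fst k) (coloured (fst k) (snd k))"

text \<open>The directions of the cube spanned by a colouring; it is the same for all states in
  which the colouring is coherent.\<close>

definition monochromatic :: "('c point \<Rightarrow> bool) \<Rightarrow> 'c set" where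
  "monochromatic K = {\<tau> \<in> crossings G. mono_at K \<tau>}"

lemma finite_states_at: "finite (states_at i)"
  using finite_states by (simp add: states_at_def)

lemma finite_basis_at: "finite (basis_at i)"
  by (simp add: basis_at_def finite_states_at finite_colourings)

lemma finite_monochromatic: "finite (monochromatic K)"
  using finite_crossings by (simp add: monochromatic_def)

lemma states_at_D: "S \<in> states_at i \<Longrightarrow> S \<in> states G"
  by (simp add: states_at_def)

lemma KL_obj: "fst KL i = kar_sum (states_at i) (\<lambda>S. (state_space ord S, id))"
  by (simp add: khovanov_lee_def states_at_def)

lemma chains_eq: "chains i = {v. Poly_Mapping.keys v \<subseteq> states_at i \<times> UNIV \<and>
    (\<forall>S\<in>states_at i. component S v \<in> state_space ord S)}"
  by (simp add: KL_obj kar_sum_def)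

lemma subspace_chains: "vec.subspace (chains i)"
  unfolding KL_obj by (rule subspace_kar_sum) (simp add: subspace_state_space)

lemma inject_chains: "S \<in> states_at i \<Longrightarrow> v \<in> state_space ord S \<Longrightarrow> inject S v \<in> chains i"
  unfolding KL_obj by (rule inject_in_kar_sum) (auto simp: subspace_state_space)

lemma gen_of_chains: "k \<in> basis_at i \<Longrightarrow> gen_of k \<in> chains i"
  unfolding gen_of_def by (intro inject_chains coloured_state_space) (auto simp: basis_at_def)

lemma chains_span: "chains i \<subseteq> vec.span (gen_of ` basis_at i)"
proof
  fix v assume v: "v \<in> chains i"
  have "inject S (component S v) \<in> vec.span (gen_of ` basis_at i)" if S: "S \<in> states_at i" for S
  proof (rule vlinear_into_span[OF vlinear_inject _ vec.subspace_span])
    show "component S v \<in> vec.span (coloured S ` colourings S)"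
      using state_space_span[OF states_at_D[OF S]] v S by (auto simp: chains_eq)
    fix x assume "x \<in> coloured S ` colourings S"
    then obtain K where "x = coloured S K" "K \<in> colourings S"
      by blast
    then have "inject S x = gen_of (S, K)" "(S, K) \<in> basis_at i"
      using S by (auto simp: gen_of_def basis_at_def)
    then show "inject S x \<in> vec.span (gen_of ` basis_at i)"
      by (metis vec.span_base image_eqI)
  qed
  then have "(\<Sum>S\<in>states_at i. inject S (component S v)) \<in> vec.span (gen_of ` basis_at i)"
    by (intro vec.span_sum)
  then show "v \<in> vec.span (gen_of ` basis_at i)"
    using sum_inject_component[OF finite_states_at, of v i] v by (simp add: chains_eq)
qed

lemma vlinear_eq_on_chains:
  assumes "vlinear f" "vlinear g" "\<And>k. k \<in> basis_at i \<Longrightarrow> f (gen_of k) = g (gen_of k)" "v \<in> chains i"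
  shows "f v = g v"
  by (rule vlin.linear_eq_on[OF assms(1,2), of v "gen_of ` basis_at i"]) (use assms chains_span in auto)

lemma vlinear_chains_into:
  assumes "vlinear f" "\<And>k. k \<in> basis_at i \<Longrightarrow> f (gen_of k) \<in> W" "vec.subspace W" "v \<in> chains i"
  shows "f v \<in> W"
  by (rule vlinear_into_span[OF assms(1) _ assms(3), of "gen_of ` basis_at i"]) (use assms chains_span in auto)

lemma KL_idem: "v \<in> chains i \<Longrightarrow> snd (fst KL i) v = v"
  unfolding KL_obj by (rule kar_sum_id[OF finite_states_at])

lemma diff_eq: "diff i v = (\<Sum>S\<in>states_at i. \<Sum>\<tau>\<in>crossings G - S.
    inject (insert \<tau> S) (partial_diff G ord mark S \<tau> (component S v)))"
  by (simp add: khovanov_lee_def states_at_def)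

lemma vlinear_diff: "vlinear (diff i)"
  unfolding diff_eq[abs_def]
  by (intro vlinear_sum vlinear_compose[OF _ vlinear_inject] vlinear_compose[OF _ vlinear_partial_diff]
      vlinear_component)

lemma basis_at_D:
  assumes "(S, K) \<in> basis_at i"
  shows "S \<in> states_at i" "S \<in> states G" "K \<in> colourings S" "coherent S K"
  using assms by (auto simp: basis_at_def states_at_def colourings_def)

lemma diff_gen_of:
  assumes k: "(S, K) \<in> basis_at i"
  shows "diff i (gen_of (S, K)) =
    (\<Sum>\<tau>\<in>monochromatic K - S. vscale (of_int (edge S K \<tau>)) (gen_of (insert \<tau> S, K)))"
proof -
  note S = basis_at_D[OF k]
  let ?pd = "\<lambda>T \<tau>. inject (insert \<tau> T) (partial_diff G ord mark T \<tau> (component T (gen_of (S, K))))"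
  have "(\<Sum>\<tau>\<in>crossings G - T. ?pd T \<tau>) = 0" if "T \<noteq> S" for T
    using that by (simp add: gen_of_def component_inject vlin.linear_0[OF vlinear_partial_diff]
        vlin.linear_0[OF vlinear_inject])
  then have "diff i (gen_of (S, K)) = (\<Sum>T\<in>states_at i. if T = S then (\<Sum>\<tau>\<in>crossings G - S. ?pd S \<tau>) else 0)"
    unfolding diff_eq by (intro sum.cong) auto
  also have "\<dots> = (\<Sum>\<tau>\<in>crossings G - S. ?pd S \<tau>)"
    using finite_states_at S(1) by simp
  also have "\<dots> = (\<Sum>\<tau>\<in>crossings G - S. if \<tau> \<in> monochromatic K then vscale (of_int (edge S K \<tau>)) (gen_of (insert \<tau> S, K)) else 0)"
    using S by (intro sum.cong) (auto simp: gen_of_def component_inject monochromatic_def partial_diff_mono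
        partial_diff_not_mono vlin.linear_0[OF vlinear_inject] vlin.linear_scale[OF vlinear_inject])
  also have "\<dots> = (\<Sum>\<tau>\<in>(crossings G - S) \<inter> monochromatic K. vscale (of_int (edge S K \<tau>)) (gen_of (insert \<tau> S, K)))"
    using finite_crossings by (intro sum.inter_restrict[symmetric]) auto
  also have "(crossings G - S) \<inter> monochromatic K = monochromatic K - S"
    by (auto simp: monochromatic_def)
  finally show ?thesis .
qed

lemma colourings_agree_off:
  "K \<in> colourings S \<Longrightarrow> mono_at K \<tau> \<Longrightarrow> agree_off \<tau> S S' \<Longrightarrow> K \<in> colourings S'"
  using coherent_agree_off by (auto simp: colourings_def)

lemma hom_degree_insert:
  assumes "S \<in> states G" "\<tau> \<notin> S"
  shows "hom_degree G (insert \<tau> S) = hom_degree G S + 1"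
proof -
  have "finite S"
    using assms finite_crossings by (auto simp: states_def intro: finite_subset)
  then show ?thesis
    using assms by (simp add: hom_degree_def)
qed

lemma basis_at_insert:
  assumes "(S, K) \<in> basis_at i" "\<tau> \<in> monochromatic K - S"
  shows "(insert \<tau> S, K) \<in> basis_at (i + 1)"
  using assms colourings_agree_off[OF _ _ agree_off_insert(1)] hom_degree_insert
  by (auto simp: basis_at_def states_at_def monochromatic_def insert_states)

text \<open>The cube of a colouring is closed under steps backwards as well, which gives the
  homotopy its values.\<close>

lemma basis_at_remove:
  assumes k: "(S, K) \<in> basis_at i" and \<tau>: "\<tau> \<in> monochromatic K" "\<tau> \<in> S"
  shows "(S - {\<tau>}, K) \<in> basis_at (i - 1)"
proof -
  have S: "insert \<tau> (S - {\<tau>}) = S"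
    using \<tau> by auto
  have "S - {\<tau>} \<in> states G"
    using basis_at_D(2)[OF k] by (auto simp: states_def)
  moreover have "hom_degree G (S - {\<tau>}) = i - 1"
    using hom_degree_insert[OF calculation, of \<tau>] k S by (auto simp: basis_at_def states_at_def)
  moreover have "agree_off \<tau> S (S - {\<tau>})"
    using agree_off_insert(2)[of \<tau> "S - {\<tau>}"] unfolding S .
  then have "K \<in> colourings (S - {\<tau>})"
    using colourings_agree_off[OF basis_at_D(3)[OF k]] \<tau> unfolding monochromatic_def by blast
  ultimately show ?thesis
    by (simp add: basis_at_def states_at_def)
qed

lemma diff_chains: "v \<in> chains i \<Longrightarrow> diff i v \<in> chains (i + 1)"
proof (rule vlinear_chains_into[OF vlinear_diff _ subspace_chains])
  fix k assume k: "k \<in> basis_at i"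
  obtain S K where [simp]: "k = (S, K)"
    by (cases k)
  show "diff i (gen_of k) \<in> chains (i + 1)"
    using diff_gen_of[of S K i] k basis_at_insert[of S K i]
    by (auto intro!: vec.subspace_sum[OF subspace_chains] vec.subspace_scale[OF subspace_chains] gen_of_chains)
qed

lemma edge_anticommute':
  assumes "(S, K) \<in> basis_at i" "\<sigma> \<in> monochromatic K - S" "\<tau> \<in> monochromatic K - S" "\<sigma> \<noteq> \<tau>"
  shows "edge S K \<sigma> * edge (insert \<sigma> S) K \<tau> = - (edge S K \<tau> * edge (insert \<tau> S) K \<sigma>)"
  using assms basis_at_D[OF assms(1)] by (intro edge_anticommute) (auto simp: monochromatic_def)

text \<open>Adding \<open>\<sigma>\<close> and then \<open>\<tau>\<close> leads to the same vector
  as the opposite order, with the opposite scalar.\<close>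

lemma diff_diff: "v \<in> chains i \<Longrightarrow> diff (i + 1) (diff i v) = 0"
proof (rule vlinear_eq_on_chains[OF vlinear_compose[OF vlinear_diff vlinear_diff] vlinear_zero])
  fix k assume k: "k \<in> basis_at i"
  obtain S K where [simp]: "k = (S, K)"
    by (cases k)
  let ?N = "monochromatic K - S"
  \<comment> \<open>The diagonal is filled with zeros so that both sums run over \<open>?N\<close>
    and antisymmetry can be applied.\<close>
  let ?g = "\<lambda>\<sigma> \<tau>. if \<tau> = \<sigma> then 0 else
    vscale (of_int (edge S K \<sigma> * edge (insert \<sigma> S) K \<tau>)) (gen_of (insert \<tau> (insert \<sigma> S), K))"
  have fin: "finite ?N"
    using finite_monochromatic by simp
  have "diff (i + 1) (gen_of (insert \<sigma> S, K)) =
      (\<Sum>\<tau>\<in>?N. if \<tau> = \<sigma> then 0 else vscale (of_int (edge (insert \<sigma> S) K \<tau>)) (gen_of (insert \<tau> (insert \<sigma> S), K)))"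
    if \<sigma>: "\<sigma> \<in> ?N" for \<sigma>
  proof -
    have "(insert \<sigma> S, K) \<in> basis_at (i + 1)"
      using basis_at_insert k \<sigma> by simp
    moreover have "monochromatic K - insert \<sigma> S = ?N - {\<sigma>}"
      by auto
    ultimately show ?thesis
      using fin \<sigma> by (simp add: diff_gen_of sum.remove[of ?N \<sigma>])
  qed
  then have "diff (i + 1) (diff i (gen_of k)) = (\<Sum>\<sigma>\<in>?N. \<Sum>\<tau>\<in>?N. ?g \<sigma> \<tau>)"
    using k by (simp add: diff_gen_of vlin_simps[OF vlinear_diff]
        vec.scale_sum_right if_distrib cong: if_cong)
  also have "\<dots> = 0"
  proof (rule sum_antisymmetric_zero)
    fix \<sigma> \<tau> assume "\<sigma> \<in> ?N" "\<tau> \<in> ?N"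
    then show "?g \<tau> \<sigma> = - ?g \<sigma> \<tau>"
      using edge_anticommute'[of S K i \<tau> \<sigma>] k
      by (auto simp: insert_commute vec.scale_minus_left simp flip: of_int_mult)
  qed
  finally show "diff (i + 1) (diff i (gen_of k)) = 0" .
qed

text \<open>The idempotents of this complex are identities, so compatibility with them is
  automatic.\<close>

lemma kar_hom_chains:
  assumes "vlinear f" "\<And>u. u \<in> chains i \<Longrightarrow> f u \<in> chains j"
  shows "kar_hom (fst KL i) (fst KL j) f"
  using assms KL_idem by (auto simp: kar_hom_def intro: linear_betweenI)

lemma kar_complex_KL: "kar_complex KL"
  unfolding kar_complex_def
proof (intro conjI allI ballI)
  show "kar_obj (fst KL i)" for i
    unfolding KL_obj
    by (rule kar_obj_kar_sum[OF finite_states_at])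
      (auto simp: kar_obj_def subspace_state_space intro: linear_betweenI)
  show "kar_hom (fst KL i) (fst KL (i + 1)) (diff i)" for i
    by (rule kar_hom_chains[OF vlinear_diff diff_chains])
  show "diff (i + 1) (diff i u) = 0" if "u \<in> chains i" for i u
    using that by (rule diff_diff)
qed

subsection \<open>The contracting homotopy\<close>

text \<open>Chosen from the colouring alone, hence the same direction at all vertices of its
  cube.\<close>

definition pivot :: "('c point \<Rightarrow> bool) \<Rightarrow> 'c" where
  "pivot K = (SOME \<tau>. \<tau> \<in> monochromatic K)"

lemma pivot_monochromatic: "monochromatic K \<noteq> {} \<Longrightarrow> pivot K \<in> monochromatic K"
  unfolding pivot_def by (rule some_in_eq[THEN iffD2])

text \<open>One step back in the direction of the pivot, divided by the scalar of the edge;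
  \<open>coord\<close> extracts the coefficients with respect to the coloured basis.\<close>

definition homotopy :: "int \<Rightarrow> ('c state \<times> word) vec \<Rightarrow> ('c state \<times> word) vec" where
  "homotopy i v = (\<Sum>(S, K) | (S, K) \<in> basis_at i \<and> monochromatic K \<noteq> {} \<and> pivot K \<in> S.
     vscale (coord S K (component S v) * inverse (of_int (edge (S - {pivot K}) K (pivot K))))
       (gen_of (S - {pivot K}, K)))"

lemma vlinear_homotopy: "vlinear (homotopy i)"
proof -
  have "vlinear (\<lambda>v. case k of (S, K) \<Rightarrow> vscale (coord S K (component S v) *
      inverse (of_int (edge (S - {pivot K}) K (pivot K)))) (gen_of (S - {pivot K}, K)))" for k
    by (cases k) (simp add: vlinear_coord vlinear_component)
  then show ?thesis
    unfolding homotopy_def[abs_def] by (intro vlinear_sum)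
qed

lemma coord_zero: "coord S K 0 = 0"
  using coord_scale[of S K 0 0] by simp

lemma homotopy_gen_of:
  assumes k: "(S, K) \<in> basis_at i"
  shows "homotopy i (gen_of (S, K)) = (if monochromatic K \<noteq> {} \<and> pivot K \<in> S
    then vscale (inverse (of_int (edge (S - {pivot K}) K (pivot K)))) (gen_of (S - {pivot K}, K)) else 0)"
proof -
  let ?I = "{(S, K). (S, K) \<in> basis_at i \<and> monochromatic K \<noteq> {} \<and> pivot K \<in> S}"
  let ?x = "\<lambda>(S, K). vscale (inverse (of_int (edge (S - {pivot K}) K (pivot K)))) (gen_of (S - {pivot K}, K))"
  have fin: "finite ?I"
    by (rule finite_subset[OF _ finite_basis_at[of i]]) auto
  have "coord T \<mu> (component T (gen_of (S, K))) = (if (T, \<mu>) = (S, K) then 1 else 0)"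
    if "(T, \<mu>) \<in> basis_at i" for T \<mu>
    using basis_at_D[OF k] basis_at_D[OF that] by (auto simp: gen_of_def component_inject coord_zero coord_coloured)
  then have "homotopy i (gen_of (S, K)) = (\<Sum>k\<in>?I. if k = (S, K) then ?x k else 0)"
    unfolding homotopy_def
  proof (intro sum.cong refl)
    fix x assume "x \<in> ?I"
    then obtain T \<mu> where x: "x = (T, \<mu>)" "(T, \<mu>) \<in> basis_at i"
      by blast
    show "(case x of (S', \<mu>) \<Rightarrow> vscale (coord S' \<mu> (component S' (gen_of (S, K))) *
        inverse (of_int (edge (S' - {pivot \<mu>}) \<mu> (pivot \<mu>)))) (gen_of (S' - {pivot \<mu>}, \<mu>))) =
      (if x = (S, K) then ?x x else 0)"
      using \<open>\<And>T \<mu>. (T, \<mu>) \<in> basis_at i \<Longrightarrow> coord T \<mu> (component T (gen_of (S, K))) =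
        (if (T, \<mu>) = (S, K) then 1 else 0)\<close>[OF x(2)] unfolding x(1) by (cases "(T, \<mu>) = (S, K)") auto
  qed
  also have "\<dots> = (if (S, K) \<in> ?I then ?x (S, K) else 0)"
    using fin by (simp add: sum.delta)
  finally show ?thesis
    using k by simp
qed

lemma homotopy_chains: "v \<in> chains i \<Longrightarrow> homotopy i v \<in> chains (i - 1)"
proof (rule vlinear_chains_into[OF vlinear_homotopy _ subspace_chains])
  fix k assume k: "k \<in> basis_at i"
  obtain S K where [simp]: "k = (S, K)"
    by (cases k)
  show "homotopy i (gen_of k) \<in> chains (i - 1)"
    using homotopy_gen_of[of S K i] k basis_at_remove[of S K i "pivot K"] pivot_monochromatic[of K]
    by (auto intro!: vec.subspace_scale[OF subspace_chains] gen_of_chains simp: vec.subspace_0[OF subspace_chains])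
qed

text \<open>In the pivot direction a cube is the cone of an isomorphism. The edge of the pivot
  yields the vector itself, and all other edges cancel by anticommutation.\<close>

lemma homotopy_identity:
  assumes k: "(S, K) \<in> basis_at i"
  shows "diff (i - 1) (homotopy i (gen_of (S, K))) + homotopy (i + 1) (diff i (gen_of (S, K))) =
    (if monochromatic K = {} then 0 else gen_of (S, K))"
proof (cases "monochromatic K = {}")
  case True
  then show ?thesis
    using k by (simp add: homotopy_gen_of diff_gen_of vlin.linear_0[OF vlinear_diff] vlin.linear_0[OF vlinear_homotopy])
next
  case False
  let ?p = "pivot K"
  have p: "?p \<in> monochromatic K"
    using False by (rule pivot_monochromatic)
  have hd: "homotopy (i + 1) (diff i (gen_of (S, K))) = (\<Sum>\<tau>\<in>monochromatic K - S. if ?p \<in> insert \<tau> S then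
      vscale (of_int (edge S K \<tau>) * inverse (of_int (edge (insert \<tau> S - {?p}) K ?p))) (gen_of (insert \<tau> S - {?p}, K)) else 0)"
    unfolding diff_gen_of[OF k] vlin.linear_sum[OF vlinear_homotopy] vlin.linear_scale[OF vlinear_homotopy]
    by (intro sum.cong refl) (simp add: False homotopy_gen_of[OF basis_at_insert[OF k]])
  show ?thesis
  proof (cases "?p \<in> S")
    \<comment> \<open>Among the states reached by the differential only \<open>insert ?p S\<close>
      contains the pivot, and the homotopy undoes exactly this edge.\<close>
    case pS: False
    then have "homotopy i (gen_of (S, K)) = 0"
      using homotopy_gen_of[OF k] by simp
    moreover have "homotopy (i + 1) (diff i (gen_of (S, K))) = gen_of (S, K)"
    proof -
      have "edge S K ?p \<noteq> 0"
        using basis_at_D(2)[OF k] p by (intro edge_nonzero) (auto simp: monochromatic_def)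
      moreover have "insert ?p S - {?p} = S"
        using pS by auto
      moreover have "homotopy (i + 1) (diff i (gen_of (S, K))) = (\<Sum>\<tau>\<in>monochromatic K - S. if \<tau> = ?p then
          vscale (of_int (edge S K ?p) * inverse (of_int (edge (insert ?p S - {?p}) K ?p)))
            (gen_of (insert ?p S - {?p}, K)) else 0)"
        unfolding hd using pS by (intro sum.cong) auto
      ultimately show ?thesis
        using p pS finite_monochromatic by simp
    qed
    ultimately show ?thesis
      using False by (simp add: vlin.linear_0[OF vlinear_diff])
  next
    case pS: True
    let ?T = "S - {?p}"
    have T: "insert ?p ?T = S" "?p \<notin> ?T"
      using pS by auto
    have kT: "(?T, K) \<in> basis_at (i - 1)"
      using basis_at_remove[OF k p pS] .
    let ?e = "\<lambda>S \<tau>. of_int (edge S K \<tau>) :: rat"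
    have eT: "edge ?T K \<tau> \<noteq> 0" if "\<tau> \<in> monochromatic K" for \<tau>
      using basis_at_D(2)[OF kT] that by (intro edge_nonzero) (auto simp: monochromatic_def)
    have NT: "monochromatic K - ?T = insert ?p (monochromatic K - S)"
      using p pS by auto
    have "diff (i - 1) (homotopy i (gen_of (S, K))) =
        vscale (inverse (?e ?T ?p)) (\<Sum>\<tau>\<in>monochromatic K - ?T. vscale (?e ?T \<tau>) (gen_of (insert \<tau> ?T, K)))"
      using False pS by (simp add: homotopy_gen_of[OF k] vlin.linear_scale[OF vlinear_diff] diff_gen_of[OF kT])
    also have "\<dots> = gen_of (S, K) +
        (\<Sum>\<tau>\<in>monochromatic K - S. vscale (inverse (?e ?T ?p) * ?e ?T \<tau>) (gen_of (insert \<tau> ?T, K)))"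
      unfolding NT using finite_monochromatic pS eT[OF p]
      by (simp add: vec.scale_right_distrib insert_absorb vec.scale_sum_right)
    finally have dh: "diff (i - 1) (homotopy i (gen_of (S, K))) = gen_of (S, K) +
        (\<Sum>\<tau>\<in>monochromatic K - S. vscale (inverse (?e ?T ?p) * ?e ?T \<tau>) (gen_of (insert \<tau> ?T, K)))" .
    have "homotopy (i + 1) (diff i (gen_of (S, K))) =
        (\<Sum>\<tau>\<in>monochromatic K - S. - vscale (inverse (?e ?T ?p) * ?e ?T \<tau>) (gen_of (insert \<tau> ?T, K)))"
      unfolding hd
    proof (rule sum.cong[OF refl])
      fix \<tau> assume \<tau>: "\<tau> \<in> monochromatic K - S"
      then have ne: "\<tau> \<noteq> ?p" and \<tau>T: "\<tau> \<in> monochromatic K - ?T" and pT: "?p \<in> monochromatic K - ?T"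
        using pS p by auto
      have ins: "insert \<tau> S - {?p} = insert \<tau> ?T"
        using ne by auto
      \<comment> \<open>This is the square over \<open>?T\<close> in the directions
        \<open>?p\<close> and \<open>\<tau>\<close>; adding \<open>?p\<close> to \<open>?T\<close>
        gives \<open>S\<close>.\<close>
      have "edge ?T K ?p * edge S K \<tau> = - (edge ?T K \<tau> * edge (insert \<tau> ?T) K ?p)"
        using edge_anticommute'[OF kT pT \<tau>T] ne unfolding T(1) by blast
      then have "?e ?T ?p * ?e S \<tau> = - (?e ?T \<tau> * ?e (insert \<tau> ?T) ?p)"
        by (simp flip: of_int_mult of_int_minus)
      moreover have "?e ?T ?p \<noteq> 0"
        using eT[OF p] by simp
      moreover have "edge (insert \<tau> ?T) K ?p \<noteq> 0"
        using basis_at_D(2)[OF basis_at_insert[OF kT \<tau>T]] p by (intro edge_nonzero) (auto simp: monochromatic_def)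
      ultimately have "?e S \<tau> * inverse (?e (insert \<tau> ?T) ?p) = - (inverse (?e ?T ?p) * ?e ?T \<tau>)"
        by (simp add: field_simps)
      then show "(if ?p \<in> insert \<tau> S then vscale (?e S \<tau> * inverse (?e (insert \<tau> S - {?p}) ?p))
            (gen_of (insert \<tau> S - {?p}, K)) else 0) =
          - vscale (inverse (?e ?T ?p) * ?e ?T \<tau>) (gen_of (insert \<tau> ?T, K))"
        using pS by (simp add: ins vec.scale_minus_left)
    qed
    then show ?thesis
      using False dh by (simp add: sum_negf)
  qed
qed

end

context khovanov_data
begin

subsection \<open>Alternately coloured smoothings\<close>

definition colouring_of :: "'c state \<times> ('c point set \<Rightarrow> colour) \<Rightarrow> 'c point \<Rightarrow> bool" where
  "colouring_of s = (\<lambda>p\<in>points G. snd s (arc_of G (fst s) p) = Red)"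

lemma arc_of_eq: "travel G S p 0 q \<Longrightarrow> arc_of G S q = arc_of G S p"
  unfolding arc_of_def using travel_trans[of S p 0 q 0] travel_trans[of S q 0 p 0] travel_sym[of S p 0 q]
  by auto

lemma colour_neqD: "x \<noteq> y \<Longrightarrow> (x = Red) \<noteq> (y = Red)"
  by (cases x; cases y) auto

lemma alternately_coloured_D:
  assumes "s \<in> alternately_coloured G"
  shows "fst s \<in> states G" "snd s \<in> arcs G (fst s) \<rightarrow>\<^sub>E UNIV"
    "\<And>p q. semi_arc G p q \<Longrightarrow> cut p q \<Longrightarrow> snd s (arc_of G (fst s) p) \<noteq> snd s (arc_of G (fst s) q)"
    "\<And>c. c \<in> crossings G \<Longrightarrow>
      snd s (arc_of G (fst s) (point1 G (fst s) c)) \<noteq> snd s (arc_of G (fst s) (point2 G (fst s) c))"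
  using assms by (auto simp: alternately_coloured_def)

lemma colouring_of_colourings:
  assumes s: "s \<in> alternately_coloured G"
  shows "colouring_of s \<in> colourings (fst s)"
proof -
  have "(colouring_of s (partner p) \<noteq> colouring_of s p) = cut p (partner p)" if p: "p \<in> ends" for p
  proof (cases "cut p (partner p)")
    case True
    have "semi_arc G p (partner p) \<or> semi_arc G (partner p) p"
      using p adj_iff[of p "partner p"] by (simp add: adj_def)
    then have "snd s (arc_of G (fst s) p) \<noteq> snd s (arc_of G (fst s) (partner p))"
      using alternately_coloured_D(3)[OF s] True cut_sym by metis
    from colour_neqD[OF this] show ?thesis
      using True p by (simp add: colouring_of_def ends_points)
  next
    case False
    then have "arc_of G (fst s) (partner p) = arc_of G (fst s) p"
      using travel_arc[OF travel.start p, of "fst s"] by (intro arc_of_eq) simp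
    then show ?thesis
      using False p by (simp add: colouring_of_def ends_points)
  qed
  moreover have "colouring_of s (strand_end (fst s) p) = colouring_of s p" if p: "p \<in> ends" for p
    using arc_of_eq[OF travel_strand[OF travel.start p]] p by (simp add: colouring_of_def ends_points)
  ultimately show ?thesis
    by (auto simp: colourings_def coherent_def) (simp_all add: colouring_of_def)
qed

lemma point12_ends: "c \<in> crossings G \<Longrightarrow> point1 G S c \<in> ends" "c \<in> crossings G \<Longrightarrow> point2 G S c \<in> ends"
  by (simp_all add: point1_def point2_def)

lemma monochromatic_colouring_of:
  assumes s: "s \<in> alternately_coloured G"
  shows "monochromatic (colouring_of s) = {}"
proof -
  have "\<not> mono_at (colouring_of s) c" if c: "c \<in> crossings G" for c
    using mono_at_iff[of "fst s" "colouring_of s" c] colouring_of_colourings[OF s] c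
      colour_neqD[OF alternately_coloured_D(4)[OF s c]] point12_ends[OF c]
    by (simp add: colourings_def colouring_of_def ends_points)
  then show ?thesis
    by (auto simp: monochromatic_def)
qed

lemma arcs_colour:
  assumes "p \<in> points G"
  shows "snd s (arc_of G (fst s) p) = (if colouring_of s p then Red else Green)"
  using assms by (cases "snd s (arc_of G (fst s) p)") (simp_all add: colouring_of_def)

lemma colouring_of_inj:
  assumes "s \<in> alternately_coloured G" "t \<in> alternately_coloured G" "fst s = fst t" "colouring_of s = colouring_of t"
  shows "s = t"
proof (rule prod_eqI)
  show "snd s = snd t"
  proof (rule PiE_ext)
    show "snd s \<in> arcs G (fst s) \<rightarrow>\<^sub>E UNIV" "snd t \<in> arcs G (fst s) \<rightarrow>\<^sub>E UNIV"
      using alternately_coloured_D(2) assms by metis+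
    show "snd s X = snd t X" if "X \<in> arcs G (fst s)" for X
      using that arcs_colour[of _ s] arcs_colour[of _ t] assms(3,4) by (auto simp: arcs_def)
  qed
qed (fact assms(3))

text \<open>A coherent colouring is constant on arcs, so any point of an arc may stand for it. The
  absence of monochromatic crossings is the condition that the two strands differ at each crossing.
  Thus the smoothings correspond to the cubes that are points.\<close>

lemma colouring_of_surj:
  assumes S: "S \<in> states G" and K: "K \<in> colourings S" and no: "monochromatic K = {}"
  obtains s where "s \<in> alternately_coloured G" "fst s = S" "colouring_of s = K"
proof -
  define col where "col = (\<lambda>X\<in>arcs G S. if K (SOME p. p \<in> X) then Red else Green)"
  have coh: "coherent S K"
    using K by (simp add: colourings_def)
  have col: "col (arc_of G S p) = (if K p then Red else Green)" if p: "p \<in> points G" for p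
  proof -
    have "p \<in> arc_of G S p"
      using travel.start by (simp add: arc_of_def)
    then have "(SOME q. q \<in> arc_of G S p) \<in> arc_of G S p"
      by (rule someI)
    then have "K (SOME q. q \<in> arc_of G S p) = K p"
      using coherent_travel[OF coh, of p 0] by (simp add: arc_of_def)
    then show ?thesis
      using p by (simp add: col_def arcs_def)
  qed
  have "col (arc_of G S p) \<noteq> col (arc_of G S q)" if pq: "semi_arc G p q" "cut p q" for p q
  proof -
    have "p \<in> ends" "q \<in> ends" "q = partner p"
      using semi_arc_ends[OF pq(1)] adj_iff[of p q] pq(1) by (auto simp: adj_def)
    then show ?thesis
      using coh pq(2) col[of p] col[of q] by (auto simp: coherent_def ends_points)
  qed
  moreover have "col (arc_of G S (point1 G S c)) \<noteq> col (arc_of G S (point2 G S c))" if c: "c \<in> crossings G" for c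
  proof -
    have "K (point1 G S c) \<noteq> K (point2 G S c)"
      using mono_at_iff[OF coh c] no c by (auto simp: monochromatic_def)
    then show ?thesis
      using col point12_ends[OF c] by (auto simp: ends_points)
  qed
  ultimately have "(S, col) \<in> alternately_coloured G"
    using S by (auto simp: alternately_coloured_def col_def)
  moreover have "colouring_of (S, col) = K"
  proof (rule PiE_ext)
    show "colouring_of (S, col) \<in> points G \<rightarrow>\<^sub>E UNIV" "K \<in> points G \<rightarrow>\<^sub>E UNIV"
      using K by (auto simp: colouring_of_def colourings_def)
    show "colouring_of (S, col) p = K p" if "p \<in> points G" for p
      using that col by (simp add: colouring_of_def)
  qed
  ultimately show ?thesis
    by (intro that[of "(S, col)"]) auto
qed

definition alt_at :: "int \<Rightarrow> ('c state \<times> ('c point set \<Rightarrow> colour)) set" where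
  "alt_at i = {s \<in> alternately_coloured G. hom_degree G (fst s) = i}"

definition alt_proj :: "'c state \<times> ('c point set \<Rightarrow> colour) \<Rightarrow> word vec \<Rightarrow> word vec" where
  "alt_proj s = proj (fst s) (colouring_of s)"

definition alt_gen :: "'c state \<times> ('c point set \<Rightarrow> colour) \<Rightarrow> word vec" where
  "alt_gen s = coloured (fst s) (colouring_of s)"

lemma alt_at_D:
  assumes "s \<in> alt_at i"
  shows "s \<in> alternately_coloured G" "fst s \<in> states_at i" "(fst s, colouring_of s) \<in> basis_at i"
  using assms alternately_coloured_D(1) colouring_of_colourings
  by (auto simp: alt_at_def states_at_def basis_at_def)

lemma finite_alternately_coloured: "finite (alternately_coloured G)"
proof -
  have "inj_on (\<lambda>s. (fst s, colouring_of s)) (alternately_coloured G)"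
    using colouring_of_inj by (auto intro!: inj_onI)
  moreover have "(\<lambda>s. (fst s, colouring_of s)) ` alternately_coloured G \<subseteq> (SIGMA S : states G. colourings S)"
    using alternately_coloured_D(1) colouring_of_colourings by blast
  ultimately show ?thesis
    using finite_states finite_colourings by (meson finite_SigmaI inj_on_finite)
qed

lemma finite_alt_at: "finite (alt_at i)"
  using finite_alternately_coloured by (simp add: alt_at_def)

lemma colour_obj_eq:
  assumes s: "s \<in> alternately_coloured G"
  shows "colour_obj G ord mark s = (state_space ord (fst s), alt_proj s)"
proof -
  obtain S col where [simp]: "s = (S, col)"
    by (cases s)
  have S: "S \<in> states G"
    using alternately_coloured_D(1)[OF s] by simp
  have "col (arc_of G S (mark S C)) = (if colouring_of s (mark S C) then Red else Green)" if "C \<in> set (ord S)" for C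
    using arcs_colour[of "mark S C" s] that mark_points[OF S] by (simp add: set_ord[OF S])
  then show ?thesis
    by (simp add: colour_obj_def alt_proj_def proj_def cong: map_cong)
qed

lemma vlinear_alt_proj: "vlinear (alt_proj s)"
  by (simp add: alt_proj_def vlinear_proj)

lemma alt_proj_eq:
  assumes "s \<in> alternately_coloured G" "v \<in> state_space ord (fst s)"
  shows "alt_proj s v = vscale (coord (fst s) (colouring_of s) v) (alt_gen s)"
  unfolding alt_proj_def alt_gen_def
  by (rule proj_eq_coord[OF alternately_coloured_D(1)[OF assms(1)] colouring_of_colourings[OF assms(1)] assms(2)])

lemma alt_proj_alt_gen:
  assumes "s \<in> alternately_coloured G" "t \<in> alternately_coloured G" "fst s = fst t"
  shows "alt_proj s (alt_gen t) = (if s = t then alt_gen t else 0)"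
  using proj_coloured[of "fst s" "colouring_of s" "colouring_of t"] colouring_of_inj[OF assms]
    alternately_coloured_D(1)[OF assms(1)] colouring_of_colourings[OF assms(1)] colouring_of_colourings[OF assms(2)]
    assms(3)
  by (auto simp: alt_proj_def alt_gen_def)

lemma alt_proj_state_space:
  "s \<in> alternately_coloured G \<Longrightarrow> v \<in> state_space ord (fst s) \<Longrightarrow> alt_proj s v \<in> state_space ord (fst s)"
  by (simp add: alt_proj_eq vec.subspace_scale[OF subspace_state_space] alt_gen_def coloured_state_space)

lemma alt_proj_alt_proj:
  assumes "s \<in> alternately_coloured G" "t \<in> alternately_coloured G" "fst s = fst t" "v \<in> state_space ord (fst t)"
  shows "alt_proj s (alt_proj t v) = (if s = t then alt_proj t v else 0)"
  using assms by (simp add: alt_proj_eq[of t] vlin.linear_scale[OF vlinear_alt_proj] alt_proj_alt_gen)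

lemma kar_obj_colour_obj:
  assumes s: "s \<in> alternately_coloured G"
  shows "kar_obj (colour_obj G ord mark s)"
  using alt_proj_state_space[OF s] alt_proj_alt_proj[OF s s refl]
  by (auto simp: colour_obj_eq[OF s] kar_obj_def subspace_state_space vlinear_alt_proj intro!: linear_betweenI)

text \<open>The image of the idempotent is the line through \<open>alt_gen s\<close>. Taking the
  coordinate and multiplying this vector are inverse to each other in the Karoubi envelope, where
  the identity is the idempotent.\<close>

lemma kar_iso_ground:
  assumes s: "s \<in> alternately_coloured G"
  shows "kar_iso (colour_obj G ord mark s) ground_obj"
proof -
  let ?c = "coord (fst s) (colouring_of s)"
  have c: "?c (alt_gen s) = 1"
    using coord_coloured[OF alternately_coloured_D(1)[OF s] colouring_of_colourings[OF s] colouring_of_colourings[OF s]]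
    by (simp add: alt_gen_def)
  have unit: "vscale (coef u ()) (basis_vec ()) = u" for u :: "unit vec"
    by (rule poly_mapping_eqI) (simp add: lookup_vscale)
  have f: "vlinear (\<lambda>v. vscale (?c v) (basis_vec ()))"
    using vlinear_coord[OF vlinear_id(1), of "fst s" "colouring_of s" 1] by simp
  have g: "vlinear (\<lambda>u :: unit vec. vscale (coef u ()) (alt_gen s))"
    by (rule vlinearI) (simp_all add: lookup_add lookup_vscale vec.scale_left_distrib)
  have gen: "alt_gen s \<in> state_space ord (fst s)"
    by (simp add: alt_gen_def coloured_state_space)
  have ground: "kar_obj ground_obj"
    by (auto simp: ground_obj_def kar_obj_def intro: linear_betweenI)
  show ?thesis
    unfolding kar_iso_def
  proof (intro conjI kar_obj_colour_obj[OF s] ground exI)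
    show "kar_hom (colour_obj G ord mark s) ground_obj (\<lambda>v. vscale (?c v) (basis_vec ()))"
      using f s c by (auto simp: kar_hom_def colour_obj_eq ground_obj_def alt_proj_eq coord_scale intro!: linear_betweenI)
    show "kar_hom ground_obj (colour_obj G ord mark s) (\<lambda>u. vscale (coef u ()) (alt_gen s))"
      using g s gen by (auto simp: kar_hom_def colour_obj_eq ground_obj_def vlin.linear_scale[OF vlinear_alt_proj]
          alt_proj_alt_gen vec.subspace_scale[OF subspace_state_space] intro!: linear_betweenI)
    show "\<forall>u\<in>fst (colour_obj G ord mark s). vscale (coef (vscale (?c u) (basis_vec ())) ()) (alt_gen s) =
        snd (colour_obj G ord mark s) u"
      using s by (simp add: colour_obj_eq alt_proj_eq lookup_vscale)
    show "\<forall>w\<in>fst ground_obj. vscale (?c (vscale (coef w ()) (alt_gen s))) (basis_vec ()) =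
        snd ground_obj w"
      by (simp add: ground_obj_def coord_scale c unit)
  qed
qed

subsection \<open>The homotopy equivalence\<close>

abbreviation target :: "int \<Rightarrow> (('c state \<times> ('c point set \<Rightarrow> colour)) \<times> word) kobj" where
  "target i \<equiv> kar_sum (alt_at i) (colour_obj G ord mark)"

text \<open>A summand of the target is a whole state space with an idempotent, not its image;
  applying \<open>alt_proj\<close> makes the map compatible with the idempotents.\<close>

definition to_target :: "int \<Rightarrow> ('c state \<times> word) vec \<Rightarrow> (('c state \<times> ('c point set \<Rightarrow> colour)) \<times> word) vec" where
  "to_target i v = (\<Sum>s\<in>alt_at i. inject s (alt_proj s (component (fst s) v)))"

definition from_target :: "int \<Rightarrow> (('c state \<times> ('c point set \<Rightarrow> colour)) \<times> word) vec \<Rightarrow> ('c state \<times> word) vec" where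
  "from_target i w = (\<Sum>s\<in>alt_at i. inject (fst s) (alt_proj s (component s w)))"

lemma vlinear_to_target: "vlinear (to_target i)"
  unfolding to_target_def[abs_def]
  by (intro vlinear_sum vlinear_compose[OF _ vlinear_inject] vlinear_compose[OF _ vlinear_alt_proj] vlinear_component)

lemma vlinear_from_target: "vlinear (from_target i)"
  unfolding from_target_def[abs_def]
  by (intro vlinear_sum vlinear_compose[OF _ vlinear_inject] vlinear_compose[OF _ vlinear_alt_proj] vlinear_component)

lemma target_component: "w \<in> fst (target i) \<Longrightarrow> s \<in> alt_at i \<Longrightarrow> component s w \<in> state_space ord (fst s)"
  using alt_at_D(1) by (auto simp: kar_sum_def colour_obj_eq)

lemma chains_component: "v \<in> chains i \<Longrightarrow> s \<in> alt_at i \<Longrightarrow> component (fst s) v \<in> state_space ord (fst s)"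
  using alt_at_D(2) by (auto simp: chains_eq)

lemma target_idem: "snd (target i) w = (\<Sum>s\<in>alt_at i. inject s (alt_proj s (component s w)))"
  using alt_at_D(1) by (auto simp: kar_sum_def colour_obj_eq intro!: sum.cong)

lemma subspace_target: "vec.subspace (fst (target i))"
  by (rule subspace_kar_sum) (use alt_at_D(1) in \<open>auto simp: colour_obj_eq subspace_state_space\<close>)

lemma inject_target: "s \<in> alt_at i \<Longrightarrow> v \<in> state_space ord (fst s) \<Longrightarrow> inject s v \<in> fst (target i)"
  by (rule inject_in_kar_sum) (use alt_at_D(1) in \<open>auto simp: colour_obj_eq subspace_state_space\<close>)

lemma to_target_into: "v \<in> chains i \<Longrightarrow> to_target i v \<in> fst (target i)"
  unfolding to_target_def
  by (intro vec.subspace_sum[OF subspace_target] inject_target alt_proj_state_space chains_component alt_at_D(1))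

lemma from_target_into: "w \<in> fst (target i) \<Longrightarrow> from_target i w \<in> chains i"
  unfolding from_target_def
  by (intro vec.subspace_sum[OF subspace_chains] inject_chains alt_proj_state_space target_component alt_at_D(1,2))

lemma target_idem_to_target: "v \<in> chains i \<Longrightarrow> snd (target i) (to_target i v) = to_target i v"
  unfolding target_idem to_target_def
  using finite_alt_at alt_at_D(1) chains_component
  by (intro sum.cong refl) (simp add: component_sum_inject alt_proj_alt_proj)

lemma from_target_target_idem: "w \<in> fst (target i) \<Longrightarrow> from_target i (snd (target i) w) = from_target i w"
  unfolding target_idem from_target_def
  using finite_alt_at alt_at_D(1) target_component
  by (intro sum.cong refl) (simp add: component_sum_inject alt_proj_alt_proj)

lemma diff_alt_gen:
  assumes "s \<in> alt_at i"
  shows "diff i (inject (fst s) (alt_gen s)) = 0"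
  using diff_gen_of[OF alt_at_D(3)[OF assms]] monochromatic_colouring_of[OF alt_at_D(1)[OF assms]]
  by (simp add: gen_of_def alt_gen_def)

lemma diff_from_target: "w \<in> fst (target i) \<Longrightarrow> diff i (from_target i w) = 0"
  unfolding from_target_def
  using alt_at_D(1) target_component
  by (auto simp: vlin.linear_sum[OF vlinear_diff] alt_proj_eq vlin.linear_scale[OF vlinear_diff]
      vlin.linear_scale[OF vlinear_inject] diff_alt_gen intro!: sum.neutral)

lemma to_target_gen_of:
  assumes k: "(S, K) \<in> basis_at i"
  shows "to_target i (gen_of (S, K)) =
    (\<Sum>s\<in>alt_at i. if fst s = S \<and> colouring_of s = K then inject s (coloured S K) else 0)"
  unfolding to_target_def
proof (intro sum.cong refl)
  fix s assume s: "s \<in> alt_at i"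
  have "alt_proj s (coloured S K) = (if colouring_of s = K then coloured S K else 0)" if "fst s = S"
    using proj_coloured[of S "colouring_of s" K] basis_at_D[OF k] basis_at_D(3)[OF alt_at_D(3)[OF s]] that
    by (auto simp: alt_proj_def)
  then show "inject s (alt_proj s (component (fst s) (gen_of (S, K)))) =
      (if fst s = S \<and> colouring_of s = K then inject s (coloured S K) else 0)"
    by (auto simp: gen_of_def component_inject vlin.linear_0[OF vlinear_alt_proj] vlin.linear_0[OF vlinear_inject])
qed

lemma to_target_mono:
  assumes "(S, K) \<in> basis_at i" "monochromatic K \<noteq> {}"
  shows "to_target i (gen_of (S, K)) = 0"
proof -
  have "\<not> (fst s = S \<and> colouring_of s = K)" if "s \<in> alt_at i" for s
    using monochromatic_colouring_of[OF alt_at_D(1)[OF that]] assms(2) by blast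
  then show ?thesis
    unfolding to_target_gen_of[OF assms(1)] by (intro sum.neutral) auto
qed

lemma to_target_alt:
  assumes "s \<in> alt_at i"
  shows "to_target i (inject (fst s) (alt_gen s)) = inject s (alt_gen s)"
proof -
  have "fst t = fst s \<and> colouring_of t = colouring_of s \<longleftrightarrow> t = s" if "t \<in> alt_at i" for t
    using colouring_of_inj[OF alt_at_D(1)[OF that] alt_at_D(1)[OF assms]] by auto
  then have "to_target i (inject (fst s) (alt_gen s)) = (\<Sum>t\<in>alt_at i. if t = s then inject s (alt_gen s) else 0)"
    using to_target_gen_of[OF alt_at_D(3)[OF assms]] by (auto simp: gen_of_def alt_gen_def intro!: sum.cong)
  then show ?thesis
    using finite_alt_at assms by simp
qed

lemma from_target_alt:
  assumes "s \<in> alt_at i"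
  shows "from_target i (inject s (alt_gen s)) = inject (fst s) (alt_gen s)"
proof -
  have "from_target i (inject s (alt_gen s)) =
      (\<Sum>t\<in>alt_at i. if t = s then inject (fst s) (alt_gen s) else 0)"
    unfolding from_target_def
    by (intro sum.cong refl) (auto simp: component_inject vlin.linear_0[OF vlinear_alt_proj]
        vlin.linear_0[OF vlinear_inject] alt_proj_alt_gen alt_at_D(1)[OF assms])
  then show ?thesis
    using finite_alt_at assms by simp
qed

text \<open>The differential keeps the colouring and moves along monochromatic crossings, so its
  values never involve an isolated vertex.\<close>

lemma to_target_diff: "v \<in> chains i \<Longrightarrow> to_target (i + 1) (diff i v) = 0"
proof (rule vlinear_eq_on_chains[OF vlinear_compose[OF vlinear_diff vlinear_to_target] vlinear_zero])
  fix k assume k: "k \<in> basis_at i"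
  obtain S K where [simp]: "k = (S, K)"
    by (cases k)
  have "to_target (i + 1) (gen_of (insert \<tau> S, K)) = 0" if "\<tau> \<in> monochromatic K - S" for \<tau>
    using to_target_mono[OF basis_at_insert[OF _ that]] k that by auto
  then show "to_target (i + 1) (diff i (gen_of k)) = 0"
    using k by (simp add: diff_gen_of vlin_simps[OF vlinear_to_target])
qed

text \<open>On an alternately coloured state the composite is the identity and the homotopy part
  vanishes; on every other coloured state it is the reverse.\<close>

lemma from_to_target:
  "v \<in> chains i \<Longrightarrow> from_target i (to_target i v) + (diff (i - 1) (homotopy i v) + homotopy (i + 1) (diff i v)) = v"
proof (rule vlinear_eq_on_chains[of "\<lambda>v. from_target i (to_target i v) +
      (diff (i - 1) (homotopy i v) + homotopy (i + 1) (diff i v))" "\<lambda>v. v"])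
  show "vlinear (\<lambda>v. from_target i (to_target i v) + (diff (i - 1) (homotopy i v) + homotopy (i + 1) (diff i v)))"
    by (intro vlin.linear_compose_add vlinear_compose[OF vlinear_to_target vlinear_from_target]
        vlinear_compose[OF vlinear_homotopy vlinear_diff] vlinear_compose[OF vlinear_diff vlinear_homotopy])
  fix k assume k: "k \<in> basis_at i"
  obtain S K where kS: "k = (S, K)"
    by (cases k)
  show "from_target i (to_target i (gen_of k)) +
      (diff (i - 1) (homotopy i (gen_of k)) + homotopy (i + 1) (diff i (gen_of k))) = gen_of k"
  proof (cases "monochromatic K = {}")
    case False
    then show ?thesis
      using k homotopy_identity[of S K i] by (simp add: kS to_target_mono vlin.linear_0[OF vlinear_from_target])
  next
    case True
    obtain s where s: "s \<in> alternately_coloured G" "fst s = S" "colouring_of s = K"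
      using colouring_of_surj[OF _ _ True] basis_at_D[of S K i] k unfolding kS by blast
    then have "s \<in> alt_at i" "gen_of k = inject (fst s) (alt_gen s)"
      using k by (auto simp: kS alt_at_def basis_at_def states_at_def gen_of_def alt_gen_def)
    then have "from_target i (to_target i (gen_of k)) = gen_of k"
      by (simp add: to_target_alt from_target_alt)
    then show ?thesis
      using k True homotopy_identity[of S K i] by (simp add: kS)
  qed
qed simp

lemma to_from_target: "w \<in> fst (target i) \<Longrightarrow> to_target i (from_target i w) = snd (target i) w"
  unfolding from_target_def target_idem
  using alt_at_D(1) target_component
  by (auto simp: vlin.linear_sum[OF vlinear_to_target] alt_proj_eq vlin.linear_scale[OF vlinear_to_target]
      vlin.linear_scale[OF vlinear_inject] to_target_alt intro!: sum.cong)

lemma kar_hom_zero: "kar_hom (target i) (target j) (\<lambda>w. 0)"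
  using vlin.linear_0[OF vlinear_kar_sum[of "alt_at j" "colour_obj G ord mark"]] alt_at_D(1)
  by (auto simp: kar_hom_def colour_obj_eq vlinear_alt_proj vec.subspace_0[OF subspace_target]
      intro!: linear_betweenI vlinear_zero)

lemma homotopy_equivalent_target: "homotopy_equivalent KL (target, \<lambda>i v. 0)"
  unfolding homotopy_equivalent_def
proof (intro conjI exI)
  show "kar_complex KL"
    by (rule kar_complex_KL)
  have "kar_obj (target i)" for i
  proof (rule kar_obj_kar_sum[OF finite_alt_at])
    fix s assume "s \<in> alt_at i"
    then have "s \<in> alternately_coloured G"
      by (rule alt_at_D(1))
    then show "kar_obj (colour_obj G ord mark s)" "vlinear (snd (colour_obj G ord mark s))"
      using kar_obj_colour_obj vlinear_alt_proj by (simp_all add: colour_obj_eq)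
  qed
  then show "kar_complex (target, \<lambda>i v. 0)"
    by (simp add: kar_complex_def kar_hom_zero)
  show "chain_map KL (target, \<lambda>i v. 0) to_target"
    unfolding chain_map_def
  proof (intro conjI allI ballI)
    show "kar_hom (fst KL i) (fst (target, \<lambda>i v. 0) i) (to_target i)" for i
      by (auto simp: kar_hom_def KL_idem target_idem_to_target to_target_into intro!: linear_betweenI vlinear_to_target)
    show "to_target (i + 1) (diff i u) = snd (target, \<lambda>i v. 0) i (to_target i u)" if "u \<in> chains i" for i u
      using to_target_diff[OF that] by simp
  qed
  show "chain_map (target, \<lambda>i v. 0) KL from_target"
    unfolding chain_map_def
  proof (intro conjI allI ballI)
    show "kar_hom (fst (target, \<lambda>i v. 0) i) (fst KL i) (from_target i)" for i
      by (auto simp: kar_hom_def KL_idem from_target_target_idem from_target_into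
          intro!: linear_betweenI vlinear_from_target)
    show "from_target (i + 1) (snd (target, \<lambda>i v. 0) i u) = diff i (from_target i u)"
      if "u \<in> fst (fst (target, \<lambda>i v. 0) i)" for i u
      using diff_from_target[of u i] that by (simp add: vlin.linear_0[OF vlinear_from_target])
  qed
  show "chain_homotopic KL KL (\<lambda>i. from_target i \<circ> to_target i) (\<lambda>i. snd (fst KL i))"
    unfolding chain_homotopic_def
  \<comment> \<open>The minus sign appears since \<open>chain_homotopic\<close> asks for the
    composite minus the identity.\<close>
  proof (intro exI[of _ "\<lambda>i v. - homotopy i v"] conjI allI ballI)
    have neg: "vlinear (\<lambda>v. - homotopy i v)" for i
      by (intro vlin.linear_compose_neg vlinear_homotopy)
    show "kar_hom (fst KL i) (fst KL (i - 1)) (\<lambda>v. - homotopy i v)" for i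
      by (rule kar_hom_chains[OF neg]) (intro vec.subspace_neg[OF subspace_chains] homotopy_chains)
    show "(from_target i \<circ> to_target i) u - snd (fst KL i) u =
        diff (i - 1) (- homotopy i u) + - homotopy (i + 1) (diff i u)" if u: "u \<in> chains i" for i u
    proof -
      have "from_target i (to_target i u) = u - (diff (i - 1) (homotopy i u) + homotopy (i + 1) (diff i u))"
        using from_to_target[OF u] by (simp add: eq_diff_eq)
      then show ?thesis
        by (simp add: KL_idem[OF u] vlin.linear_neg[OF vlinear_diff])
    qed
  qed
  show "chain_homotopic (target, \<lambda>i v. 0) (target, \<lambda>i v. 0) (\<lambda>i. to_target i \<circ> from_target i)
      (\<lambda>i. snd (fst (target, \<lambda>i v. 0) i))"
    unfolding chain_homotopic_def
    by (intro exI[of _ "\<lambda>i v. 0"]) (auto simp: kar_hom_zero to_from_target)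
qed

end

subsection \<open>The abstract diagram of a virtual link diagram\<close>

lemma plane_det_swap: "plane_det v u = - plane_det u v"
  by (simp add: plane_det_def)

text \<open>The determinant is antisymmetric and nonzero, so exactly one of the two preimages sees
  the other cross to its left, and both definite descriptions denote.\<close>

lemma passages:
  assumes D: "virtual_link_diagram D" and c: "c \<in> classical D"
  shows "preimages D c = {passage D c True, passage D c False}" "passage D c True \<noteq> passage D c False"
proof -
  let ?d = "\<lambda>p q. plane_det (velocity D p) (velocity D q)"
  have "c \<in> double_points D"
    using D c by (auto simp: virtual_link_diagram_def)
  then have card: "card (preimages D c) = 2"
    and det: "\<And>p q. p \<in> preimages D c \<Longrightarrow> q \<in> preimages D c \<Longrightarrow> p \<noteq> q \<Longrightarrow> ?d p q \<noteq> 0"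
    using D by (auto simp: virtual_link_diagram_def)
  obtain p0 q0 where pq0: "preimages D c = {p0, q0}" "p0 \<noteq> q0"
    using card by (auto simp: card_2_iff)
  then have "?d p0 q0 > 0 \<or> ?d q0 p0 > 0"
    using det[of p0 q0] plane_det_swap[of "velocity D p0" "velocity D q0"] by auto
  then obtain p q where pq: "preimages D c = {p, q}" "p \<noteq> q" "?d p q > 0"
    using pq0 by (metis insert_commute)
  have z: "?d x x = 0" for x
    by (simp add: plane_det_def)
  have q: "?d q p < 0"
    using pq(3) plane_det_swap[of "velocity D q" "velocity D p"] by simp
  have "x \<in> preimages D c \<and> (\<exists>y\<in>preimages D c. ?d x y > 0) \<longleftrightarrow> x = p"
    "x \<in> preimages D c \<and> (\<exists>y\<in>preimages D c. ?d x y < 0) \<longleftrightarrow> x = q" for x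
    unfolding pq(1) using pq(3) q z[of p] z[of q] by auto
  then have "passage D c True = p" "passage D c False = q"
    by (simp_all add: passage_def)
  then show "preimages D c = {passage D c True, passage D c False}" "passage D c True \<noteq> passage D c False"
    using pq by auto
qed

lemma curve_add_int:
  assumes D: "virtual_link_diagram D" and i: "i < ncomps D"
  shows "curve D i (t + of_int k) = curve D i t"
proof -
  have per: "curve D i (t + 1) = curve D i t" for t
    using D i by (auto simp: virtual_link_diagram_def)
  have nat: "curve D i (t + of_nat n) = curve D i t" for t n
  proof (induction n)
    case (Suc n)
    have "t + of_nat (Suc n) = (t + of_nat n) + 1"
      by simp
    then show ?case
      using Suc per by (simp only:)
  qed simp
  show ?thesis
  proof (cases "k \<ge> 0")
    case True
    then show ?thesis
      using nat[of t "nat k"] by simp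
  next
    case False
    then show ?thesis
      using nat[of "t + of_int k" "nat (- k)"] by simp
  qed
qed

lemma curve_frac:
  assumes "virtual_link_diagram D" "i < ncomps D"
  shows "curve D i (frac t) = curve D i t"
  using curve_add_int[OF assms, of "frac t" "\<lfloor>t\<rfloor>"] by (simp add: frac_def)

definition passage_times :: "vdiagram \<Rightarrow> (nat \<times> real) set" where
  "passage_times D = {(i, t). i < ncomps D \<and> 0 \<le> t \<and> t < 1 \<and> curve D i t \<in> classical D}"

lemma finite_classical: "virtual_link_diagram D \<Longrightarrow> finite (classical D)"
  by (auto simp: virtual_link_diagram_def intro: finite_subset)

lemma bij_betw_passage:
  assumes D: "virtual_link_diagram D"
  shows "bij_betw (\<lambda>(c, r). passage D c r) (classical D \<times> UNIV) (passage_times D)"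
proof -
  have eq: "passage_times D = (\<Union>c\<in>classical D. preimages D c)"
    by (auto simp: passage_times_def preimages_def)
  have disj: "p \<in> preimages D c \<Longrightarrow> p \<in> preimages D c' \<Longrightarrow> c = c'" for p c c'
    by (auto simp: preimages_def)
  have mem: "passage D c r \<in> preimages D c" if "c \<in> classical D" for c r
    using passages(1)[OF D that] by (cases r) auto
  show ?thesis
  proof (rule bij_betw_imageI)
    show "inj_on (\<lambda>(c, r). passage D c r) (classical D \<times> UNIV)"
    proof (rule inj_onI, clarify)
      fix c r c' r'
      assume c: "c \<in> classical D" "c' \<in> classical D" and eq: "passage D c r = passage D c' r'"
      then have "c = c'"
        using disj[OF mem[OF c(1), of r]] mem[OF c(2), of r'] by simp
      then show "c = c' \<and> r = r'"
        using eq passages(2)[OF D c(1)] by (cases r; cases r') auto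
    qed
    show "(\<lambda>(c, r). passage D c r) ` (classical D \<times> UNIV) = passage_times D"
    proof
      show "(\<lambda>(c, r). passage D c r) ` (classical D \<times> UNIV) \<subseteq> passage_times D"
        using mem by (auto simp: eq)
      show "passage_times D \<subseteq> (\<lambda>(c, r). passage D c r) ` (classical D \<times> UNIV)"
        using passages(1)[OF D] by (force simp: eq)
    qed
  qed
qed

lemma finite_passage_times: "virtual_link_diagram D \<Longrightarrow> finite (passage_times D)"
  using bij_betw_finite[OF bij_betw_passage] finite_classical by auto

text \<open>After one full turn the curve passes the same crossing again, so a next passage exists,
  and within one period there are only finitely many.\<close>

lemma next_time:
  assumes D: "virtual_link_diagram D" and i: "i < ncomps D" and t: "curve D i t \<in> classical D"
  shows "t < next_time D i t" "curve D i (next_time D i t) \<in> classical D"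
    "\<And>u. t < u \<Longrightarrow> u < next_time D i t \<Longrightarrow> curve D i u \<notin> classical D"
proof -
  let ?T = "{s. t < s \<and> s \<le> t + 1 \<and> curve D i s \<in> classical D}"
  have "?T \<subseteq> (\<lambda>((j, u), k). u + of_int k) ` (passage_times D \<times> {\<lfloor>t\<rfloor>..\<lfloor>t + 1\<rfloor>})"
  proof
    fix s assume s: "s \<in> ?T"
    then have "(i, frac s) \<in> passage_times D"
      using i by (simp add: passage_times_def frac_ge_0 frac_lt_1 curve_frac[OF D i])
    moreover have "t \<le> s" "s \<le> t + 1"
      using s by auto
    then have "\<lfloor>s\<rfloor> \<in> {\<lfloor>t\<rfloor>..\<lfloor>t + 1\<rfloor>}"
      using floor_mono[of t s] floor_mono[of s "t + 1"] by (simp only: atLeastAtMost_iff)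
    moreover have "s = frac s + of_int \<lfloor>s\<rfloor>"
      by (simp add: frac_def)
    ultimately show "s \<in> (\<lambda>((j, u), k). u + of_int k) ` (passage_times D \<times> {\<lfloor>t\<rfloor>..\<lfloor>t + 1\<rfloor>})"
      by (intro rev_image_eqI[of "((i, frac s), \<lfloor>s\<rfloor>)"]) auto
  qed
  then have fin: "finite ?T"
    by (rule finite_subset) (intro finite_imageI finite_cartesian_product finite_passage_times[OF D] finite_atLeastAtMost_int)
  have "t + 1 \<in> ?T"
    using t curve_add_int[OF D i, of t 1] by simp
  then have ne: "?T \<noteq> {}"
    by blast
  define s where "s = Min ?T"
  have s: "s \<in> ?T"
    unfolding s_def by (rule Min_in[OF fin ne])
  have least: "curve D i u \<notin> classical D" if "t < u" "u < s" for u
    using Min_le[OF fin, of u] that s by (auto simp: s_def[symmetric])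
  have "next_time D i t = s"
    unfolding next_time_def
  proof (rule the_equality)
    show "t < s \<and> curve D i s \<in> classical D \<and> (\<forall>u. t < u \<and> u < s \<longrightarrow> curve D i u \<notin> classical D)"
      using s least by simp
    show "s' = s" if "t < s' \<and> curve D i s' \<in> classical D \<and> (\<forall>u. t < u \<and> u < s' \<longrightarrow> curve D i u \<notin> classical D)" for s'
      using that s least[of s'] by (cases s' s rule: linorder_cases) auto
  qed
  then show "t < next_time D i t" "curve D i (next_time D i t) \<in> classical D"
    "\<And>u. t < u \<Longrightarrow> u < next_time D i t \<Longrightarrow> curve D i u \<notin> classical D"
    using s least by auto
qed

text \<open>Shift one passage by an integer so that the next times coincide. Neither passage can
  then lie strictly between the other and this common time, so they are equal; as both times lie in
  \<open>[0, 1)\<close>, the shift is 0.\<close>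

lemma next_time_inj:
  assumes D: "virtual_link_diagram D" and t: "(i, t) \<in> passage_times D" "(i, t') \<in> passage_times D"
    and eq: "frac (next_time D i t) = frac (next_time D i t')"
  shows "t = t'"
proof -
  have i: "i < ncomps D" and T: "curve D i t \<in> classical D" "curve D i t' \<in> classical D"
    and range: "0 \<le> t" "t < 1" "0 \<le> t'" "t' < 1"
    using t by (auto simp: passage_times_def)
  let ?s = "next_time D i t" and ?s' = "next_time D i t'"
  define k where "k = \<lfloor>?s'\<rfloor> - \<lfloor>?s\<rfloor>"
  have s': "?s' = ?s + of_int k"
    using eq by (simp add: frac_def k_def)
  have "curve D i (t + of_int k) \<in> classical D" "curve D i (t' + of_int (- k)) \<in> classical D"
    using T by (simp_all only: curve_add_int[OF D i])
  then have "\<not> t' < t + of_int k" "\<not> t < t' + of_int (- k)"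
    using next_time(1)[OF D i T(1)] next_time(1)[OF D i T(2)] s'
      next_time(3)[OF D i T(2), of "t + of_int k"] next_time(3)[OF D i T(1), of "t' + of_int (- k)"]
    by auto
  then have "t' = t + of_int k"
    by simp
  moreover from this have "k = 0"
    using range by linarith
  ultimately show ?thesis
    by simp
qed

text \<open>A crossing has just two passages, so the test for the \<open>True\<close> strand in
  \<open>next_passage\<close> also identifies the \<open>False\<close> one when it fails.\<close>

lemma passage_next_passage:
  assumes D: "virtual_link_diagram D" and c: "c \<in> classical D" and p: "passage D c r = (i, t)"
    and n: "next_passage D (c, r) = (c', r')"
  shows "c' \<in> classical D" "passage D c' r' = (i, frac (next_time D i t))" "(i, t) \<in> passage_times D"
proof -
  show t: "(i, t) \<in> passage_times D"
    using bspec[OF bij_betwE[OF bij_betw_passage[OF D]], of "(c, r)"] c p by simp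
  then have i: "i < ncomps D" and T: "curve D i t \<in> classical D"
    by (auto simp: passage_times_def)
  let ?s = "next_time D i t"
  have n': "c' = curve D i ?s" "r' = (passage D c' True = (i, frac ?s))"
    using n p by (auto simp: next_passage_def Let_def)
  show c': "c' \<in> classical D"
    unfolding n'(1) by (rule next_time(2)[OF D i T])
  have "(i, frac ?s) \<in> preimages D c'"
    using i by (simp add: preimages_def n'(1) frac_ge_0 frac_lt_1 curve_frac[OF D i])
  then show "passage D c' r' = (i, frac ?s)"
    using passages[OF D c'] n'(2) by (cases r') auto
qed

lemma bij_betw_next_passage:
  assumes D: "virtual_link_diagram D"
  shows "bij_betw (next_passage D) (classical D \<times> UNIV) (classical D \<times> UNIV)"
proof -
  have fin: "finite (classical D \<times> (UNIV :: bool set))"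
    using finite_classical[OF D] by simp
  have into: "next_passage D ` (classical D \<times> UNIV) \<subseteq> classical D \<times> UNIV"
    using passage_next_passage(1)[OF D] by (auto, metis surj_pair)
  have "inj_on (next_passage D) (classical D \<times> UNIV)"
  proof (rule inj_onI)
    fix x y assume x: "x \<in> classical D \<times> UNIV" and y: "y \<in> classical D \<times> UNIV"
      and eq: "next_passage D x = next_passage D y"
    obtain c r d u where xy: "x = (c, r)" "y = (d, u)"
      by (cases x; cases y)
    obtain i t j v where p: "passage D c r = (i, t)" "passage D d u = (j, v)"
      by (metis surj_pair)
    obtain c' r' where n: "next_passage D (c, r) = (c', r')" "next_passage D (d, u) = (c', r')"
      using eq xy by (metis surj_pair)
    note 1 = passage_next_passage[OF D _ p(1) n(1)] and 2 = passage_next_passage[OF D _ p(2) n(2)]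
    have ij: "i = j" "frac (next_time D i t) = frac (next_time D i v)"
      using 1(2) 2(2) x y by (auto simp: xy)
    then have "t = v"
      using next_time_inj[OF D, of i t v] 1(3) 2(3) x y by (simp add: xy)
    then have "passage D c r = passage D d u"
      using p ij by simp
    then show "x = y"
      using inj_onD[OF bij_betw_imp_inj_on[OF bij_betw_passage[OF D]], of "(c, r)" "(d, u)"] x y
      by (simp add: xy)
  qed
  then show ?thesis
    using into fin by (simp add: bij_betw_def endo_inj_surj)
qed

lemma diagram_abstract_of:
  assumes "virtual_link_diagram D"
  shows "diagram (abstract_of D)"
proof
  show "finite (crossings (abstract_of D))"
    using finite_classical[OF assms] by (simp add: abstract_of_def)
  show "finite (circles (abstract_of D))"
    by (simp add: abstract_of_def)
  show "bij_betw (next_pass (abstract_of D)) (crossings (abstract_of D) \<times> UNIV) (crossings (abstract_of D) \<times> UNIV)"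
    using bij_betw_next_passage[OF assms] by (simp add: abstract_of_def)
qed

theorem theorem4p2:
  fixes D :: vdiagram
    and ord :: "complex order_choice"
    and mark :: "complex mark_choice"
  defines "G \<equiv> abstract_of D"
  assumes "virtual_link_diagram D"
    and "global_orders G ord"
    and "marked_points G mark"
  shows "(\<forall>s\<in>alternately_coloured G. kar_iso (colour_obj G ord mark s) ground_obj) \<and>
    homotopy_equivalent (khovanov_lee G ord mark)
      (\<lambda>i. kar_sum {s \<in> alternately_coloured G. hom_degree G (fst s) = i} (colour_obj G ord mark),
       \<lambda>i v. 0)"
proof -
  interpret diagram G
    unfolding G_def by (rule diagram_abstract_of) fact
  interpret khovanov_data G ord mark
    by unfold_locales fact+
  show ?thesis
    using kar_iso_ground homotopy_equivalent_target by (simp add: alt_at_def)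
qed

end
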